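(* Assume that $\nu$ has a probability density $\rho\in\mathrm{BV}(\mathbb{R})$ and that there are constants $C,\alpha>0$ such that $|u(k)|\le C e^{-\alpha|k|_1}$ for all $k\in\mathbb{Z}^d$. Then there exist $C(u)>0$ and $I_0\in\mathbb{N}_0^d$, both depending only on $u$, such that for any $l\in\mathbb{N}$ and any bounded interval $I\subset\mathbb{R}$ $$\mathbb{E}\bigl(\operatorname{Tr}\chi_I(H_{\Lambda_l})\bigr)\le\lambda^{-1}C(u)\,\|\rho\|_{\rm Var}\,|I|\,(2l+1)^{2d+|I_0|}.$$ Here $I_0$ can be taken to be any multi-index with $(D_z^{I_0}F)(\mathbf{1})\ne0$ and $(D_z^{J}F)(\mathbf{1})=0$ for all $J<I_0$, where $F$ is the generating function of $u$ defined in the context.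
   Context: Discrete alloy-type model: $d\ge1$; $|\cdot|_1,|\cdot|_\infty$ are the $\ell^1$- and sup-norms on $\mathbb{Z}^d$. $\nu$ is a probability measure on $\mathbb{R}$ with compact support; $\Omega=\times_{k\in\mathbb{Z}^d}\mathbb{R}$ carries the product $\sigma$-algebra and $\mathbb{P}=\prod_{k}\nu$, so the coordinates $\omega_k$ are i.i.d. with law $\nu$; $\mathbb{E}$ is expectation. $u\in\ell^1(\mathbb{Z}^d;\mathbb{R})$ is the single-site potential with $0\in\operatorname{supp}u=\{k:u(k)\ne0\}$ (so $u\not\equiv0$). For $\lambda>0$, $H_\omega=-\Delta+\lambda V_\omega$ on $\ell^2(\mathbb{Z}^d)$, with $(\Delta\psi)(x)=\sum_{|e|_1=1}\psi(x+e)$ and $V_\omega$ multiplication by $V_\omega(x)=\sum_{k}\omega_k u(x-k)$. $\Lambda_l=\{k\in\mathbb{Z}^d:|k|_\infty\le l\}$, and $H_{\Lambda_l}$ is the compression of $H_\omega$ to $\ell^2(\Lambda_l)$ (a finite random matrix). $\chi_I(H_{\Lambda_l})$ is the spectral projection onto $I$, $|I|$ the length of $I$. $\mathrm{BV}(\mathbb{R})$ is the set of $f\in L^1(\mathbb{R})$ whose distributional derivative $Df$ is a signed Borel measure of finite total variation, and $\|f\|_{\rm Var}=|Df|(\mathbb{R})$. Multi-indices: for $I,J\in\mathbb{N}_0^d$, $|I|=\sum_r i_r$; $J\le I$ means $j_r\le i_r$ for all $r$; $J<I$ means $J\le I$ and $|J|<|I|$; $D_z^I=\partial_{z_1}^{i_1}\cdots\partial_{z_d}^{i_d}$;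 $\mathbf{1}=(1,\dots,1)$. Generating function: $F(z)=\sum_{k\in\mathbb{Z}^d}u(-k)z^k$ with $z^k=z_1^{k_1}\cdots z_d^{k_d}$, holomorphic for $z\in\mathbb{C}^d$ with $|z_j-1|<\delta$ for all $j$, where $\delta\in(0,1-e^{-\alpha})$. Since $F\not\equiv0$, a multi-index $I_0$ as in the claim exists. *)

theory Defs
  imports "HOL-Probability.Probability"
begin

text \<open>The lattice $\mathbb{Z}^d$ is \<open>int ^ 'd\<close> with \<open>d = CARD('d)\<close>.\<close>

definition norm1 :: "int ^ 'd \<Rightarrow> int" where
  "norm1 k = (\<Sum>j\<in>UNIV. \<bar>k $ j\<bar>)"

definition norm_sup :: "int ^ 'd \<Rightarrow> int" where
  "norm_sup k = Max (range (\<lambda>j. \<bar>k $ j\<bar>))"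

definition cube :: "nat \<Rightarrow> (int ^ 'd) set" where
  "cube l = {k. norm_sup k \<le> int l}"

definition lattice_laplacian :: "(int ^ 'd \<Rightarrow> complex) \<Rightarrow> int ^ 'd \<Rightarrow> complex" where
  "lattice_laplacian \<psi> x = (\<Sum>e\<in>{e. norm1 e = 1}. \<psi> (x + e))"

text \<open>The series is absolutely convergent for every bounded configuration \<open>\<omega>\<close>, hence almost
  surely if the coordinates are i.i.d. with compactly supported law. On the remaining null set
  the value of \<^const>\<open>infsum\<close> is irrelevant.\<close>

definition alloy_potential ::
    "(int ^ 'd \<Rightarrow> real) \<Rightarrow> (int ^ 'd \<Rightarrow> real) \<Rightarrow> int ^ 'd \<Rightarrow> real" where
  "alloy_potential u \<omega> x = (\<Sum>\<^sub>\<infinity>k. \<omega> k * u (x - k))"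

definition alloy_hamiltonian ::
    "real \<Rightarrow> (int ^ 'd \<Rightarrow> real) \<Rightarrow> (int ^ 'd \<Rightarrow> real)
      \<Rightarrow> (int ^ 'd \<Rightarrow> complex) \<Rightarrow> int ^ 'd \<Rightarrow> complex" where
  "alloy_hamiltonian lam u \<omega> \<psi> =
     (\<lambda>x. - lattice_laplacian \<psi> x + of_real (lam * alloy_potential u \<omega> x) * \<psi> x)"

text \<open>For a finite set \<open>\<Lambda>\<close>, the Hilbert space $\ell^2(\Lambda)$ is the set of all functions
  vanishing off \<open>\<Lambda>\<close>. Operators are functions that are only considered on this set.\<close>

definition ell2_on :: "'a set \<Rightarrow> ('a \<Rightarrow> complex) set" where
  "ell2_on \<Lambda> = {\<psi>. \<forall>x. x \<notin> \<Lambda> \<longrightarrow> \<psi> x = 0}"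

definition ell2_inner :: "'a set \<Rightarrow> ('a \<Rightarrow> complex) \<Rightarrow> ('a \<Rightarrow> complex) \<Rightarrow> complex" where
  "ell2_inner \<Lambda> \<phi> \<psi> = (\<Sum>x\<in>\<Lambda>. cnj (\<phi> x) * \<psi> x)"

definition compression ::
    "'a set \<Rightarrow> (('a \<Rightarrow> complex) \<Rightarrow> 'a \<Rightarrow> complex) \<Rightarrow> ('a \<Rightarrow> complex) \<Rightarrow> 'a \<Rightarrow> complex" where
  "compression \<Lambda> A \<psi> =
     (\<lambda>x. if x \<in> \<Lambda> then A (\<lambda>y. if y \<in> \<Lambda> then \<psi> y else 0) x else 0)"

definition ell2_trace :: "'a set \<Rightarrow> (('a \<Rightarrow> complex) \<Rightarrow> 'a \<Rightarrow> complex) \<Rightarrow> complex" where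
  "ell2_trace \<Lambda> A = (\<Sum>x\<in>\<Lambda>. ell2_inner \<Lambda> (indicator {x}) (A (indicator {x})))"

definition eigenspace_on ::
    "'a set \<Rightarrow> (('a \<Rightarrow> complex) \<Rightarrow> 'a \<Rightarrow> complex) \<Rightarrow> real \<Rightarrow> ('a \<Rightarrow> complex) set" where
  "eigenspace_on \<Lambda> A E = {\<psi> \<in> ell2_on \<Lambda>. A \<psi> = (\<lambda>x. of_real E * \<psi> x)}"

definition orth_proj_on ::
    "'a set \<Rightarrow> ('a \<Rightarrow> complex) set \<Rightarrow> ('a \<Rightarrow> complex) \<Rightarrow> 'a \<Rightarrow> complex" where
  "orth_proj_on \<Lambda> S \<psi> =
     (THE \<phi>. \<phi> \<in> S \<and> (\<forall>\<eta>\<in>S. ell2_inner \<Lambda> \<eta> (\<lambda>x. \<psi> x - \<phi> x) = 0))"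

text \<open>For a self-adjoint operator \<open>A\<close> on $\ell^2(\Lambda)$, \<open>\<Lambda>\<close> finite, this is
  $\chi_I(A) = \sum_{E \in \sigma(A)} \chi_I(E) P_E$, where $P_E$ is the orthogonal projection
  onto $\ker(A - E)$.\<close>

definition spectral_projection_on ::
    "'a set \<Rightarrow> (('a \<Rightarrow> complex) \<Rightarrow> 'a \<Rightarrow> complex) \<Rightarrow> real set
      \<Rightarrow> ('a \<Rightarrow> complex) \<Rightarrow> 'a \<Rightarrow> complex" where
  "spectral_projection_on \<Lambda> A I \<psi> =
     (\<lambda>x. \<Sum>E\<in>{E \<in> I. eigenspace_on \<Lambda> A E \<noteq> {\<lambda>_. 0}}.
        orth_proj_on \<Lambda> (eigenspace_on \<Lambda> A E) \<psi> x)"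

definition measure_support :: "real measure \<Rightarrow> real set" where
  "measure_support \<nu> = {x. \<forall>U. open U \<and> x \<in> U \<longrightarrow> emeasure \<nu> U > 0}"

text \<open>Only the values on Borel sets are relevant. Countable additivity includes
  \<open>\<mu> {} = 0\<close>, as a constant series can only converge if it vanishes.\<close>

definition signed_borel_measure :: "(real set \<Rightarrow> real) \<Rightarrow> bool" where
  "signed_borel_measure \<mu> \<longleftrightarrow>
     (\<forall>A. range A \<subseteq> sets borel \<and> disjoint_family A \<longrightarrow>
        (\<lambda>n::nat. \<mu> (A n)) sums \<mu> (\<Union>n. A n))"

text \<open>The positive part \<open>\<mu>\<^sup>+\<close> of the Jordan decomposition,
  $\mu^+(A) = \sup_{B \subseteq A} \mu(B)$. The negative part is the positive part of \<open>- \<mu>\<close>.\<close>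

definition upper_variation :: "(real set \<Rightarrow> real) \<Rightarrow> real measure" where
  "upper_variation \<mu> =
     measure_of UNIV (sets borel) (\<lambda>A. \<Squnion>B\<in>{B \<in> sets borel. B \<subseteq> A}. ennreal (\<mu> B))"

definition lower_variation :: "(real set \<Rightarrow> real) \<Rightarrow> real measure" where
  "lower_variation \<mu> = upper_variation (\<lambda>A. - \<mu> A)"

definition total_variation :: "(real set \<Rightarrow> real) \<Rightarrow> real set \<Rightarrow> ennreal" where
  "total_variation \<mu> A = emeasure (upper_variation \<mu>) A + emeasure (lower_variation \<mu>) A"

definition signed_integral :: "(real set \<Rightarrow> real) \<Rightarrow> (real \<Rightarrow> real) \<Rightarrow> real" where
  "signed_integral \<mu> \<phi> =
     (\<integral>x. \<phi> x \<partial>upper_variation \<mu>) - (\<integral>x. \<phi> x \<partial>lower_variation \<mu>)"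

definition test_function :: "(real \<Rightarrow> real) \<Rightarrow> bool" where
  "test_function \<phi> \<longleftrightarrow>
     (\<forall>n. (deriv ^^ n) \<phi> differentiable_on UNIV) \<and> compact (closure {x. \<phi> x \<noteq> 0})"

definition is_distributional_derivative :: "(real \<Rightarrow> real) \<Rightarrow> (real set \<Rightarrow> real) \<Rightarrow> bool" where
  "is_distributional_derivative f \<mu> \<longleftrightarrow>
     signed_borel_measure \<mu> \<and> total_variation \<mu> UNIV < \<infinity> \<and>
     (\<forall>\<phi>. test_function \<phi> \<longrightarrow>
        (\<integral>x. f x * deriv \<phi> x \<partial>lborel) = - signed_integral \<mu> \<phi>)"

definition BV :: "(real \<Rightarrow> real) set" where
  "BV = {f. integrable lborel f \<and> (\<exists>\<mu>. is_distributional_derivative f \<mu>)}"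

text \<open>The choice does not matter: the derivative is unique on Borel sets, and its total
  variation only depends on its values there.\<close>

definition var_norm :: "(real \<Rightarrow> real) \<Rightarrow> real" where
  "var_norm f = enn2real (total_variation (SOME \<mu>. is_distributional_derivative f \<mu>) UNIV)"

definition generating_function :: "(int ^ 'd \<Rightarrow> real) \<Rightarrow> complex ^ 'd \<Rightarrow> complex" where
  "generating_function u z = (\<Sum>\<^sub>\<infinity>k. of_real (u (- k)) * (\<Prod>j\<in>UNIV. (z $ j) powi (k $ j)))"

definition partial_deriv ::
    "'d \<Rightarrow> (complex ^ 'd \<Rightarrow> complex) \<Rightarrow> complex ^ 'd \<Rightarrow> complex" where
  "partial_deriv j f z = deriv (\<lambda>t. f (\<chi> i. if i = j then t else z $ i)) (z $ j)"

definition multi_index_abs :: "nat ^ 'd \<Rightarrow> nat" where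
  "multi_index_abs I = (\<Sum>r\<in>UNIV. I $ r)"

definition multi_index_less :: "nat ^ 'd \<Rightarrow> nat ^ 'd \<Rightarrow> bool" where
  "multi_index_less J I \<longleftrightarrow> (\<forall>r. J $ r \<le> I $ r) \<and> multi_index_abs J < multi_index_abs I"

text \<open>The index type has no canonical order, so the partial derivatives are taken along an
  arbitrary enumeration of the coordinates. For functions that are holomorphic near the point
  of evaluation, which are the only ones considered, they commute.\<close>

definition multi_deriv ::
    "nat ^ 'd \<Rightarrow> (complex ^ 'd \<Rightarrow> complex) \<Rightarrow> complex ^ 'd \<Rightarrow> complex" where
  "multi_deriv I f =
     foldr (\<lambda>j. partial_deriv j ^^ (I $ j)) (SOME js. distinct js \<and> set js = UNIV) f"

definition leading_index :: "(int ^ 'd \<Rightarrow> real) \<Rightarrow> nat ^ 'd \<Rightarrow> bool" where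
  "leading_index u I \<longleftrightarrow>
     multi_deriv I (generating_function u) (\<chi> j. 1) \<noteq> 0 \<and>
     (\<forall>J. multi_index_less J I \<longrightarrow> multi_deriv J (generating_function u) (\<chi> j. 1) = 0)"

end

theory Submission
  imports Defs "HOL-Complex_Analysis.Complex_Analysis"
    "HOL-Computational_Algebra.Fundamental_Theorem_Algebra"
begin

text \<open>
  The derivatives of the generating function at \<open>\<one>\<close> are the moments
  $\sum_k u(-k) \prod_r k_r (k_r - 1) \cdots (k_r - i_r + 1)$. For a leading index \<open>I\<^sub>0\<close>, Vandermonde's
  identity shows that convolving \<open>u\<close> with $t_k = \prod_r k_r (k_r - 1) \cdots (k_r - i_r + 1)$ gives a nonzero
  constant \<open>c\<close>, so, after truncation to a cube of side comparable to \<open>l\<close>, moving the couplings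
  \<open>\<omega>\<close> along \<open>t / c\<close> raises the potential by at least \<open>1/2\<close> everywhere on the box.

  Shifting \<open>\<omega>\<close> along this direction by \<open>s = 2 (\<bar>I\<bar> + \<epsilon>) / \<lambda>\<close> pushes all eigenvalues up by at least
  \<open>\<bar>I\<bar> + \<epsilon>\<close>. Hence the number of eigenvalues in \<open>I\<close> is at most the difference of one eigenvalue counting
  function \<open>g\<close> before and after the shift. As \<open>0 \<le> g \<le> \<bar>\<Lambda>\<^sub>l\<bar>\<close>, the expectation of this difference
  is controlled by the distance in variation between the law of \<open>\<omega>\<close> and its translate, that is, by
  $\sum_k \| \rho - \rho(\cdot - s t_k / c) \|_1 \le s \sum_k |t_k / c| \, \|\rho\|_{\mathrm{Var}}$.
\<close>

text \<open>As \<open>u\<close> may change sign, the potential need not be monotone in any single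
  coupling; this is why a whole direction in coupling space has to be found. The weights grow
  polynomially, so along the untruncated direction the summed cost of all one-site translations
  would in general diverge. Cutting at radius 2l + D, with D independent of l, makes it finite and
  costs at most half of the gain, whence the factor 2 in \<open>s\<close>. The exponent has three
  sources: one factor (2l+1)^d is the bound on \<open>g\<close>, another counts the shifted sites,
  and |I_0| is the degree of growth of the weights. The count \<open>g\<close> is integer valued and
  jumps, and \<rho> is only of bounded variation. A finite shift avoids differentiating either of
  them: \<open>g\<close> enters only through its bounds and its measurability. The \<epsilon>
  reconciles the strict inequality in the counting function with a closed right end point and
  disappears in a limit. That a leading index exists is a separate analytic fact: a nonzero
  exponentially decaying \<open>u\<close> cannot have all its moments equal to zero.\<close>

no_notation fps_nth (infixl \<open>$\<close> 75)

text \<open>Gaussian elimination, by induction on the equations. This one statement carries all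
  later dimension counts: annihilating polynomials, the size of orthonormal families and Weyl
  monotonicity. Arbitrary finite index sets allow sites and eigenvectors to serve as indices
  directly.\<close>

lemma homogeneous_system:
  fixes M :: "'q \<Rightarrow> 'p \<Rightarrow> 'f :: field"
  assumes "finite Q" "finite P" "card Q < card P"
  shows "\<exists>c. (\<exists>p\<in>P. c p \<noteq> 0) \<and> (\<forall>q\<in>Q. (\<Sum>p\<in>P. c p * M q p) = 0)"
  using assms
proof (induction Q arbitrary: P M rule: finite_induct)
  case empty
  then have "P \<noteq> {}" by auto
  then show ?case by (intro exI[of _ "\<lambda>_. 1"]) auto
next
  case (insert q Q)
  show ?case
  proof (cases "\<forall>p\<in>P. M q p = 0")
    case True
    have "card Q < card P" using insert by simp
    from insert.IH[OF insert.prems(1) this, of M] obtain c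
      where "\<exists>p\<in>P. c p \<noteq> 0" "\<forall>q\<in>Q. (\<Sum>p\<in>P. c p * M q p) = 0" by blast
    with True show ?thesis by (intro exI[of _ c]) auto
  next
    case False
    then obtain p0 where p0: "p0 \<in> P" "M q p0 \<noteq> 0" by auto
    define P' where "P' = P - {p0}"
    have P': "finite P'" "p0 \<notin> P'" "P = insert p0 P'" using p0 insert.prems by (auto simp: P'_def)
    have "card Q < card P'" using insert.prems insert.hyps P' by simp
    \<comment> \<open>Equation \<open>q\<close> is solved for the pivot unknown \<open>p0\<close>
      and substituted into the others, which leaves one equation and one unknown fewer.\<close>
    from insert.IH[OF P'(1) this, of "\<lambda>q' p. M q' p - M q' p0 * M q p / M q p0"] obtain c
      where c: "\<exists>p\<in>P'. c p \<noteq> 0"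
        "\<forall>q'\<in>Q. (\<Sum>p\<in>P'. c p * (M q' p - M q' p0 * M q p / M q p0)) = 0" by blast
    define c0 where "c0 = - (\<Sum>p\<in>P'. c p * M q p) / M q p0"
    define c' where "c' = c(p0 := c0)"
    have sum_eq: "(\<Sum>p\<in>P. c' p * M q' p) = c0 * M q' p0 + (\<Sum>p\<in>P'. c p * M q' p)" for q'
      using P' by (auto simp: c'_def intro!: sum.cong)
    have "(\<Sum>p\<in>P. c' p * M q' p) = 0" if "q' \<in> insert q Q" for q'
    proof (cases "q' = q")
      case True
      then show ?thesis using p0 by (simp add: sum_eq c0_def)
    next
      case False
      then have "q' \<in> Q" using that by simp
      then have "(\<Sum>p\<in>P'. c p * (M q' p - M q' p0 * M q p / M q p0)) = 0" using c by blast
      moreover have "(\<Sum>p\<in>P'. c p * (M q' p - M q' p0 * M q p / M q p0)) =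
          (\<Sum>p\<in>P'. c p * M q' p) + c0 * M q' p0"
        by (simp add: c0_def sum_subtractf algebra_simps sum_distrib_left sum_divide_distrib)
      ultimately show ?thesis unfolding sum_eq by (metis add.commute)
    qed
    moreover have "\<exists>p\<in>P. c' p \<noteq> 0" using c P' by (auto simp: c'_def)
    ultimately show ?thesis by blast
  qed
qed

section \<open>Hermitian operators on a finite set\<close>

lemma ell2_inner_commute: "cnj (ell2_inner L \<phi> \<psi>) = ell2_inner L \<psi> \<phi>"
  by (simp add: ell2_inner_def mult.commute)

lemma ell2_inner_diff_right:
  "ell2_inner L \<phi> (\<lambda>x. \<psi> x - \<eta> x) = ell2_inner L \<phi> \<psi> - ell2_inner L \<phi> \<eta>"
  by (simp add: ell2_inner_def algebra_simps sum_subtractf)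

lemma ell2_inner_scale_right: "ell2_inner L \<phi> (\<lambda>x. c * \<psi> x) = c * ell2_inner L \<phi> \<psi>"
  by (simp add: ell2_inner_def algebra_simps sum_distrib_left)

lemma ell2_inner_scale_left: "ell2_inner L (\<lambda>x. c * \<phi> x) \<psi> = cnj c * ell2_inner L \<phi> \<psi>"
  by (simp add: ell2_inner_def algebra_simps sum_distrib_left)

lemma ell2_inner_sum_right:
  "ell2_inner L \<phi> (\<lambda>x. \<Sum>i\<in>S. f i x) = (\<Sum>i\<in>S. ell2_inner L \<phi> (f i))"
  unfolding ell2_inner_def sum_distrib_left by (rule sum.swap)

lemma ell2_inner_self: "ell2_inner L \<psi> \<psi> = of_real (\<Sum>x\<in>L. (cmod (\<psi> x))\<^sup>2)"
  by (simp only: ell2_inner_def of_real_sum complex_norm_square mult.commute)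

lemma ell2_inner_self_eq_0:
  assumes "finite L" "\<psi> \<in> ell2_on L" "ell2_inner L \<psi> \<psi> = 0"
  shows "\<psi> = (\<lambda>_. 0)"
proof -
  have "(\<Sum>x\<in>L. (cmod (\<psi> x))\<^sup>2) = 0" using assms(3) unfolding ell2_inner_self of_real_eq_0_iff .
  then have "\<forall>x\<in>L. \<psi> x = 0" using assms(1) by (subst (asm) sum_nonneg_eq_0_iff) auto
  then show ?thesis using assms(2) by (auto simp: ell2_on_def)
qed

lemma ell2_on_sum: "(\<And>i. i \<in> S \<Longrightarrow> f i \<in> ell2_on L) \<Longrightarrow> (\<lambda>x. \<Sum>i\<in>S. c i * f i x) \<in> ell2_on L"
  by (auto simp: ell2_on_def intro!: sum.neutral)

text \<open>The operator is a function on all of \<open>'a \<Rightarrow> complex\<close>, so its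
  properties are demanded only for vectors supported in \<open>L\<close>. There they describe a
  Hermitian matrix.\<close>

locale hermitian_on =
  fixes L :: "'a set" and A :: "('a \<Rightarrow> complex) \<Rightarrow> 'a \<Rightarrow> complex"
  assumes finite_carrier: "finite L"
    and maps_to: "\<psi> \<in> ell2_on L \<Longrightarrow> A \<psi> \<in> ell2_on L"
    and linear: "\<phi> \<in> ell2_on L \<Longrightarrow> \<psi> \<in> ell2_on L \<Longrightarrow>
      A (\<lambda>x. a * \<phi> x + b * \<psi> x) = (\<lambda>x. a * A \<phi> x + b * A \<psi> x)"
    and symmetric: "\<phi> \<in> ell2_on L \<Longrightarrow> \<psi> \<in> ell2_on L \<Longrightarrow>
      ell2_inner L \<phi> (A \<psi>) = ell2_inner L (A \<phi>) \<psi>"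
begin

lemma A_zero: "A (\<lambda>_. 0) = (\<lambda>_. 0)"
proof -
  have "(\<lambda>_. 0) \<in> ell2_on L" by (simp add: ell2_on_def)
  from linear[OF this this, of 0 0] show ?thesis by simp
qed

lemma A_sum:
  assumes "finite S" "\<And>i. i \<in> S \<Longrightarrow> f i \<in> ell2_on L"
  shows "A (\<lambda>x. \<Sum>i\<in>S. c i * f i x) = (\<lambda>x. \<Sum>i\<in>S. c i * A (f i) x)"
  using assms
proof (induction S rule: finite_induct)
  case empty
  then show ?case by (simp add: A_zero)
next
  case (insert j S)
  have "A (\<lambda>x. c j * f j x + 1 * (\<Sum>i\<in>S. c i * f i x))
      = (\<lambda>x. c j * A (f j) x + 1 * A (\<lambda>x. \<Sum>i\<in>S. c i * f i x) x)"
    using insert by (intro linear ell2_on_sum) auto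
  then show ?case using insert by simp
qed

lemma funpow_maps_to: "v \<in> ell2_on L \<Longrightarrow> (A ^^ i) v \<in> ell2_on L"
  by (induction i) (auto intro: maps_to)

section \<open>Polynomials in the operator and existence of an eigenvector\<close>

definition poly_apply :: "complex poly \<Rightarrow> ('a \<Rightarrow> complex) \<Rightarrow> 'a \<Rightarrow> complex" where
  "poly_apply p v = (\<lambda>x. \<Sum>i\<le>degree p. coeff p i * (A ^^ i) v x)"

lemma poly_apply_bound:
  assumes "degree p \<le> n"
  shows "poly_apply p v = (\<lambda>x. \<Sum>i\<le>n. coeff p i * (A ^^ i) v x)"
  unfolding poly_apply_def
proof
  fix x
  show "(\<Sum>i\<le>degree p. coeff p i * (A ^^ i) v x) = (\<Sum>i\<le>n. coeff p i * (A ^^ i) v x)"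
    using assms by (intro sum.mono_neutral_left) (auto simp: coeff_eq_0)
qed

lemma poly_apply_maps_to: "v \<in> ell2_on L \<Longrightarrow> poly_apply p v \<in> ell2_on L"
  unfolding poly_apply_def by (intro ell2_on_sum funpow_maps_to)

text \<open>Multiplication by X - z acts as A - z. This is how a root of an annihilating polynomial
  becomes an eigenvalue.\<close>

lemma poly_apply_factor:
  assumes v: "v \<in> ell2_on L"
  shows "poly_apply ([:-z, 1:] * q) v = (\<lambda>x. A (poly_apply q v) x - z * poly_apply q v x)"
proof
  fix x
  define n where "n = degree q"
  have A: "A (poly_apply q v) x = (\<Sum>i\<le>n. coeff q i * (A ^^ Suc i) v x)"
    unfolding poly_apply_def n_def
    by (subst A_sum) (auto intro: funpow_maps_to[OF v])
  have "degree ([:-z, 1:] * q) \<le> Suc n"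
    unfolding n_def by (rule order_trans[OF degree_mult_le]) simp
  then have "poly_apply ([:-z, 1:] * q) v x
      = (\<Sum>i\<le>Suc n. coeff ([:-z, 1:] * q) i * (A ^^ i) v x)"
    by (subst poly_apply_bound) auto
  also have "\<dots> = (\<Sum>i\<le>Suc n. coeff (pCons 0 q) i * (A ^^ i) v x)
      - z * (\<Sum>i\<le>Suc n. coeff q i * (A ^^ i) v x)"
    by (simp only: mult_pCons_left sum_distrib_left sum_subtractf[symmetric])
       (intro sum.cong, auto simp: algebra_simps)
  also have "(\<Sum>i\<le>Suc n. coeff (pCons 0 q) i * (A ^^ i) v x) = A (poly_apply q v) x"
    unfolding A by (subst sum.atMost_Suc_shift) simp
  also have "(\<Sum>i\<le>Suc n. coeff q i * (A ^^ i) v x) = poly_apply q v x"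
    by (subst poly_apply_bound[of q "Suc n"]) (auto simp: n_def)
  finally show "poly_apply ([:-z, 1:] * q) v x = A (poly_apply q v) x - z * poly_apply q v x" .
qed

lemma annihilating_poly:
  assumes v: "v \<in> ell2_on L"
  shows "\<exists>p. p \<noteq> 0 \<and> poly_apply p v = (\<lambda>_. 0)"
proof -
  \<comment> \<open>The iterates with exponents 0 to \<open>card L\<close> are one more than the
    sites, so they satisfy a linear relation.\<close>
  have "\<exists>c. (\<exists>p\<in>{..card L}. c p \<noteq> 0) \<and> (\<forall>q\<in>L. (\<Sum>p\<in>{..card L}. c p * (A ^^ p) v q) = 0)"
    by (rule homogeneous_system) (auto simp: finite_carrier)
  then obtain c where c: "\<exists>i\<le>card L. c i \<noteq> 0"
    "\<forall>x\<in>L. (\<Sum>i\<le>card L. c i * (A ^^ i) v x) = 0" by auto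
  define p where "p = (\<Sum>i\<le>card L. monom (c i) i)"
  have coeff_p: "coeff p i = (if i \<le> card L then c i else 0)" for i
    by (simp add: p_def coeff_sum)
  have "degree p \<le> card L" by (rule degree_le) (simp add: coeff_p)
  then have "poly_apply p v = (\<lambda>x. \<Sum>i\<le>card L. c i * (A ^^ i) v x)"
    by (subst poly_apply_bound) (auto simp: coeff_p)
  also have "\<dots> = (\<lambda>_. 0)"
  proof
    fix x
    show "(\<Sum>i\<le>card L. c i * (A ^^ i) v x) = 0"
      using c(2) funpow_maps_to[OF v] by (cases "x \<in> L") (auto simp: ell2_on_def)
  qed
  finally have "poly_apply p v = (\<lambda>_. 0)" .
  moreover have "p \<noteq> 0" using c(1) coeff_p by (metis coeff_0)
  ultimately show ?thesis by blast
qed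

text \<open>A factor of an annihilating polynomial of minimal degree produces the eigenvector.\<close>

lemma eigenvector_in_cyclic_subspace:
  assumes v: "v \<in> ell2_on L" "v \<noteq> (\<lambda>_. 0)"
  shows "\<exists>q z. poly_apply q v \<noteq> (\<lambda>_. 0) \<and> A (poly_apply q v) = (\<lambda>x. z * poly_apply q v x)"
proof -
  define P where "P n \<longleftrightarrow> (\<exists>p. p \<noteq> 0 \<and> poly_apply p v = (\<lambda>_. 0) \<and> degree p = n)" for n
  have "\<exists>n. P n" using annihilating_poly[OF v(1)] by (auto simp: P_def)
  then have "P (LEAST n. P n)" by (auto intro: LeastI)
  then obtain p where p: "p \<noteq> 0" "poly_apply p v = (\<lambda>_. 0)" "degree p = (LEAST n. P n)"
    by (auto simp: P_def)
  have "degree p \<noteq> 0"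
  proof
    assume d: "degree p = 0"
    then have "coeff p 0 \<noteq> 0" using p(1) by (metis leading_coeff_0_iff)
    moreover have "coeff p 0 * v x = 0" for x
      using fun_cong[OF p(2), of x] d by (simp add: poly_apply_def)
    ultimately show False using v(2) by auto
  qed
  then obtain z where "poly p z = 0" using alg_closed_imp_poly_has_root[of p] by blast
  then obtain q where q: "p = [:-z, 1:] * q" by (auto simp: poly_eq_0_iff_dvd)
  with p(1) have "q \<noteq> 0" by auto
  then have "degree q < degree p" unfolding q by (subst degree_mult_eq) auto
  \<comment> \<open>By minimality \<open>q\<close> does not annihilate \<open>v\<close>, whereas A -
    z annihilates the vector that \<open>q\<close> produces.\<close>
  then have "\<not> P (degree q)" using p(3) not_less_Least by metis
  then have "poly_apply q v \<noteq> (\<lambda>_. 0)" using \<open>q \<noteq> 0\<close> by (auto simp: P_def)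
  moreover have "A (poly_apply q v) = (\<lambda>x. z * poly_apply q v x)"
    using p(2) unfolding q poly_apply_factor[OF v(1)] by (auto simp: fun_eq_iff)
  ultimately show ?thesis by blast
qed

section \<open>Orthonormal families of eigenvectors and the eigenbasis\<close>

definition orthonormal_eigenvectors :: "('a \<Rightarrow> complex) set \<Rightarrow> bool" where
  "orthonormal_eigenvectors B \<longleftrightarrow> finite B \<and> B \<subseteq> ell2_on L \<and>
     (\<forall>b\<in>B. \<forall>b'\<in>B. ell2_inner L b b' = (if b = b' then 1 else 0)) \<and>
     (\<forall>b\<in>B. \<exists>E::real. A b = (\<lambda>x. of_real E * b x))"

text \<open>The Rayleigh quotient of a unit vector: it recovers the eigenvalue of a normalized
  eigenvector without a choice.\<close>

definition eigenvalue :: "('a \<Rightarrow> complex) \<Rightarrow> real" where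
  "eigenvalue b = Re (ell2_inner L b (A b))"

lemma A_eigenvector:
  assumes "orthonormal_eigenvectors B" "b \<in> B"
  shows "A b = (\<lambda>x. of_real (eigenvalue b) * b x)"
proof -
  obtain E :: real where E: "A b = (\<lambda>x. of_real E * b x)"
    using assms by (auto simp: orthonormal_eigenvectors_def)
  have "ell2_inner L b b = 1" using assms by (auto simp: orthonormal_eigenvectors_def)
  then have "eigenvalue b = E" by (simp add: eigenvalue_def E ell2_inner_scale_right)
  with E show ?thesis by simp
qed

lemma eigenvalue_real:
  assumes w: "w \<in> ell2_on L" "w \<noteq> (\<lambda>_. 0)" "A w = (\<lambda>x. z * w x)"
  shows "z \<in> \<real>"
proof -
  have "ell2_inner L w w \<noteq> 0" using ell2_inner_self_eq_0 w finite_carrier by blast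
  moreover have "z * ell2_inner L w w = cnj z * ell2_inner L w w"
    using symmetric[OF w(1) w(1)] by (simp add: w(3) ell2_inner_scale_right ell2_inner_scale_left)
  ultimately show ?thesis using Reals_cnj_iff by simp
qed

lemma orthonormal_sum_inner:
  assumes "orthonormal_eigenvectors B" "C \<subseteq> B" "b \<in> B"
  shows "ell2_inner L b (\<lambda>x. \<Sum>b'\<in>C. c b' * b' x) = (if b \<in> C then c b else 0)"
proof -
  have fin: "finite C" using assms by (auto simp: orthonormal_eigenvectors_def finite_subset)
  have "ell2_inner L b (\<lambda>x. \<Sum>b'\<in>C. c b' * b' x) = (\<Sum>b'\<in>C. c b' * ell2_inner L b b')"
    by (simp add: ell2_inner_sum_right ell2_inner_scale_right)
  also have "\<dots> = (\<Sum>b'\<in>C. if b = b' then c b' else 0)"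
    using assms by (intro sum.cong) (auto simp: orthonormal_eigenvectors_def)
  also have "\<dots> = (if b \<in> C then c b else 0)" using fin by simp
  finally show ?thesis .
qed

text \<open>A larger family would be linearly dependent on \<open>L\<close>, and pairing the
  relation with one of its members isolates a nonzero coefficient.\<close>

lemma orthonormal_card_le:
  assumes B: "orthonormal_eigenvectors B"
  shows "card B \<le> card L"
proof (rule ccontr)
  assume "\<not> ?thesis"
  then have "card L < card B" by simp
  moreover have "finite B" using B by (simp add: orthonormal_eigenvectors_def)
  ultimately obtain c where c: "\<exists>b\<in>B. c b \<noteq> 0" "\<forall>x\<in>L. (\<Sum>b\<in>B. c b * b x) = 0"
    using homogeneous_system[OF finite_carrier, of B "\<lambda>x b. b x"] by blast
  from c(1) obtain b where b: "b \<in> B" "c b \<noteq> 0" by blast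
  have "ell2_inner L b (\<lambda>x. \<Sum>b'\<in>B. c b' * b' x) = 0" using c(2) by (simp add: ell2_inner_def)
  with orthonormal_sum_inner[OF B order_refl b(1), of c] b show False by simp
qed

text \<open>The orthogonal complement of a maximal orthonormal family of eigenvectors is invariant,
  hence would contain a further eigenvector if it were nonzero.\<close>

lemma eigenbasis_exists:
  "\<exists>B. orthonormal_eigenvectors B \<and>
     (\<forall>\<psi>\<in>ell2_on L. \<psi> = (\<lambda>x. \<Sum>b\<in>B. ell2_inner L b \<psi> * b x))"
proof -
  have "orthonormal_eigenvectors {}" by (simp add: orthonormal_eigenvectors_def)
  moreover have "\<forall>B. orthonormal_eigenvectors B \<longrightarrow> card B < Suc (card L)"
    using orthonormal_card_le by (auto simp: less_Suc_eq_le)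
  ultimately obtain B where B: "orthonormal_eigenvectors B"
    and max: "\<And>B'. orthonormal_eigenvectors B' \<Longrightarrow> card B' \<le> card B"
    using ex_has_greatest_nat[of orthonormal_eigenvectors "{}" card "Suc (card L)"] by blast
  have BL: "B \<subseteq> ell2_on L" and finB: "finite B"
    using B by (auto simp: orthonormal_eigenvectors_def)
  have complement: "v = (\<lambda>_. 0)"
    if v: "v \<in> ell2_on L" "\<forall>b\<in>B. ell2_inner L b v = 0" for v
  proof (rule ccontr)
    assume "v \<noteq> (\<lambda>_. 0)"
    from eigenvector_in_cyclic_subspace[OF v(1) this] obtain q z
      where w0: "poly_apply q v \<noteq> (\<lambda>_. 0)" and w1: "A (poly_apply q v) = (\<lambda>x. z * poly_apply q v x)"
      by blast
    define w where "w = poly_apply q v"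
    have wL: "w \<in> ell2_on L" unfolding w_def by (rule poly_apply_maps_to[OF v(1)])
    \<comment> \<open>Symmetry moves \<open>A\<close> onto the eigenvector \<open>b\<close>, so all
      iterates of \<open>v\<close>, and with them the new eigenvector, stay orthogonal to
      \<open>B\<close>.\<close>
    have pow: "ell2_inner L b ((A ^^ i) v) = 0" if "b \<in> B" for b i
    proof (induction i)
      case 0
      then show ?case using v that by simp
    next
      case (Suc i)
      have "ell2_inner L b (A ((A ^^ i) v)) = ell2_inner L (A b) ((A ^^ i) v)"
        using that BL by (intro symmetric funpow_maps_to[OF v(1)]) auto
      also have "\<dots> = 0"
        by (subst A_eigenvector[OF B that]) (simp only: ell2_inner_scale_left Suc mult_zero_right)
      finally show ?case by simp
    qed
    have orth: "ell2_inner L b w = 0" if "b \<in> B" for b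
      unfolding w_def poly_apply_def ell2_inner_sum_right ell2_inner_scale_right
      using pow[OF that] by simp
    define r where "r = sqrt (\<Sum>x\<in>L. (cmod (w x))\<^sup>2)"
    have ww: "ell2_inner L w w = of_real (r\<^sup>2)"
      unfolding ell2_inner_self r_def by (subst real_sqrt_pow2) (auto intro: sum_nonneg)
    have "ell2_inner L w w \<noteq> 0"
      using ell2_inner_self_eq_0[OF finite_carrier wL] w0 by (auto simp: w_def)
    then have r: "r \<noteq> 0" using ww by auto
    obtain E where E: "z = of_real E"
      using eigenvalue_real[OF wL _ w1[folded w_def]] w0 by (auto simp: w_def Reals_def)
    define b0 where "b0 = (\<lambda>x. of_real (1 / r) * w x)"
    have b0L: "b0 \<in> ell2_on L" using wL by (auto simp: b0_def ell2_on_def)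
    have b0b0: "ell2_inner L b0 b0 = 1"
      unfolding b0_def ell2_inner_scale_left ell2_inner_scale_right ww using r
      by (simp add: power2_eq_square)
    have orth0: "ell2_inner L b b0 = 0" if "b \<in> B" for b
      unfolding b0_def ell2_inner_scale_right using orth[OF that] by simp
    have orth0': "ell2_inner L b0 b = 0" if "b \<in> B" for b
      using orth0[OF that] ell2_inner_commute[of L b b0] by simp
    have "A (\<lambda>x. of_real (1 / r) * w x + 0 * w x)
        = (\<lambda>x. of_real (1 / r) * A w x + 0 * A w x)"
      by (rule linear[OF wL wL])
    then have "A b0 = (\<lambda>x. of_real E * b0 x)"
      using w1 by (simp add: b0_def w_def E mult.left_commute)
    moreover have "b0 \<notin> B" using orth0 b0b0 by force
    ultimately have "orthonormal_eigenvectors (insert b0 B)"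
      using B b0L b0b0 orth0 orth0' by (auto simp: orthonormal_eigenvectors_def)
    from max[OF this] \<open>b0 \<notin> B\<close> finB show False by simp
  qed
  have "\<psi> = (\<lambda>x. \<Sum>b\<in>B. ell2_inner L b \<psi> * b x)" if \<psi>: "\<psi> \<in> ell2_on L" for \<psi>
  proof -
    define v where "v = (\<lambda>x. \<psi> x - (\<Sum>b\<in>B. ell2_inner L b \<psi> * b x))"
    have "(\<lambda>x. \<Sum>b\<in>B. ell2_inner L b \<psi> * b x) \<in> ell2_on L" using BL by (intro ell2_on_sum) auto
    then have "v \<in> ell2_on L" using \<psi> by (auto simp: v_def ell2_on_def)
    moreover have "\<forall>b\<in>B. ell2_inner L b v = 0"
      unfolding v_def ell2_inner_diff_right
      using orthonormal_sum_inner[OF B order_refl, of _ "\<lambda>b. ell2_inner L b \<psi>"] by simp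
    ultimately have "v = (\<lambda>_. 0)" by (rule complement)
    then show ?thesis by (auto simp: v_def fun_eq_iff)
  qed
  with B show ?thesis by blast
qed

text \<open>Fixed once by choice; counting its members by eigenvalue counts eigenvalues with
  multiplicity.\<close>

definition eigenbasis :: "('a \<Rightarrow> complex) set" where
  "eigenbasis = (SOME B. orthonormal_eigenvectors B \<and>
     (\<forall>\<psi>\<in>ell2_on L. \<psi> = (\<lambda>x. \<Sum>b\<in>B. ell2_inner L b \<psi> * b x)))"

lemma eigenbasis: "orthonormal_eigenvectors eigenbasis"
  and eigenbasis_expansion:
    "\<psi> \<in> ell2_on L \<Longrightarrow> \<psi> = (\<lambda>x. \<Sum>b\<in>eigenbasis. ell2_inner L b \<psi> * b x)"
  using someI_ex[OF eigenbasis_exists] unfolding eigenbasis_def by blast+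

lemma finite_eigenbasis: "finite eigenbasis"
  and eigenbasis_subset: "eigenbasis \<subseteq> ell2_on L"
  using eigenbasis by (auto simp: orthonormal_eigenvectors_def)

lemma inner_A_eigenvector:
  assumes "b \<in> eigenbasis" "\<psi> \<in> ell2_on L"
  shows "ell2_inner L b (A \<psi>) = of_real (eigenvalue b) * ell2_inner L b \<psi>"
proof -
  have "ell2_inner L b (A \<psi>) = ell2_inner L (A b) \<psi>"
    using assms eigenbasis_subset by (intro symmetric) auto
  also have "\<dots> = of_real (eigenvalue b) * ell2_inner L b \<psi>"
    by (subst A_eigenvector[OF eigenbasis assms(1)]) (simp add: ell2_inner_scale_left)
  finally show ?thesis .
qed

section \<open>Parseval identities, eigenspaces and spectral projections\<close>

lemma parseval:
  assumes "\<psi> \<in> ell2_on L" 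
  shows "ell2_inner L \<phi> \<psi> = (\<Sum>b\<in>eigenbasis. ell2_inner L \<phi> b * ell2_inner L b \<psi>)"
proof -
  have "ell2_inner L \<phi> \<psi> = ell2_inner L \<phi> (\<lambda>x. \<Sum>b\<in>eigenbasis. ell2_inner L b \<psi> * b x)"
    using eigenbasis_expansion[OF assms] by simp
  also have "\<dots> = (\<Sum>b\<in>eigenbasis. ell2_inner L b \<psi> * ell2_inner L \<phi> b)"
    unfolding ell2_inner_sum_right ell2_inner_scale_right ..
  finally show ?thesis by (simp add: mult.commute)
qed

lemma parseval_self:
  assumes "\<psi> \<in> ell2_on L"
  shows "ell2_inner L \<psi> \<psi> = of_real (\<Sum>b\<in>eigenbasis. (cmod (ell2_inner L b \<psi>))\<^sup>2)"
  unfolding of_real_sum complex_norm_square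
  by (subst parseval[OF assms], intro sum.cong refl) (simp add: ell2_inner_commute mult.commute)

lemma parseval_A:
  assumes "\<psi> \<in> ell2_on L"
  shows "ell2_inner L \<psi> (A \<psi>)
    = of_real (\<Sum>b\<in>eigenbasis. eigenvalue b * (cmod (ell2_inner L b \<psi>))\<^sup>2)"
  unfolding of_real_sum of_real_mult complex_norm_square
  by (subst parseval[OF maps_to[OF assms]], intro sum.cong refl) (simp add: inner_A_eigenvector assms ell2_inner_commute algebra_simps)

text \<open>Comparing the coefficients of A \<psi> and E \<psi> in the eigenbasis shows that only
  basis vectors with eigenvalue \<open>E\<close> can contribute.\<close>

lemma eigenspace_mem_iff:
  assumes "\<psi> \<in> ell2_on L"
  shows "\<psi> \<in> eigenspace_on L A E \<longleftrightarrow>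
    (\<forall>b\<in>eigenbasis. eigenvalue b \<noteq> E \<longrightarrow> ell2_inner L b \<psi> = 0)"
proof
  assume E: "\<psi> \<in> eigenspace_on L A E"
  then have "ell2_inner L b (A \<psi>) = of_real E * ell2_inner L b \<psi>" for b
    by (simp add: eigenspace_on_def ell2_inner_scale_right)
  then show "\<forall>b\<in>eigenbasis. eigenvalue b \<noteq> E \<longrightarrow> ell2_inner L b \<psi> = 0"
    using inner_A_eigenvector[OF _ assms] by force
next
  assume *: "\<forall>b\<in>eigenbasis. eigenvalue b \<noteq> E \<longrightarrow> ell2_inner L b \<psi> = 0"
  have "A \<psi> = A (\<lambda>x. \<Sum>b\<in>eigenbasis. ell2_inner L b \<psi> * b x)"
    using eigenbasis_expansion[OF assms] by simp
  also have "\<dots> = (\<lambda>x. \<Sum>b\<in>eigenbasis. ell2_inner L b \<psi> * A b x)"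
    using eigenbasis_subset by (intro A_sum finite_eigenbasis) auto
  also have "\<dots> = (\<lambda>x. \<Sum>b\<in>eigenbasis. of_real E * (ell2_inner L b \<psi> * b x))"
  proof (intro ext sum.cong refl)
    fix x b assume b: "b \<in> eigenbasis"
    show "ell2_inner L b \<psi> * A b x = of_real E * (ell2_inner L b \<psi> * b x)"
      using * b by (subst A_eigenvector[OF eigenbasis b]) auto
  qed
  also have "\<dots> = (\<lambda>x. of_real E * \<psi> x)"
    by (subst (2) eigenbasis_expansion[OF assms]) (simp add: sum_distrib_left)
  finally show "\<psi> \<in> eigenspace_on L A E" using assms by (simp add: eigenspace_on_def)
qed

text \<open>The description in \<open>orth_proj_on\<close> must be shown to denote something. The
  partial expansion over the basis vectors with eigenvalue \<open>E\<close> is a candidate, and the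
  difference of two candidates lies in the eigenspace and is orthogonal to itself.\<close>

lemma orth_proj_eigenspace:
  assumes \<psi>: "\<psi> \<in> ell2_on L"
  shows "orth_proj_on L (eigenspace_on L A E) \<psi>
    = (\<lambda>x. \<Sum>b\<in>{b \<in> eigenbasis. eigenvalue b = E}. ell2_inner L b \<psi> * b x)"
proof -
  let ?B = "{b \<in> eigenbasis. eigenvalue b = E}"
  define \<phi> where "\<phi> = (\<lambda>x. \<Sum>b\<in>?B. ell2_inner L b \<psi> * b x)"
  have \<phi>L: "\<phi> \<in> ell2_on L" unfolding \<phi>_def using eigenbasis_subset by (intro ell2_on_sum) auto
  have inner_\<phi>: "ell2_inner L b \<phi> = (if b \<in> ?B then ell2_inner L b \<psi> else 0)"
    if "b \<in> eigenbasis" for b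
    unfolding \<phi>_def by (rule orthonormal_sum_inner[OF eigenbasis _ that]) auto
  have \<phi>E: "\<phi> \<in> eigenspace_on L A E"
    by (subst eigenspace_mem_iff[OF \<phi>L]) (auto simp: inner_\<phi>)
  have diffL: "(\<lambda>x. \<psi> x - \<phi> x) \<in> ell2_on L" using \<psi> \<phi>L by (auto simp: ell2_on_def)
  have orth: "ell2_inner L \<eta> (\<lambda>x. \<psi> x - \<phi> x) = 0" if "\<eta> \<in> eigenspace_on L A E" for \<eta>
  proof -
    have \<eta>: "\<eta> \<in> ell2_on L" using that by (simp add: eigenspace_on_def)
    have "ell2_inner L \<eta> b * ell2_inner L b (\<lambda>x. \<psi> x - \<phi> x) = 0" if b: "b \<in> eigenbasis" for b
    proof (cases "eigenvalue b = E")
      case True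
      then show ?thesis using b by (simp add: ell2_inner_diff_right inner_\<phi>)
    next
      case False
      then have "ell2_inner L b \<eta> = 0"
        using that eigenspace_mem_iff[OF \<eta>] \<open>\<eta> \<in> eigenspace_on L A E\<close> b by blast
      then show ?thesis using ell2_inner_commute[of L b \<eta>] by simp
    qed
    then show ?thesis by (subst parseval[OF diffL]) (intro sum.neutral ballI)
  qed
  have unique: "\<phi>' = \<phi>"
    if *: "\<phi>' \<in> eigenspace_on L A E" "\<forall>\<eta>\<in>eigenspace_on L A E. ell2_inner L \<eta> (\<lambda>x. \<psi> x - \<phi>' x) = 0"
    for \<phi>'
  proof -
    define d where "d = (\<lambda>x. \<phi>' x - \<phi> x)"
    have \<phi>'L: "\<phi>' \<in> ell2_on L" using * by (simp add: eigenspace_on_def)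
    have dL: "d \<in> ell2_on L" using \<phi>'L \<phi>L by (auto simp: d_def ell2_on_def)
    have dE: "d \<in> eigenspace_on L A E"
      using *(1) \<phi>E unfolding eigenspace_mem_iff[OF dL] eigenspace_mem_iff[OF \<phi>'L]
        eigenspace_mem_iff[OF \<phi>L] by (simp add: d_def ell2_inner_diff_right)
    have "ell2_inner L d d
        = ell2_inner L d (\<lambda>x. \<psi> x - \<phi> x) - ell2_inner L d (\<lambda>x. \<psi> x - \<phi>' x)"
      unfolding ell2_inner_diff_right[symmetric] by (simp add: d_def)
    also have "\<dots> = 0" using orth[OF dE] *(2) dE by simp
    finally have "d = (\<lambda>_. 0)" using ell2_inner_self_eq_0[OF finite_carrier dL] by simp
    then show ?thesis by (auto simp: d_def fun_eq_iff)
  qed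
  show ?thesis unfolding orth_proj_on_def \<phi>_def[symmetric]
    using \<phi>E orth unique by (intro the_equality) blast+
qed

text \<open>Identifies the energies over which \<open>spectral_projection_on\<close> sums. In
  particular they are finitely many, so that sum is a genuine one and not a default value.\<close>

lemma eigenspace_nontrivial_iff:
  "eigenspace_on L A E \<noteq> {\<lambda>_. 0} \<longleftrightarrow> E \<in> eigenvalue ` eigenbasis"
proof
  assume ne: "eigenspace_on L A E \<noteq> {\<lambda>_. 0}"
  have "(\<lambda>_. 0) \<in> eigenspace_on L A E" by (simp add: eigenspace_on_def A_zero ell2_on_def)
  with ne obtain \<psi> where \<psi>: "\<psi> \<in> eigenspace_on L A E" "\<psi> \<noteq> (\<lambda>_. 0)" by auto
  then have L: "\<psi> \<in> ell2_on L" by (simp add: eigenspace_on_def)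
  show "E \<in> eigenvalue ` eigenbasis"
  proof (rule ccontr)
    assume "\<not> ?thesis"
    then have "\<forall>b\<in>eigenbasis. ell2_inner L b \<psi> = 0"
      using \<psi>(1) unfolding eigenspace_mem_iff[OF L] by auto
    then have "\<psi> = (\<lambda>_. 0)" by (subst eigenbasis_expansion[OF L]) simp
    with \<psi>(2) show False ..
  qed
next
  assume "E \<in> eigenvalue ` eigenbasis"
  then obtain b where b: "b \<in> eigenbasis" "E = eigenvalue b" by auto
  then have "b \<in> eigenspace_on L A E"
    using eigenbasis_subset A_eigenvector[OF eigenbasis b(1)] by (auto simp: eigenspace_on_def)
  moreover have "ell2_inner L b b = 1"
    using eigenbasis b(1) by (auto simp: orthonormal_eigenvectors_def)
  then have "b \<noteq> (\<lambda>_. 0)" by (auto simp: ell2_inner_def)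
  ultimately show "eigenspace_on L A E \<noteq> {\<lambda>_. 0}" by auto
qed

lemma spectral_projection_expansion:
  assumes \<psi>: "\<psi> \<in> ell2_on L"
  shows "spectral_projection_on L A I \<psi>
    = (\<lambda>x. \<Sum>b\<in>{b \<in> eigenbasis. eigenvalue b \<in> I}. ell2_inner L b \<psi> * b x)"
proof
  fix x
  let ?B = "{b \<in> eigenbasis. eigenvalue b \<in> I}"
  have "{E \<in> I. eigenspace_on L A E \<noteq> {\<lambda>_. 0}} = eigenvalue ` ?B"
    unfolding eigenspace_nontrivial_iff by auto
  then have "spectral_projection_on L A I \<psi> x = (\<Sum>E\<in>eigenvalue ` ?B.
      \<Sum>b\<in>{b \<in> eigenbasis. eigenvalue b = E}. ell2_inner L b \<psi> * b x)"
    unfolding spectral_projection_on_def orth_proj_eigenspace[OF \<psi>] by simp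
  also have "\<dots> = (\<Sum>E\<in>eigenvalue ` ?B. \<Sum>b\<in>{b \<in> ?B. eigenvalue b = E}. ell2_inner L b \<psi> * b x)"
    by (intro sum.cong) auto
  also have "\<dots> = (\<Sum>b\<in>?B. ell2_inner L b \<psi> * b x)"
    using finite_eigenbasis by (intro sum.group) auto
  finally show "spectral_projection_on L A I \<psi> x = (\<Sum>b\<in>?B. ell2_inner L b \<psi> * b x)" .
qed

text \<open>The diagonal entry at x is the sum of |b(x)|^2 over the selected basis vectors; after
  exchanging the sums every such vector contributes its norm, which is 1.\<close>

lemma trace_spectral_projection:
  "ell2_trace L (spectral_projection_on L A I) = of_nat (card {b \<in> eigenbasis. eigenvalue b \<in> I})"
proof -
  let ?B = "{b \<in> eigenbasis. eigenvalue b \<in> I}"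
  have ind: "indicator {x} \<in> ell2_on L" if "x \<in> L" for x
    using that by (auto simp: ell2_on_def indicator_def)
  have left: "ell2_inner L (indicator {x}) \<phi> = \<phi> x" if "x \<in> L" for x \<phi>
  proof -
    have "ell2_inner L (indicator {x}) \<phi> = (\<Sum>y\<in>L. if y = x then \<phi> y else 0)"
      unfolding ell2_inner_def by (intro sum.cong) (auto simp: indicator_def)
    then show ?thesis using that finite_carrier by simp
  qed
  have right: "ell2_inner L \<phi> (indicator {x}) = cnj (\<phi> x)" if "x \<in> L" for x \<phi>
    using left[OF that, of \<phi>] ell2_inner_commute[of L "indicator {x}" \<phi>] by simp
  have "ell2_trace L (spectral_projection_on L A I) = (\<Sum>x\<in>L. \<Sum>b\<in>?B. cnj (b x) * b x)"
    unfolding ell2_trace_def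
    by (intro sum.cong refl) (simp add: left right spectral_projection_expansion ind)
  also have "\<dots> = (\<Sum>b\<in>?B. ell2_inner L b b)"
    unfolding ell2_inner_def by (rule sum.swap)
  also have "\<dots> = (\<Sum>b\<in>?B. 1)"
    using eigenbasis by (intro sum.cong) (auto simp: orthonormal_eigenvectors_def)
  finally show ?thesis by simp
qed

section \<open>Counting eigenvalues below an energy\<close>

definition count_below :: "real \<Rightarrow> nat" where
  "count_below E = card {b \<in> eigenbasis. eigenvalue b < E}"

lemma count_below_le: "count_below E \<le> card L"
  unfolding count_below_def
  by (rule order_trans[OF card_mono orthonormal_card_le[OF eigenbasis]]) (auto simp: finite_eigenbasis)

lemma count_below_mono: "E \<le> E' \<Longrightarrow> count_below E \<le> count_below E'"
  unfolding count_below_def by (intro card_mono) (auto simp: finite_eigenbasis)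

text \<open>As \<open>count_below\<close> uses a strict inequality, its increments count the
  eigenvalues in half-open intervals that contain their left end point.\<close>

lemma trace_spectral_projection_le:
  assumes "I \<subseteq> {E..<E'}" "E \<le> E'"
  shows "Re (ell2_trace L (spectral_projection_on L A I)) \<le> real (count_below E') - real (count_below E)"
proof -
  have "card {b \<in> eigenbasis. eigenvalue b \<in> I} + count_below E
      = card ({b \<in> eigenbasis. eigenvalue b \<in> I} \<union> {b \<in> eigenbasis. eigenvalue b < E})"
    unfolding count_below_def using assms finite_eigenbasis by (subst card_Un_disjoint) auto
  also have "\<dots> \<le> count_below E'"
    unfolding count_below_def using assms finite_eigenbasis by (intro card_mono) auto
  finally show ?thesis by (simp add: trace_spectral_projection)
qed

text \<open>The finitely many eigenvalues below \<open>E\<close> keep a positive distance from it.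
  This left continuity is the source of the measurability of the count.\<close>

lemma count_below_left_constant: "\<exists>\<delta>>0. count_below (E - \<delta>) = count_below E"
proof -
  \<comment> \<open>The element 1 keeps the minimum defined when no eigenvalue lies below
    \<open>E\<close>; halving makes the final comparison strict.\<close>
  define \<delta> where "\<delta> = Min (insert 1 ((\<lambda>b. E - eigenvalue b) ` {b \<in> eigenbasis. eigenvalue b < E})) / 2"
  let ?S = "insert 1 ((\<lambda>b. E - eigenvalue b) ` {b \<in> eigenbasis. eigenvalue b < E})"
  have fin: "finite ?S" using finite_eigenbasis by simp
  have "0 < Min ?S" using fin by (subst Min_gr_iff) auto
  then have pos: "\<delta> > 0" by (simp add: \<delta>_def)
  have "eigenvalue b < E - \<delta>" if "b \<in> eigenbasis" "eigenvalue b < E" for b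
  proof -
    have "Min ?S \<le> E - eigenvalue b" using that fin by (intro Min_le) auto
    then show ?thesis using \<open>0 < Min ?S\<close> by (simp add: \<delta>_def)
  qed
  then have "{b \<in> eigenbasis. eigenvalue b < E - \<delta>} = {b \<in> eigenbasis. eigenvalue b < E}"
    using pos by force
  then show ?thesis using pos by (auto simp: count_below_def)
qed

end

text \<open>Weyl monotonicity: if the inequality failed, some nonzero vector in the span of the low
  eigenvectors of \<open>A'\<close> would be orthogonal to the low eigenvectors of \<open>A\<close>.\<close>

lemma count_below_antimono:
  assumes A: "hermitian_on L A" and A': "hermitian_on L A'"
    and ge: "\<And>\<psi>. \<psi> \<in> ell2_on L \<Longrightarrow> Re (ell2_inner L \<psi> (A' \<psi>))
      \<ge> Re (ell2_inner L \<psi> (A \<psi>)) + \<delta> * Re (ell2_inner L \<psi> \<psi>)"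
  shows "hermitian_on.count_below L A' E \<le> hermitian_on.count_below L A (E - \<delta>)"
proof -
  interpret A: hermitian_on L A by fact
  interpret A': hermitian_on L A' by fact
  define P where "P = {b \<in> A'.eigenbasis. A'.eigenvalue b < E}"
  define Q where "Q = {b \<in> A.eigenbasis. A.eigenvalue b < E - \<delta>}"
  have fin: "finite P" "finite Q"
    using A.finite_eigenbasis A'.finite_eigenbasis by (auto simp: P_def Q_def)
  have "\<not> card Q < card P"
  proof
    assume "card Q < card P"
    from homogeneous_system[OF fin(2,1) this, of "\<lambda>q p. ell2_inner L q p"] obtain c
      where c: "\<exists>p\<in>P. c p \<noteq> 0" "\<forall>q\<in>Q. (\<Sum>p\<in>P. c p * ell2_inner L q p) = 0" by blast
    define \<psi> where "\<psi> = (\<lambda>x. \<Sum>p\<in>P. c p * p x)"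
    have \<psi>L: "\<psi> \<in> ell2_on L"
      unfolding \<psi>_def using A'.eigenbasis_subset by (intro ell2_on_sum) (auto simp: P_def)
    have Q: "ell2_inner L q \<psi> = 0" if "q \<in> Q" for q
      using c(2) that by (simp add: \<psi>_def ell2_inner_sum_right ell2_inner_scale_right)
    have P: "ell2_inner L b \<psi> = (if b \<in> P then c b else 0)" if "b \<in> A'.eigenbasis" for b
      unfolding \<psi>_def by (rule A'.orthonormal_sum_inner[OF A'.eigenbasis _ that]) (auto simp: P_def)
    have "Re (ell2_inner L \<psi> (A \<psi>)) \<ge> (E - \<delta>) * Re (ell2_inner L \<psi> \<psi>)"
      unfolding A.parseval_A[OF \<psi>L] A.parseval_self[OF \<psi>L] Re_complex_of_real sum_distrib_left
    proof (intro sum_mono)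
      fix b assume b: "b \<in> A.eigenbasis"
      show "(E - \<delta>) * (cmod (ell2_inner L b \<psi>))\<^sup>2 \<le> A.eigenvalue b * (cmod (ell2_inner L b \<psi>))\<^sup>2"
      proof (cases "b \<in> Q")
        case True
        then show ?thesis using Q by simp
      next
        case False
        then show ?thesis using b by (intro mult_right_mono) (auto simp: Q_def)
      qed
    qed
    \<comment> \<open>Strictness comes from a nonzero coefficient on \<open>P\<close>, where the
      eigenvalues of \<open>A'\<close> are strictly below \<open>E\<close>.\<close>
    moreover have "Re (ell2_inner L \<psi> (A' \<psi>)) < E * Re (ell2_inner L \<psi> \<psi>)"
      unfolding A'.parseval_A[OF \<psi>L] A'.parseval_self[OF \<psi>L] Re_complex_of_real sum_distrib_left
    proof (rule sum_strict_mono_ex1)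
      show "finite A'.eigenbasis" by (rule A'.finite_eigenbasis)
      show "\<forall>b\<in>A'.eigenbasis. A'.eigenvalue b * (cmod (ell2_inner L b \<psi>))\<^sup>2
          \<le> E * (cmod (ell2_inner L b \<psi>))\<^sup>2"
        using P by (auto simp: P_def intro!: mult_right_mono)
      obtain b where b: "b \<in> P" "c b \<noteq> 0" using c(1) by blast
      then have "b \<in> A'.eigenbasis" by (simp add: P_def)
      with b P show "\<exists>b\<in>A'.eigenbasis. A'.eigenvalue b * (cmod (ell2_inner L b \<psi>))\<^sup>2
          < E * (cmod (ell2_inner L b \<psi>))\<^sup>2"
        by (intro bexI[of _ b]) (auto simp: P_def intro!: mult_strict_right_mono)
    qed
    ultimately show False using ge[OF \<psi>L] by (simp add: algebra_simps)
  qed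
  then show ?thesis by (simp add: A.count_below_def A'.count_below_def P_def Q_def)
qed

section \<open>The box Hamiltonian\<close>

lemma cube_iff: "k \<in> cube l \<longleftrightarrow> (\<forall>j. \<bar>k $ j\<bar> \<le> int l)"
  by (simp add: cube_def norm_sup_def)

text \<open>Reading vectors as functions turns the cube into a product of intervals. Finiteness,
  cardinality and the factorization of exponential sums all rest on this.\<close>

lemma bij_betw_vec_nth_cube:
  "bij_betw vec_nth (cube l :: (int ^ 'd) set) (PiE UNIV (\<lambda>_. {- int l..int l}))"
proof (rule bij_betw_byWitness[where f' = vec_lambda])
  show "vec_nth ` (cube l :: (int ^ 'd) set) \<subseteq> PiE UNIV (\<lambda>_. {- int l..int l})"
    by (auto simp: cube_iff abs_le_iff minus_le_iff)
  show "vec_lambda ` PiE UNIV (\<lambda>_. {- int l..int l}) \<subseteq> (cube l :: (int ^ 'd) set)"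
    by (auto simp: cube_iff abs_le_iff minus_le_iff PiE_iff)
qed (simp_all add: vec_lambda_inverse)

lemma finite_cube: "finite (cube l :: (int ^ 'd) set)"
  using bij_betw_finite[OF bij_betw_vec_nth_cube[where 'd = 'd, of l]] by (simp add: finite_PiE)

lemma card_cube: "card (cube l :: (int ^ 'd) set) = (2 * l + 1) ^ CARD('d)"
proof -
  have "card {- int l..int l} = 2 * l + 1" by simp
  then show ?thesis
    using bij_betw_same_card[OF bij_betw_vec_nth_cube[where 'd = 'd, of l]] by (simp add: card_PiE)
qed

lemma norm1_minus: "norm1 (- k) = norm1 k"
  by (simp add: norm1_def)

lemma component_le_norm1: "\<bar>k $ j\<bar> \<le> norm1 k"
  unfolding norm1_def by (rule member_le_sum) auto

lemma finite_neighbours: "finite {e :: int ^ 'd. norm1 e = 1}"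
proof (rule finite_subset[OF _ finite_cube[of 1]])
  show "{e :: int ^ 'd. norm1 e = 1} \<subseteq> cube 1"
  proof
    fix e :: "int ^ 'd" assume "e \<in> {e. norm1 e = 1}"
    then show "e \<in> cube 1" using component_le_norm1[of e] by (simp add: cube_iff)
  qed
qed

text \<open>The potential is an arbitrary function \<open>W\<close>, so that configurations before
  and after the shift are compared through their potentials alone.\<close>

definition box_operator ::
    "(int ^ 'd) set \<Rightarrow> (int ^ 'd \<Rightarrow> real) \<Rightarrow> (int ^ 'd \<Rightarrow> complex) \<Rightarrow> int ^ 'd \<Rightarrow> complex" where
  "box_operator L W = compression L (\<lambda>\<psi> x. - lattice_laplacian \<psi> x + of_real (W x) * \<psi> x)"

lemma compression_alloy_hamiltonian:
  "compression L (alloy_hamiltonian lam u \<omega>) = box_operator L (\<lambda>x. lam * alloy_potential u \<omega> x)"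
  unfolding box_operator_def alloy_hamiltonian_def ..

text \<open>On functions supported in \<open>L\<close> the Laplacian is the adjacency matrix of the
  lattice, a kernel symmetric in x and y.\<close>

lemma laplacian_eq_sum:
  assumes "finite L" "\<psi> \<in> ell2_on L"
  shows "lattice_laplacian \<psi> x = (\<Sum>y\<in>L. of_bool (norm1 (y - x) = 1) * \<psi> y)"
proof -
  have "(\<Sum>y\<in>L. of_bool (norm1 (y - x) = 1) * \<psi> y) = (\<Sum>y\<in>{y\<in>L. norm1 (y - x) = 1}. \<psi> y)"
    using assms by (intro sum.mono_neutral_cong_right) auto
  also have "\<dots> = (\<Sum>e\<in>{e. norm1 e = 1 \<and> x + e \<in> L}. \<psi> (x + e))"
    by (rule sum.reindex_bij_witness[of _ "\<lambda>e. x + e" "\<lambda>y. y - x"]) auto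
  also have "\<dots> = (\<Sum>e\<in>{e. norm1 e = 1}. \<psi> (x + e))"
    using assms finite_neighbours by (intro sum.mono_neutral_left) (auto simp: ell2_on_def)
  finally show ?thesis by (simp add: lattice_laplacian_def)
qed

lemma box_operator_eq:
  assumes "finite L" "\<psi> \<in> ell2_on L"
  shows "box_operator L W \<psi> = (\<lambda>x. if x \<in> L
    then - (\<Sum>y\<in>L. of_bool (norm1 (y - x) = 1) * \<psi> y) + of_real (W x) * \<psi> x else 0)"
proof -
  have "(\<lambda>y. if y \<in> L then \<psi> y else 0) = \<psi>" using assms by (auto simp: ell2_on_def)
  then show ?thesis
    by (simp add: box_operator_def compression_def laplacian_eq_sum[OF assms] cong: if_cong)
qed

lemma inner_box_operator:
  assumes "finite L" "\<psi> \<in> ell2_on L"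
  shows "ell2_inner L \<phi> (box_operator L W \<psi>) =
    - (\<Sum>x\<in>L. \<Sum>y\<in>L. of_bool (norm1 (y - x) = 1) * (cnj (\<phi> x) * \<psi> y))
    + (\<Sum>x\<in>L. of_real (W x) * (cnj (\<phi> x) * \<psi> x))"
proof -
  have "ell2_inner L \<phi> (box_operator L W \<psi>) = (\<Sum>x\<in>L.
      - (\<Sum>y\<in>L. of_bool (norm1 (y - x) = 1) * (cnj (\<phi> x) * \<psi> y))
      + of_real (W x) * (cnj (\<phi> x) * \<psi> x))"
    unfolding ell2_inner_def box_operator_eq[OF assms]
    by (intro sum.cong refl) (simp add: right_diff_distrib sum_distrib_left mult.left_commute)
  then show ?thesis by (simp only: sum.distrib sum_negf)
qed

lemma hermitian_box_operator:
  assumes L: "finite L"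
  shows "hermitian_on L (box_operator L W)"
proof
  show "finite L" by fact
  show "box_operator L W \<psi> \<in> ell2_on L" for \<psi>
    by (simp add: box_operator_def compression_def ell2_on_def)
next
  fix \<phi> \<psi> :: "int ^ 'a \<Rightarrow> complex" and a b
  assume "\<phi> \<in> ell2_on L" "\<psi> \<in> ell2_on L"
  moreover from this have "(\<lambda>x. a * \<phi> x + b * \<psi> x) \<in> ell2_on L" by (simp add: ell2_on_def)
  ultimately show "box_operator L W (\<lambda>x. a * \<phi> x + b * \<psi> x)
      = (\<lambda>x. a * box_operator L W \<phi> x + b * box_operator L W \<psi> x)"
    by (auto simp: box_operator_eq[OF L] algebra_simps sum.distrib sum_distrib_left)
next
  fix \<phi> \<psi> :: "int ^ 'a \<Rightarrow> complex"
  assume *: "\<phi> \<in> ell2_on L" "\<psi> \<in> ell2_on L"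
  have cnj_of_bool: "cnj (of_bool P) = of_bool P" for P by (cases P) auto
  have sym: "norm1 (y - x) = norm1 (x - y)" for x y :: "int ^ 'a"
    using norm1_minus[of "x - y"] by simp
  have "ell2_inner L (box_operator L W \<phi>) \<psi> = cnj (ell2_inner L \<psi> (box_operator L W \<phi>))"
    by (simp add: ell2_inner_commute)
  also have "\<dots> = - (\<Sum>x\<in>L. \<Sum>y\<in>L. of_bool (norm1 (y - x) = 1) * (cnj (\<phi> y) * \<psi> x))
    + (\<Sum>x\<in>L. of_real (W x) * (cnj (\<phi> x) * \<psi> x))"
    by (simp add: inner_box_operator[OF L *(1)] cnj_of_bool mult.commute)
  also have "(\<Sum>x\<in>L. \<Sum>y\<in>L. of_bool (norm1 (y - x) = 1) * (cnj (\<phi> y) * \<psi> x))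
      = (\<Sum>x\<in>L. \<Sum>y\<in>L. of_bool (norm1 (y - x) = 1) * (cnj (\<phi> x) * \<psi> y))"
    by (subst sum.swap) (simp add: sym)
  finally show "ell2_inner L \<phi> (box_operator L W \<psi>) = ell2_inner L (box_operator L W \<phi>) \<psi>"
    by (simp add: inner_box_operator[OF L *(2)])
qed

section \<open>The eigenvalue count as a function of the potential\<close>

definition box_count :: "(int ^ 'd) set \<Rightarrow> (int ^ 'd \<Rightarrow> real) \<Rightarrow> real \<Rightarrow> nat" where
  "box_count L W = hermitian_on.count_below L (box_operator L W)"

text \<open>The Laplacian is common to both quadratic forms, so a pointwise gap between the
  potentials is a gap between the forms. The gap \<delta> may be negative.\<close>

lemma box_count_antimono:
  assumes L: "finite L" and W: "\<And>x. x \<in> L \<Longrightarrow> W x + \<delta> \<le> W' x"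
  shows "box_count L W' E \<le> box_count L W (E - \<delta>)"
  unfolding box_count_def
proof (rule count_below_antimono[OF hermitian_box_operator[OF L] hermitian_box_operator[OF L]])
  fix \<psi> :: "int ^ 'a \<Rightarrow> complex"
  assume \<psi>: "\<psi> \<in> ell2_on L"
  have re: "Re (of_real r * (cnj z * z)) = r * (cmod z)\<^sup>2" for r z
    by (metis Re_complex_of_real complex_norm_square mult.commute of_real_mult)
  have "(\<Sum>x\<in>L. W x * (cmod (\<psi> x))\<^sup>2) + \<delta> * (\<Sum>x\<in>L. (cmod (\<psi> x))\<^sup>2)
      \<le> (\<Sum>x\<in>L. W' x * (cmod (\<psi> x))\<^sup>2)"
    unfolding sum_distrib_left sum.distrib[symmetric] distrib_right[symmetric]
    by (intro sum_mono mult_right_mono W) auto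
  then show "Re (ell2_inner L \<psi> (box_operator L W' \<psi>))
      \<ge> Re (ell2_inner L \<psi> (box_operator L W \<psi>)) + \<delta> * Re (ell2_inner L \<psi> \<psi>)"
    unfolding inner_box_operator[OF L \<psi>] ell2_inner_self plus_complex.sel Re_sum re
      Re_complex_of_real by linarith
qed

text \<open>Lower semicontinuity in the potential: the count survives a small decrease of
  \<open>E\<close>, and a perturbation by less than \<delta> on \<open>L\<close> moves eigenvalues
  by at most \<delta>. As \<open>L\<close> is finite, such perturbations form an open set of the
  product topology.\<close>

lemma open_box_count_greater:
  fixes L :: "(int ^ 'd) set"
  assumes L: "finite L"
  shows "open {W. r < real (box_count L W E)}"
proof (subst open_subopen, intro ballI)
  fix W assume "W \<in> {W. r < real (box_count L W E)}"
  then have W: "r < real (box_count L W E)" by simp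
  obtain \<delta> where \<delta>: "\<delta> > 0" "box_count L W (E - \<delta>) = box_count L W E"
    using hermitian_on.count_below_left_constant[OF hermitian_box_operator[OF L]]
    unfolding box_count_def by blast
  define T where "T = (\<Inter>x\<in>L. (\<lambda>W'. W' x) -` {W x - \<delta><..<W x + \<delta>})"
  have "open T"
    unfolding T_def
    by (intro open_INT L ballI open_vimage open_greaterThanLessThan continuous_on_product_coordinates)
  moreover have "W \<in> T" using \<delta>(1) by (simp add: T_def)
  moreover have "T \<subseteq> {W. r < real (box_count L W E)}"
  proof
    fix W' assume "W' \<in> T"
    then have "W' x + (- \<delta>) \<le> W x" if "x \<in> L" for x using that by (force simp: T_def)
    \<comment> \<open>Weyl monotonicity with the negative gap -\<delta>, evaluated at E - \<delta>
      so that the count of \<open>W'\<close> is taken at \<open>E\<close>.\<close>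
    then have "box_count L W (E - \<delta>) \<le> box_count L W' (E - \<delta> - - \<delta>)"
      by (intro box_count_antimono[OF L])
    then have "box_count L W E \<le> box_count L W' E" using \<delta>(2) by simp
    with W show "W' \<in> {W. r < real (box_count L W E)}" by simp
  qed
  ultimately show "\<exists>T. open T \<and> W \<in> T \<and> T \<subseteq> {W. r < real (box_count L W E)}" by blast
qed

lemma borel_measurable_open_greater:
  fixes f :: "'a :: topological_space \<Rightarrow> real"
  assumes "\<And>r. open {x. r < f x}"
  shows "f \<in> borel_measurable borel"
  using assms by (intro borel_measurable_iff_greater[THEN iffD2]) simp

lemma box_count_measurable:
  fixes V :: "'b \<Rightarrow> int ^ 'd \<Rightarrow> real"
  assumes L: "finite L" and V: "\<And>x. (\<lambda>\<omega>. V \<omega> x) \<in> borel_measurable M"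
  shows "(\<lambda>\<omega>. real (box_count L (V \<omega>) E)) \<in> borel_measurable M"
proof -
  define f where "f W = real (box_count L W E)" for W
  have "f \<in> borel_measurable borel"
    by (rule borel_measurable_open_greater) (simp add: f_def open_box_count_greater[OF L])
  moreover have "V \<in> borel_measurable M" using V by (rule measurable_coordinatewise_then_product)
  ultimately have "(\<lambda>\<omega>. f (V \<omega>)) \<in> borel_measurable M" by (rule measurable_compose[rotated])
  then show ?thesis by (simp add: f_def)
qed

section \<open>Test functions\<close>

text \<open>The standard function exp(-1/x) that is flat at 0, times an arbitrary polynomial in 1/x,
  so that the class is closed under differentiation.\<close>

definition flat :: "real poly \<Rightarrow> real \<Rightarrow> real" where
  "flat p x = (if x > 0 then poly p (1 / x) * exp (- 1 / x) else 0)"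

lemma poly_times_exp_minus_tendsto_0: "((\<lambda>y::real. poly p y * exp (- y)) \<longlongrightarrow> 0) at_top"
proof -
  have "((\<lambda>y::real. \<Sum>i\<le>degree p. coeff p i * (y ^ i / exp y)) \<longlongrightarrow> (\<Sum>i\<le>degree p. coeff p i * 0)) at_top"
    by (intro tendsto_intros tendsto_power_div_exp_0)
  then show ?thesis
    by (simp add: poly_altdef exp_minus sum_distrib_right sum_divide_distrib divide_inverse mult.assoc)
qed

text \<open>For x > 0 the product and chain rules give x^(-2) (p - p')(1/x) exp(-1/x); the factor
  x^(-2) is the polynomial \<open>[:0, 0, 1:]\<close> at 1/x.\<close>

lemma flat_has_derivative:
  "(flat p has_real_derivative flat ([:0, 0, 1:] * (p - pderiv p)) x) (at x)"
proof -
  consider "x < 0" | "x = 0" | "x > 0" by linarith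
  then show ?thesis
  proof cases
    case 1
    have "((\<lambda>_. 0) has_real_derivative 0) (at x)" by simp
    then have "(flat p has_real_derivative 0) (at x)"
      by (rule has_field_derivative_transform_within_open[of _ _ _ "{..<0}"])
         (use 1 in \<open>auto simp: flat_def\<close>)
    then show ?thesis using 1 by (simp add: flat_def)
  next
    case 2
    \<comment> \<open>With x = 1/y the right difference quotient at 0 is y p(y) exp(-y).\<close>
    have "((\<lambda>y. poly (pCons 0 p) y * exp (- y)) \<longlongrightarrow> 0) at_top"
      by (rule poly_times_exp_minus_tendsto_0)
    then have "((\<lambda>y. (flat p (inverse y) - flat p 0) / (inverse y - 0)) \<longlongrightarrow> 0) at_top"
      by (rule tendsto_cong[THEN iffD1, rotated])
         (auto simp: flat_def field_simps intro!: eventually_mono[OF eventually_gt_at_top[of 0]])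
    then have right: "((\<lambda>y. (flat p y - flat p 0) / (y - 0)) \<longlongrightarrow> 0) (at_right 0)"
      unfolding filterlim_at_right_to_top .
    have left: "((\<lambda>y. (flat p y - flat p 0) / (y - 0)) \<longlongrightarrow> 0) (at_left 0)"
      by (rule tendsto_eventually) (auto simp: flat_def eventually_at_filter)
    have "flat ([:0, 0, 1:] * (p - pderiv p)) x = 0" using 2 by (simp add: flat_def)
    then show ?thesis
      unfolding has_field_derivative_iff 2 using filterlim_split_at[OF left right] by simp
  next
    case 3
    have "((\<lambda>x. poly p (1 / x) * exp (- 1 / x)) has_real_derivative
        flat ([:0, 0, 1:] * (p - pderiv p)) x) (at x)"
      using 3 by (auto intro!: derivative_eq_intros simp: flat_def field_simps power2_eq_square)
    then show ?thesis
      by (rule has_field_derivative_transform_within_open[of _ _ _ "{0<..}"])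
         (use 3 in \<open>auto simp: flat_def\<close>)
  qed
qed

text \<open>The derivative of every generator stays in the class, so rule induction gives infinite
  differentiability.\<close>

inductive smooth :: "(real \<Rightarrow> real) \<Rightarrow> bool" where
  flat: "smooth (flat p)"
| const: "smooth (\<lambda>_. c)"
| add: "smooth f \<Longrightarrow> smooth g \<Longrightarrow> smooth (\<lambda>x. f x + g x)"
| mult: "smooth f \<Longrightarrow> smooth g \<Longrightarrow> smooth (\<lambda>x. f x * g x)"
| affine: "smooth f \<Longrightarrow> smooth (\<lambda>x. f (a * x + b))"
| antiderivative: "smooth f \<Longrightarrow> (\<forall>x. (F has_real_derivative f x) (at x)) \<Longrightarrow> smooth F"

lemma smooth_derivative:
  assumes "smooth f"
  shows "\<exists>f'. smooth f' \<and> (\<forall>x. (f has_real_derivative f' x) (at x))"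
  using assms
proof induction
  case (flat p)
  show ?case using flat_has_derivative smooth.flat by blast
next
  case (const c)
  show ?case using smooth.const[of 0] by (intro exI[of _ "\<lambda>_. 0"]) auto
next
  case (add f g)
  then obtain f' g' where "smooth f'" "smooth g'"
    "\<forall>x. (f has_real_derivative f' x) (at x)" "\<forall>x. (g has_real_derivative g' x) (at x)" by blast
  then show ?case
    by (intro exI[of _ "\<lambda>x. f' x + g' x"]) (auto intro!: smooth.add derivative_intros)
next
  case (mult f g)
  then obtain f' g' where *: "smooth f'" "smooth g'"
    "\<forall>x. (f has_real_derivative f' x) (at x)" "\<forall>x. (g has_real_derivative g' x) (at x)" by blast
  have "smooth (\<lambda>x. f' x * g x + g' x * f x)"
    by (rule smooth.add[OF smooth.mult[OF *(1) mult.hyps(2)] smooth.mult[OF *(2) mult.hyps(1)]])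
  with * show ?case
    by (intro exI[of _ "\<lambda>x. f' x * g x + g' x * f x"]) (auto intro!: DERIV_mult)
next
  case (affine f a b)
  then obtain f' where *: "smooth f'" "\<forall>x. (f has_real_derivative f' x) (at x)" by blast
  have "smooth (\<lambda>x. f' (a * x + b) * a)"
    by (rule smooth.mult[OF smooth.affine[OF *(1)] smooth.const])
  moreover have "((\<lambda>x. f (a * x + b)) has_real_derivative f' (a * x + b) * a) (at x)" for x
    by (rule DERIV_chain2[OF *(2)[rule_format]]) (auto intro!: derivative_eq_intros)
  ultimately show ?case by blast
next
  case (antiderivative f F)
  then show ?case by blast
qed

lemma smooth_deriv: "smooth f \<Longrightarrow> smooth (deriv f)"
  and smooth_has_derivative: "smooth f \<Longrightarrow> (f has_real_derivative deriv f x) (at x)"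
proof -
  assume "smooth f"
  then obtain f' where *: "smooth f'" "\<And>x. (f has_real_derivative f' x) (at x)"
    using smooth_derivative by blast
  then have "deriv f = f'" by (auto intro: DERIV_imp_deriv)
  with * show "smooth (deriv f)" "(f has_real_derivative deriv f x) (at x)" by auto
qed

lemma smooth_continuous: "smooth f \<Longrightarrow> continuous_on S f"
  by (meson DERIV_isCont continuous_at_imp_continuous_on smooth_has_derivative)

lemma smooth_measurable: "smooth f \<Longrightarrow> f \<in> borel_measurable borel"
  by (intro borel_measurable_continuous_onI smooth_continuous)

lemma smooth_higher_deriv: "smooth f \<Longrightarrow> smooth ((deriv ^^ n) f)"
  by (induction n) (auto intro: smooth_deriv)

lemma test_function_smooth:
  assumes "smooth f" "\<And>x. x \<notin> {b..c} \<Longrightarrow> f x = 0"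
  shows "test_function f"
  unfolding test_function_def
proof
  show "\<forall>n. (deriv ^^ n) f differentiable_on UNIV"
    using smooth_has_derivative[OF smooth_higher_deriv[OF assms(1)]]
    by (auto simp: differentiable_on_def real_differentiable_def)
  have "closure {x. f x \<noteq> 0} \<subseteq> {b..c}" using assms(2) by (intro closure_minimal subsetI) (blast, simp)
  then show "compact (closure {x. f x \<noteq> 0})"
    by (meson bounded_closed_interval bounded_subset closed_closure compact_eq_bounded_closed)
qed

lemma continuous_compact_support_bounded:
  fixes f :: "real \<Rightarrow> real"
  assumes "continuous_on UNIV f" "\<And>x. x \<notin> {b..c} \<Longrightarrow> f x = 0"
  shows "\<exists>B\<ge>0. \<forall>x. \<bar>f x\<bar> \<le> B"
proof -
  have "compact (f ` {b..c})"
    by (intro compact_continuous_image continuous_on_subset[OF assms(1)]) auto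
  then obtain B where B: "\<And>x. x \<in> {b..c} \<Longrightarrow> \<bar>f x\<bar> \<le> B"
    using compact_imp_bounded bounded_real by (metis imageI)
  show ?thesis
  proof (intro exI[of _ "max B 0"] conjI allI)
    show "\<bar>f x\<bar> \<le> max B 0" for x
      by (cases "x \<in> {b..c}") (use B assms(2) in \<open>auto simp: le_max_iff_disj\<close>)
  qed simp
qed

text \<open>The first factor switches on at x and steepens with n, the second cuts off at x + n; for
  fixed y > x both tend to 1. The arguments are written in affine form to match the rule for
  \<open>smooth\<close>.\<close>

lemma bump_tendsto_indicator:
  fixes x y :: real
  shows "(\<lambda>n. flat 1 (real n * y + - real n * x) * flat 1 (- 1 * y + (x + real n)))
    \<longlonglongrightarrow> indicator {x<..} y"
proof (cases "x < y")
  case True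
  have "(\<lambda>n. exp (- 1 / (real n * (y - x))) * exp (- 1 / (real n - (y - x)))) \<longlonglongrightarrow> exp 0 * exp 0"
  proof (intro tendsto_intros)
    have "filterlim (\<lambda>n. real n * (y - x)) at_top sequentially"
      using filterlim_tendsto_pos_mult_at_top[OF tendsto_const _ filterlim_real_sequentially, of "y - x"]
        True by (simp add: mult.commute)
    then show "(\<lambda>n. - 1 / (real n * (y - x))) \<longlonglongrightarrow> 0"
      by (intro tendsto_divide_0[OF tendsto_const] filterlim_at_top_imp_at_infinity)
    have "filterlim (\<lambda>n. - (y - x) + real n) at_top sequentially"
      by (intro filterlim_tendsto_add_at_top[OF tendsto_const] filterlim_real_sequentially)
    then show "(\<lambda>n. - 1 / (real n - (y - x))) \<longlonglongrightarrow> 0"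
      by (intro tendsto_divide_0[OF tendsto_const] filterlim_at_top_imp_at_infinity)
         (simp add: algebra_simps)
  qed
  moreover have "eventually (\<lambda>n. exp (- 1 / (real n * (y - x))) * exp (- 1 / (real n - (y - x)))
      = flat 1 (real n * y + - real n * x) * flat 1 (- 1 * y + (x + real n))) sequentially"
  proof -
    have "eventually (\<lambda>n. real n > y - x) sequentially"
      using filterlim_real_sequentially unfolding filterlim_at_top_dense by blast
    then show ?thesis
    proof (rule eventually_mono)
      fix n assume n: "real n > y - x"
      then have "real n > 0" using True by linarith
      then have "real n * x < real n * y" using True by simp
      then show "exp (- 1 / (real n * (y - x))) * exp (- 1 / (real n - (y - x)))
          = flat 1 (real n * y + - real n * x) * flat 1 (- 1 * y + (x + real n))"
        using n by (simp add: flat_def algebra_simps)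
    qed
  qed
  ultimately show ?thesis using True by (simp add: tendsto_cong)
next
  case False
  then have "flat 1 (real n * y + - real n * x) = 0" for n
    using mult_left_mono[of y x "real n"] by (simp add: flat_def)
  then show ?thesis using False by simp
qed

lemma flat_1_bounds: "0 \<le> flat 1 x" "flat 1 x \<le> 1"
  by (auto simp: flat_def)

text \<open>Bumps approximate half lines, so \<open>k\<close> integrates to 0 over each of them. The
  measures with densities \<open>k^+\<close> and \<open>k^-\<close> then agree on half lines, hence
  everywhere, and their densities agree almost everywhere.\<close>

lemma AE_zero_if_orthogonal_to_test_functions:
  fixes k :: "real \<Rightarrow> real"
  assumes k: "integrable lborel k"
    and orth: "\<And>h b c. smooth h \<Longrightarrow> (\<And>x. x \<notin> {b..c} \<Longrightarrow> h x = 0) \<Longrightarrow>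
      (\<integral>x. k x * h x \<partial>lborel) = 0"
  shows "AE x in lborel. k x = 0"
proof -
  have [measurable]: "k \<in> borel_measurable borel" using k by auto
  have half_line: "(\<integral>y. k y * indicator {x<..} y \<partial>lborel) = 0" for x
  proof -
    define h where "h n y = flat 1 (real n * y + - real n * x) * flat 1 (- 1 * y + (x + real n))"
      for n y
    have smooth_h: "smooth (h n)" for n
      unfolding h_def by (rule smooth.mult[OF smooth.affine[OF smooth.flat] smooth.affine[OF smooth.flat]])
    have [measurable]: "h n \<in> borel_measurable borel" for n
      by (intro smooth_measurable smooth_h)
    have h_bound: "\<bar>h n y\<bar> \<le> 1" for n y
      unfolding h_def using flat_1_bounds by (auto simp: abs_mult intro!: mult_le_one)
    have h_support: "h n y = 0" if "y \<notin> {x..x + real n}" for n y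
    proof (cases "y < x")
      case True
      then have "real n * y \<le> real n * x" by (simp add: mult_left_mono)
      then show ?thesis by (simp add: h_def flat_def)
    next
      case False
      with that show ?thesis by (simp add: h_def flat_def)
    qed
    have "(\<lambda>n. \<integral>y. k y * h n y \<partial>lborel) \<longlonglongrightarrow> (\<integral>y. k y * indicator {x<..} y \<partial>lborel)"
    proof (rule integral_dominated_convergence[where w = "\<lambda>y. \<bar>k y\<bar>"])
      show "AE y in lborel. (\<lambda>n. k y * h n y) \<longlonglongrightarrow> k y * indicator {x<..} y"
        unfolding h_def by (intro AE_I2 tendsto_mult tendsto_const bump_tendsto_indicator)
      show "AE y in lborel. norm (k y * h n y) \<le> \<bar>k y\<bar>" for n
        using h_bound[of n] by (intro AE_I2) (simp add: abs_mult mult_left_le)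
    qed (use k in auto)
    moreover have "(\<integral>y. k y * h n y \<partial>lborel) = 0" for n
      by (rule orth[OF smooth_h h_support])
    ultimately show ?thesis by (simp add: LIMSEQ_const_iff)
  qed
  define M where "M s = density lborel (\<lambda>x. ennreal (max 0 (s * k x)))" for s :: real
  have int: "integrable lborel (\<lambda>x. max 0 (s * k x) * indicator A x)"
    if "A \<in> sets borel" for s A
    using k that by (intro integrable_real_mult_indicator) auto
  have em: "emeasure (M s) A = ennreal (\<integral>x. max 0 (s * k x) * indicator A x \<partial>lborel)"
    if [measurable]: "A \<in> sets borel" for s A
  proof -
    have "emeasure (M s) A = (\<integral>\<^sup>+x. ennreal (max 0 (s * k x) * indicator A x) \<partial>lborel)"
      unfolding M_def by (subst emeasure_density) (auto simp: ennreal_mult'' ennreal_indicator)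
    also have "\<dots> = ennreal (\<integral>x. max 0 (s * k x) * indicator A x \<partial>lborel)"
      by (intro nn_integral_eq_integral int that) auto
    finally show ?thesis .
  qed
  have "M 1 = M (- 1)"
  proof (rule measure_eqI_lessThan)
    fix x
    have "(\<integral>y. max 0 (1 * k y) * indicator {x<..} y \<partial>lborel)
        - (\<integral>y. max 0 (- 1 * k y) * indicator {x<..} y \<partial>lborel)
        = (\<integral>y. max 0 (1 * k y) * indicator {x<..} y - max 0 (- 1 * k y) * indicator {x<..} y \<partial>lborel)"
      by (rule Bochner_Integration.integral_diff[symmetric]; rule int) auto
    also have "\<dots> = (\<integral>y. k y * indicator {x<..} y \<partial>lborel)"
      by (intro Bochner_Integration.integral_cong) (auto simp: indicator_def max_def)
    finally show "emeasure (M 1) {x<..} = emeasure (M (- 1)) {x<..}"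
      using half_line by (simp add: em)
    show "emeasure (M 1) {x<..} < \<infinity>" by (simp add: em)
  qed (simp_all add: M_def)
  then have "AE x in lborel. ennreal (max 0 (1 * k x)) = ennreal (max 0 (- 1 * k x))"
    unfolding M_def by (intro sigma_finite_measure.density_unique[OF sigma_finite_lborel]) auto
  then show ?thesis by eventually_elim (auto simp: max_def split: if_splits)
qed

section \<open>Translates of functions of bounded variation\<close>

lemma smooth_compact_antiderivative:
  assumes h: "smooth h" "\<And>x. x \<notin> {b..c} \<Longrightarrow> h x = 0"
  shows "\<exists>F. \<forall>x. (F has_real_derivative h x) (at x)"
proof -
  \<comment> \<open>Starting one unit left of the support makes \<open>F\<close> vanish for x < b
    and places every x \<ge> b in the interior of the interval used for the fundamental
    theorem.\<close>
  define F where "F x = integral {b - 1..x} h" for x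
  have "(F has_real_derivative h x) (at x)" for x
  proof (cases "x < b")
    case True
    have "((\<lambda>_. 0) has_real_derivative 0) (at x)" by simp
    then have "(F has_real_derivative 0) (at x)"
    proof (rule has_field_derivative_transform_within_open[of _ _ _ "{..<b}"])
      fix y assume y: "y \<in> {..<b}"
      have "F y = integral {b - 1..y} (\<lambda>_. 0 :: real)"
        unfolding F_def using h(2) y by (intro integral_cong) auto
      then show "0 = F y" by simp
    qed (use True in auto)
    then show ?thesis using h(2) True by simp
  next
    case False
    have "(F has_vector_derivative h x) (at x within {b - 1..x + 1})"
      unfolding F_def using False
      by (intro integral_has_vector_derivative smooth_continuous h) auto
    then have "(F has_vector_derivative h x) (at x)"
      using False by (simp add: at_within_Icc_at)
    then show ?thesis by (simp add: has_real_derivative_iff_has_vector_derivative)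
  qed
  then show ?thesis by blast
qed

text \<open>Fubini on the strip x \<le> y \<le> x + a: its sections in y have length
  \<open>a\<close>, its sections in x are the windows \<open>{y - a..y}\<close>.\<close>

lemma window_integral:
  fixes M :: "real measure"
  assumes fin: "finite_measure M" and sets[measurable_cong]: "sets M = sets borel" and a: "0 \<le> a"
  shows "integrable lborel (\<lambda>y. measure M {y - a..y})"
    and "(\<integral>y. measure M {y - a..y} \<partial>lborel) = a * measure M UNIV"
    and "h \<in> borel_measurable borel \<Longrightarrow> (\<And>y. \<bar>h y\<bar> \<le> B) \<Longrightarrow>
      (\<integral>x. (\<integral>y. indicator {x..x + a} y * h y \<partial>lborel) \<partial>M) = (\<integral>y. h y * measure M {y - a..y} \<partial>lborel)"
proof -
  interpret M: finite_measure M by (rule fin)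
  interpret P: pair_sigma_finite M lborel ..
  have space: "space M = UNIV" using sets_eq_imp_space_eq[OF sets] by simp
  define J where "J = (\<lambda>x y :: real. indicator {x..x + a} y :: real)"
  have J_alt: "J x y = indicator {y - a..y} x" for x y by (auto simp: J_def indicator_def)
  have [measurable]: "case_prod J \<in> borel_measurable (M \<Otimes>\<^sub>M lborel)"
  proof -
    have "case_prod J = (\<lambda>z. if fst z \<le> snd z \<and> snd z \<le> fst z + a then 1 else 0)"
      by (auto simp: J_def indicator_def fun_eq_iff)
    then show ?thesis by simp
  qed
  have "(\<integral>\<^sup>+z. ennreal (norm (case_prod J z)) \<partial>(M \<Otimes>\<^sub>M lborel))
      = (\<integral>\<^sup>+x. (\<integral>\<^sup>+y. indicator {x..x + a} y \<partial>lborel) \<partial>M)"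
  proof -
    have "(\<lambda>z. ennreal (norm (case_prod J z))) \<in> borel_measurable (M \<Otimes>\<^sub>M lborel)" by measurable
    from lborel.nn_integral_fst[OF this] show ?thesis by (simp add: J_def ennreal_indicator)
  qed
  also have "\<dots> = ennreal a * emeasure M UNIV" using a by (simp add: space)
  finally have "(\<integral>\<^sup>+z. ennreal (norm (case_prod J z)) \<partial>(M \<Otimes>\<^sub>M lborel)) < \<infinity>"
    using M.emeasure_finite[of UNIV] by (simp add: M.emeasure_eq_measure ennreal_mult[symmetric] a)
  then have int: "integrable (M \<Otimes>\<^sub>M lborel) (case_prod J)" by (intro integrableI_bounded) auto
  have inner: "(\<integral>x. J x y \<partial>M) = measure M {y - a..y}" for y
    unfolding J_alt using sets by simp
  show "integrable lborel (\<lambda>y. measure M {y - a..y})"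
    using P.integrable_snd[OF int] unfolding inner .
  have "(\<integral>y. measure M {y - a..y} \<partial>lborel) = (\<integral>x. (\<integral>y. J x y \<partial>lborel) \<partial>M)"
    using P.integral_snd[OF int] P.integral_fst[OF int] unfolding inner by simp
  also have "\<dots> = a * measure M UNIV" unfolding J_def using a by (simp add: space)
  finally show "(\<integral>y. measure M {y - a..y} \<partial>lborel) = a * measure M UNIV" .
  assume [measurable]: "h \<in> borel_measurable borel" and B: "\<And>y. \<bar>h y\<bar> \<le> B"
  have int': "integrable (M \<Otimes>\<^sub>M lborel) (\<lambda>(x, y). J x y * h y)"
  proof (rule Bochner_Integration.integrable_bound)
    show "integrable (M \<Otimes>\<^sub>M lborel) (\<lambda>z. B * case_prod J z)" using int by simp
    have "\<bar>J x y * h y\<bar> \<le> \<bar>B * J x y\<bar>" for x y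
      using B[of y] by (auto simp: J_def indicator_def)
    then show "AE z in M \<Otimes>\<^sub>M lborel. norm (case z of (x, y) \<Rightarrow> J x y * h y) \<le> norm (B * case_prod J z)"
      by (intro AE_I2) auto
  qed measurable
  have "(\<integral>x. (\<integral>y. J x y * h y \<partial>lborel) \<partial>M) = (\<integral>y. (\<integral>x. J x y * h y \<partial>M) \<partial>lborel)"
    using P.integral_snd[OF int'] P.integral_fst[OF int'] by simp
  then show "(\<integral>x. (\<integral>y. indicator {x..x + a} y * h y \<partial>lborel) \<partial>M)
      = (\<integral>y. h y * measure M {y - a..y} \<partial>lborel)"
    by (simp add: J_def[symmetric] inner mult.commute)
       (simp add: J_def)
qed

text \<open>Almost everywhere f(x) - f(x - a) is the derivative measure of
  \<open>{x - a..x}\<close>, and integrating the total variation of these windows gives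
  \<open>a\<close> times the norm. The identity is proved weakly, since \<open>f\<close> is
  determined only up to null sets.\<close>

lemma BV_translation_nonneg:
  assumes f: "f \<in> BV" and a: "0 \<le> a"
  shows "(\<integral>x. \<bar>f x - f (x - a)\<bar> \<partial>lborel) \<le> a * var_norm f"
proof -
  \<comment> \<open>The same choice as in \<open>var_norm\<close>, so that the estimate is expressed
    in that norm.\<close>
  define \<mu> where "\<mu> = (SOME \<mu>. is_distributional_derivative f \<mu>)"
  have int_f: "integrable lborel f" using f by (simp add: BV_def)
  have "\<exists>\<mu>. is_distributional_derivative f \<mu>" using f by (simp add: BV_def)
  then have \<mu>: "is_distributional_derivative f \<mu>" unfolding \<mu>_def by (rule someI_ex)
  define P where "P = upper_variation \<mu>"
  define N where "N = lower_variation \<mu>"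
  have sets_upper: "sets (upper_variation \<sigma>) = sets borel" for \<sigma>
    unfolding upper_variation_def using sets.sigma_sets_eq[of "borel :: real measure"] by simp
  have sets: "sets P = sets borel" "sets N = sets borel"
    by (simp_all add: P_def N_def lower_variation_def sets_upper)
  have space: "space P = UNIV" "space N = UNIV" using sets[THEN sets_eq_imp_space_eq] by auto
  have tv: "emeasure P UNIV + emeasure N UNIV < \<infinity>"
    using \<mu> by (simp add: is_distributional_derivative_def total_variation_def P_def N_def)
  have finP: "finite_measure P" and finN: "finite_measure N"
    using tv space by (auto intro!: finite_measureI simp: less_top)
  interpret P: finite_measure P by (rule finP)
  interpret N: finite_measure N by (rule finN)
  have var: "var_norm f = measure P UNIV + measure N UNIV"
    unfolding var_norm_def \<mu>_def[symmetric] total_variation_def P_def[symmetric] N_def[symmetric]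
      measure_def using tv by (intro enn2real_plus) (auto simp: less_top)
  have parts: "(\<integral>x. f x * deriv \<phi> x \<partial>lborel) = - ((\<integral>x. \<phi> x \<partial>P) - (\<integral>x. \<phi> x \<partial>N))"
    if "test_function \<phi>" for \<phi>
    using \<mu> that by (simp add: is_distributional_derivative_def signed_integral_def P_def N_def)
  define w where "w y = measure P {y - a..y} - measure N {y - a..y}" for y
  note wP = window_integral[OF finP sets(1) a]
  note wN = window_integral[OF finN sets(2) a]
  have int_w: "integrable lborel w" unfolding w_def using wP(1) wN(1) by simp
  have int_shift: "integrable lborel (\<lambda>x. f (x - a))"
    using lborel_integrable_real_affine[OF int_f, of 1 "- a"] by simp
  have "AE x in lborel. f x - f (x - a) - w x = 0"
  proof (rule AE_zero_if_orthogonal_to_test_functions)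
    show "integrable lborel (\<lambda>x. f x - f (x - a) - w x)" using int_f int_shift int_w by simp
    fix h b c assume h: "smooth h" "\<And>x. x \<notin> {b..c} \<Longrightarrow> h x = 0"
    have hm[measurable]: "h \<in> borel_measurable borel" by (rule smooth_measurable[OF h(1)])
    obtain B where B: "\<And>x. \<bar>h x\<bar> \<le> B"
      using continuous_compact_support_bounded[OF smooth_continuous[OF h(1)] h(2)] by blast
    have int_h: "integrable lborel (\<lambda>x. g x * h x)" if "integrable lborel g" for g
    proof (rule Bochner_Integration.integrable_bound)
      show "integrable lborel (\<lambda>x. B * g x)" using that by simp
      have "\<bar>g x * h x\<bar> \<le> \<bar>B * g x\<bar>" for x
      proof -
        have "\<bar>h x\<bar> \<le> \<bar>B\<bar>" using B[of x] by linarith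
        then show ?thesis by (simp add: abs_mult mult.commute[of "\<bar>B\<bar>"] mult_left_mono)
      qed
      then show "AE x in lborel. norm (g x * h x) \<le> norm (B * g x)" by (intro AE_I2) simp
      show "(\<lambda>x. g x * h x) \<in> borel_measurable lborel"
        using borel_measurable_integrable[OF that] by measurable
    qed
    obtain H where H: "\<And>x. (H has_real_derivative h x) (at x)"
      using smooth_compact_antiderivative[OF h] by blast
    have "smooth H" by (rule smooth.antiderivative[OF h(1)]) (use H in blast)
    \<comment> \<open>The antiderivative \<open>H\<close> need not have compact support, but this
      difference does, being the integral of \<open>h\<close> over \<open>{x..x + a}\<close>. Its
      derivative h(x + a) - h(x) transfers the translation to \<open>f\<close>.\<close>
    define \<Phi> where "\<Phi> x = H (1 * x + a) + (- 1) * H x" for x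
    have smooth_\<Phi>: "smooth \<Phi>"
      unfolding \<Phi>_def
      by (rule smooth.add[OF smooth.affine[OF \<open>smooth H\<close>] smooth.mult[OF smooth.const \<open>smooth H\<close>]])
    have deriv_\<Phi>: "deriv \<Phi> x = h (x + a) - h x" for x
    proof -
      have "((\<lambda>x. H (1 * x + a)) has_real_derivative h (1 * x + a) * 1) (at x)"
        by (rule DERIV_chain2[OF H]) (auto intro!: derivative_eq_intros)
      then have "(\<Phi> has_real_derivative h (1 * x + a) * 1 + (- 1) * h x) (at x)"
        unfolding \<Phi>_def by (intro DERIV_add DERIV_cmult H)
      then show ?thesis by (simp add: DERIV_imp_deriv)
    qed
    have \<Phi>: "\<Phi> x = (\<integral>y. indicator {x..x + a} y * h y \<partial>lborel)" for x
    proof -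
      have "(\<integral>y. indicator {x..x + a} y *\<^sub>R h y \<partial>lborel) = H (x + a) - H x"
        using a H
        by (intro integral_FTC_atLeastAtMost smooth_continuous h)
           (auto simp: has_real_derivative_iff_has_vector_derivative[symmetric]
             intro: DERIV_subset)
      then show ?thesis by (simp add: \<Phi>_def)
    qed
    have "\<Phi> x = 0" if "x \<notin> {b - a..c}" for x
    proof -
      have "(\<lambda>y. indicator {x..x + a} y * h y) = (\<lambda>_. 0)"
        using that h(2) a by (auto simp: indicator_def fun_eq_iff)
      then show ?thesis by (simp add: \<Phi>)
    qed
    then have "test_function \<Phi>" by (rule test_function_smooth[OF smooth_\<Phi>])
    from parts[OF this]
    have "(\<integral>x. f x * (h (x + a) - h x) \<partial>lborel)
        = - ((\<integral>y. h y * measure P {y - a..y} \<partial>lborel) - (\<integral>y. h y * measure N {y - a..y} \<partial>lborel))"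
      unfolding deriv_\<Phi> using wP(3)[OF hm B] wN(3)[OF hm B] by (simp add: \<Phi>)
    also have "\<dots> = - (\<integral>y. w y * h y \<partial>lborel)"
      unfolding w_def left_diff_distrib
      by (subst Bochner_Integration.integral_diff[OF int_h[OF wP(1)] int_h[OF wN(1)]])
         (simp add: mult.commute)
    finally have 1: "(\<integral>x. f x * (h (x + a) - h x) \<partial>lborel) = - (\<integral>y. w y * h y \<partial>lborel)" .
    have "(\<integral>x. f (x - a) * h x \<partial>lborel) = (\<integral>x. f x * h (x + a) \<partial>lborel)"
      by (subst lborel_integral_real_affine[where c = 1 and t = "a"]) (auto simp: algebra_simps)
    moreover have "(\<integral>x. f x * (h (x + a) - h x) \<partial>lborel)
        = (\<integral>x. f x * h (x + a) \<partial>lborel) - (\<integral>x. f x * h x \<partial>lborel)"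
    proof -
      have "integrable lborel (\<lambda>x. f x * h (x + a))"
        using lborel_integrable_real_affine[OF int_h[OF int_shift], of 1 a]
        by (simp add: add.commute)
      then show ?thesis
        unfolding right_diff_distrib by (intro Bochner_Integration.integral_diff int_h int_f)
    qed
    moreover have "(\<integral>x. (f x - f (x - a) - w x) * h x \<partial>lborel)
        = (\<integral>x. f x * h x \<partial>lborel) - (\<integral>x. f (x - a) * h x \<partial>lborel) - (\<integral>x. w x * h x \<partial>lborel)"
      unfolding left_diff_distrib
      using int_h[OF int_f] int_h[OF int_shift] int_h[OF int_w] by simp
    ultimately show "(\<integral>x. (f x - f (x - a) - w x) * h x \<partial>lborel) = 0" using 1 by simp
  qed
  then have "(\<integral>x. \<bar>f x - f (x - a)\<bar> \<partial>lborel) = (\<integral>x. \<bar>w x\<bar> \<partial>lborel)"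
    using int_f int_shift int_w by (intro integral_cong_AE) auto
  also have "\<dots> \<le> (\<integral>x. measure P {x - a..x} + measure N {x - a..x} \<partial>lborel)"
  proof (rule integral_mono)
    show "\<bar>w x\<bar> \<le> measure P {x - a..x} + measure N {x - a..x}" for x
      unfolding w_def using measure_nonneg[of P "{x - a..x}"] measure_nonneg[of N "{x - a..x}"]
      by linarith
  qed (use int_w wP(1) wN(1) in auto)
  also have "\<dots> = a * var_norm f"
    using wP(1,2) wN(1,2) by (simp add: var algebra_simps)
  finally show ?thesis .
qed

lemma BV_translation:
  assumes f: "f \<in> BV"
  shows "(\<integral>x. \<bar>f x - f (x - a)\<bar> \<partial>lborel) \<le> \<bar>a\<bar> * var_norm f"
proof (cases "0 \<le> a")
  case True
  then show ?thesis using BV_translation_nonneg[OF f True] by simp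
next
  case False
  have "integrable lborel f" using f by (simp add: BV_def)
  then have [measurable]: "f \<in> borel_measurable borel" by auto
  \<comment> \<open>Substituting x + a for x exchanges the two terms and reverses the sign of the
    translation.\<close>
  have "(\<integral>x. \<bar>f x - f (x - a)\<bar> \<partial>lborel) = (\<integral>x. \<bar>f x - f (x - - a)\<bar> \<partial>lborel)"
    by (subst lborel_integral_real_affine[where c = 1 and t = a])
       (auto simp: algebra_simps abs_minus_commute)
  also have "\<dots> \<le> - a * var_norm f" using False by (intro BV_translation_nonneg[OF f]) auto
  finally show ?thesis using False by simp
qed

section \<open>Shifts of product measures\<close>

text \<open>Translation invariance of Lebesgue measure moves the shift from the merely bounded
  \<open>h\<close> to the density, with the opposite sign.\<close>

lemma integral_density_shift_le:
  fixes \<rho> h :: "real \<Rightarrow> real"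
  assumes \<rho>: "integrable lborel \<rho>" "AE x in lborel. 0 \<le> \<rho> x"
    and h: "h \<in> borel_measurable borel" "\<And>x. 0 \<le> h x" "\<And>x. h x \<le> B"
  shows "(\<integral>x. h x \<partial>density lborel \<rho>) - (\<integral>x. h (x + a) \<partial>density lborel \<rho>)
    \<le> B * (\<integral>x. \<bar>\<rho> x - \<rho> (x - a)\<bar> \<partial>lborel)"
proof -
  have B: "0 \<le> B" using h(2,3) order_trans by blast
  have [measurable]: "\<rho> \<in> borel_measurable borel" "h \<in> borel_measurable borel"
    using \<rho> h by auto
  have int_shift: "integrable lborel (\<lambda>x. \<rho> (x - a))"
    using lborel_integrable_real_affine[OF \<rho>(1), of 1 "- a"] by simp
  have bdd: "integrable lborel (\<lambda>x. f x * h x)" if "integrable lborel f" for f :: "real \<Rightarrow> real"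
  proof (rule Bochner_Integration.integrable_bound)
    show "integrable lborel (\<lambda>x. B * f x)" using that by simp
    show "AE x in lborel. norm (f x * h x) \<le> norm (B * f x)"
      using h B by (intro AE_I2) (auto simp: abs_mult mult.commute intro!: mult_mono)
    show "(\<lambda>x. f x * h x) \<in> borel_measurable lborel"
      using borel_measurable_integrable[OF that] by measurable
  qed
  have "(\<integral>x. h (x + a) \<partial>density lborel \<rho>) = (\<integral>x. \<rho> x * h (x + a) \<partial>lborel)"
    by (subst integral_density) (auto simp: \<rho>)
  also have "\<dots> = (\<integral>x. \<rho> (x - a) * h x \<partial>lborel)"
    by (subst lborel_integral_real_affine[where c = 1 and t = "- a"]) (auto simp: algebra_simps)
  finally have "(\<integral>x. h x \<partial>density lborel \<rho>) - (\<integral>x. h (x + a) \<partial>density lborel \<rho>)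
      = (\<integral>x. \<rho> x * h x \<partial>lborel) - (\<integral>x. \<rho> (x - a) * h x \<partial>lborel)"
    by (subst integral_density) (auto simp: \<rho>)
  also have "\<dots> = (\<integral>x. (\<rho> x - \<rho> (x - a)) * h x \<partial>lborel)"
    unfolding left_diff_distrib
    by (rule Bochner_Integration.integral_diff[OF bdd[OF \<rho>(1)] bdd[OF int_shift], symmetric])
  also have "\<dots> \<le> (\<integral>x. B * \<bar>\<rho> x - \<rho> (x - a)\<bar> \<partial>lborel)"
  proof (intro integral_mono bdd)
    show "(\<rho> x - \<rho> (x - a)) * h x \<le> B * \<bar>\<rho> x - \<rho> (x - a)\<bar>" for x
    proof -
      have "(\<rho> x - \<rho> (x - a)) * h x \<le> \<bar>\<rho> x - \<rho> (x - a)\<bar> * h x"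
        using h by (intro mult_right_mono) auto
      also have "\<dots> \<le> \<bar>\<rho> x - \<rho> (x - a)\<bar> * B" using h by (intro mult_left_mono) auto
      finally show ?thesis by (simp add: mult.commute)
    qed
  qed (auto intro!: \<rho> int_shift)
  finally show ?thesis by simp
qed

text \<open>Overwriting coordinate \<open>k\<close> of a product sample by an independent sample of
  \<nu> does not change the law. Fubini then leaves a one-dimensional estimate with the other
  coordinates frozen.\<close>

lemma expectation_shift_component_le:
  fixes \<rho> :: "real \<Rightarrow> real" and g :: "('i \<Rightarrow> real) \<Rightarrow> real"
  defines "\<nu> \<equiv> density lborel \<rho>"
  assumes \<rho>: "integrable lborel \<rho>" "AE x in lborel. 0 \<le> \<rho> x"
    and prob: "prob_space \<nu>"
    and g: "g \<in> borel_measurable (\<Pi>\<^sub>M i\<in>UNIV. \<nu>)" "\<And>\<omega>. 0 \<le> g \<omega>" "\<And>\<omega>. g \<omega> \<le> B"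
  shows "(\<integral>\<omega>. g \<omega> \<partial>(\<Pi>\<^sub>M i\<in>UNIV. \<nu>)) - (\<integral>\<omega>. g (fun_upd \<omega> k (\<omega> k + a)) \<partial>(\<Pi>\<^sub>M i\<in>UNIV. \<nu>))
    \<le> B * (\<integral>x. \<bar>\<rho> x - \<rho> (x - a)\<bar> \<partial>lborel)"
proof -
  define N where "N = (\<Pi>\<^sub>M i\<in>(UNIV :: 'i set). \<nu>)"
  interpret \<nu>: prob_space \<nu> by (rule prob)
  interpret N: prob_space N unfolding N_def by (intro prob_space_PiM prob)
  interpret P: pair_prob_space \<nu> N ..
  have gm[measurable]: "g \<in> borel_measurable N" using g by (simp add: N_def)
  have sets_\<nu>[measurable_cong]: "sets \<nu> = sets borel" by (simp add: \<nu>_def)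
  have upd[measurable]: "(\<lambda>(x, X). X(k := x)) \<in> \<nu> \<Otimes>\<^sub>M N \<rightarrow>\<^sub>M N"
    unfolding N_def using measurable_fun_upd[of UNIV UNIV k] by measurable
  have shift[measurable]: "(\<lambda>X. X(k := X k + a)) \<in> N \<rightarrow>\<^sub>M N"
    unfolding N_def by (rule measurable_PiM_single') (auto simp: space_PiM \<nu>_def)
  have eq: "distr (\<nu> \<Otimes>\<^sub>M N) N (\<lambda>(x, X). X(k := x)) = N"
    using distr_pair_PiM_eq_PiM[of UNIV "\<lambda>_. \<nu>" k] prob by (simp add: N_def)
  have bdd: "integrable M f" if "prob_space M" "f \<in> borel_measurable M" "\<And>x. 0 \<le> f x" "\<And>x. f x \<le> B"
    for M :: "'z measure" and f :: "'z \<Rightarrow> real"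
  proof -
    interpret prob_space M by fact
    show ?thesis using that by (intro integrable_const_bound[of _ B]) auto
  qed
  have fub: "(\<integral>\<omega>. f \<omega> \<partial>N) = (\<integral>X. (\<integral>x. f (X(k := x)) \<partial>\<nu>) \<partial>N)"
    and fub_int: "integrable N (\<lambda>X. \<integral>x. f (X(k := x)) \<partial>\<nu>)"
    if f[measurable]: "f \<in> borel_measurable N" and "\<And>x. 0 \<le> f x" "\<And>x. f x \<le> B" for f
  proof -
    have int: "integrable (\<nu> \<Otimes>\<^sub>M N) (\<lambda>(x, X). f (X(k := x)))"
      using that by (intro bdd P.prob_space_axioms) auto
    have "(\<integral>\<omega>. f \<omega> \<partial>N) = (\<integral>z. f ((\<lambda>(x, X). X(k := x)) z) \<partial>(\<nu> \<Otimes>\<^sub>M N))"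
      by (subst eq[symmetric], rule integral_distr) auto
    also have "\<dots> = (\<integral>X. (\<integral>x. f (X(k := x)) \<partial>\<nu>) \<partial>N)"
      using P.integral_snd[OF int] by (simp add: case_prod_unfold)
    finally show "(\<integral>\<omega>. f \<omega> \<partial>N) = (\<integral>X. (\<integral>x. f (X(k := x)) \<partial>\<nu>) \<partial>N)" .
    show "integrable N (\<lambda>X. \<integral>x. f (X(k := x)) \<partial>\<nu>)"
      using P.integrable_snd[OF int] by simp
  qed
  define g' where "g' \<omega> = g (fun_upd \<omega> k (\<omega> k + a))" for \<omega>
  have g'm: "g' \<in> borel_measurable N" unfolding g'_def by measurable
  have g'b: "\<And>\<omega>. 0 \<le> g' \<omega>" "\<And>\<omega>. g' \<omega> \<le> B" using g by (auto simp: g'_def)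
  have "(\<integral>\<omega>. g \<omega> \<partial>N) - (\<integral>\<omega>. g' \<omega> \<partial>N)
      = (\<integral>X. (\<integral>x. g (X(k := x)) \<partial>\<nu>) - (\<integral>x. g' (X(k := x)) \<partial>\<nu>) \<partial>N)"
    using fub[OF gm] fub[OF g'm] fub_int[OF gm] fub_int[OF g'm] g g'b by simp
  also have "\<dots> \<le> (\<integral>X. B * (\<integral>x. \<bar>\<rho> x - \<rho> (x - a)\<bar> \<partial>lborel) \<partial>N)"
  proof (rule integral_mono)
    fix X assume X: "X \<in> space N"
    have "(\<lambda>x. (\<lambda>(x, X). X(k := x)) (x, X)) \<in> \<nu> \<rightarrow>\<^sub>M N"
      using X by (intro measurable_compose[OF _ upd]) measurable
    then have "(\<lambda>x. g (X(k := x))) \<in> borel_measurable \<nu>"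
      using measurable_compose[OF _ gm] by simp
    then have "(\<lambda>x. g (X(k := x))) \<in> borel_measurable borel"
      by (simp add: \<nu>_def)
    from integral_density_shift_le[OF \<rho> this, of B a]
    show "(\<integral>x. g (X(k := x)) \<partial>\<nu>) - (\<integral>x. g' (X(k := x)) \<partial>\<nu>)
        \<le> B * (\<integral>x. \<bar>\<rho> x - \<rho> (x - a)\<bar> \<partial>lborel)"
      using g by (simp add: g'_def \<nu>_def)
  qed (use fub_int[OF gm] fub_int[OF g'm] g g'b in auto)
  also have "\<dots> = B * (\<integral>x. \<bar>\<rho> x - \<rho> (x - a)\<bar> \<partial>lborel)"
    by (simp add: N.prob_space)
  finally show ?thesis by (simp add: N_def g'_def)
qed

text \<open>Telescoping over the sites: one coordinate is translated at a time, and every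
  intermediate function obeys the same bounds 0 and \<open>B\<close>.\<close>

lemma expectation_shift_le:
  fixes \<rho> :: "real \<Rightarrow> real" and g :: "('i \<Rightarrow> real) \<Rightarrow> real" and a :: "'i \<Rightarrow> real"
  defines "\<nu> \<equiv> density lborel \<rho>"
  assumes \<rho>: "integrable lborel \<rho>" "AE x in lborel. 0 \<le> \<rho> x"
    and prob: "prob_space \<nu>"
    and g: "g \<in> borel_measurable (\<Pi>\<^sub>M i\<in>UNIV. \<nu>)" "\<And>\<omega>. 0 \<le> g \<omega>" "\<And>\<omega>. g \<omega> \<le> B"
    and K: "finite K" "\<And>k. k \<notin> K \<Longrightarrow> a k = 0"
  shows "(\<integral>\<omega>. g \<omega> \<partial>(\<Pi>\<^sub>M i\<in>UNIV. \<nu>)) - (\<integral>\<omega>. g (\<lambda>k. \<omega> k + a k) \<partial>(\<Pi>\<^sub>M i\<in>UNIV. \<nu>))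
    \<le> B * (\<Sum>k\<in>K. \<integral>x. \<bar>\<rho> x - \<rho> (x - a k)\<bar> \<partial>lborel)"
  using K
proof (induction K arbitrary: a rule: finite_induct)
  case empty
  then show ?case by simp
next
  case (insert k K)
  \<comment> \<open>All shifts except the one at \<open>k\<close>; the induction hypothesis handles
    these, and the remaining one acts on \<open>g'\<close>.\<close>
  define a' where "a' = a(k := 0)"
  define g' where "g' \<omega> = g (\<lambda>i. \<omega> i + a' i)" for \<omega>
  have \<nu>_sets[measurable_cong]: "sets \<nu> = sets borel" by (simp add: \<nu>_def)
  have "(\<lambda>\<omega> i. \<omega> i + a' i) \<in> (\<Pi>\<^sub>M i\<in>UNIV. \<nu>) \<rightarrow>\<^sub>M (\<Pi>\<^sub>M i\<in>UNIV. \<nu>)"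
    by (rule measurable_PiM_single') (auto simp: space_PiM \<nu>_def)
  then have "g' \<in> borel_measurable (\<Pi>\<^sub>M i\<in>UNIV. \<nu>)"
    unfolding g'_def using g(1) by (rule measurable_compose)
  from expectation_shift_component_le[OF \<rho> _ this[unfolded \<nu>_def], of B k "a k"]
  have step: "(\<integral>\<omega>. g' \<omega> \<partial>(\<Pi>\<^sub>M i\<in>UNIV. \<nu>))
      - (\<integral>\<omega>. g' (fun_upd \<omega> k (\<omega> k + a k)) \<partial>(\<Pi>\<^sub>M i\<in>UNIV. \<nu>))
      \<le> B * (\<integral>x. \<bar>\<rho> x - \<rho> (x - a k)\<bar> \<partial>lborel)"
    using g prob by (simp add: g'_def \<nu>_def)
  have comp: "g' (fun_upd \<omega> k (\<omega> k + a k)) = g (\<lambda>i. \<omega> i + a i)" for \<omega>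
    unfolding g'_def a'_def by (intro arg_cong[where f = g]) auto
  have "(\<integral>\<omega>. g \<omega> \<partial>(\<Pi>\<^sub>M i\<in>UNIV. \<nu>)) - (\<integral>\<omega>. g' \<omega> \<partial>(\<Pi>\<^sub>M i\<in>UNIV. \<nu>))
      \<le> B * (\<Sum>i\<in>K. \<integral>x. \<bar>\<rho> x - \<rho> (x - a' i)\<bar> \<partial>lborel)"
    unfolding g'_def using insert.prems by (intro insert.IH) (auto simp: a'_def)
  also have "(\<Sum>i\<in>K. \<integral>x. \<bar>\<rho> x - \<rho> (x - a' i)\<bar> \<partial>lborel)
      = (\<Sum>i\<in>K. \<integral>x. \<bar>\<rho> x - \<rho> (x - a i)\<bar> \<partial>lborel)"
    using insert.hyps by (intro sum.cong) (auto simp: a'_def)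
  finally show ?case using step insert.hyps by (simp add: comp algebra_simps)
qed

section \<open>Lattice sums and falling monomials\<close>

text \<open>Two geometric series, one for each sign, with 0 counted twice.\<close>

lemma sum_power_abs_le:
  fixes q :: real
  assumes q: "0 \<le> q" "q < 1"
  shows "(\<Sum>i\<in>{- int l..int l}. q ^ nat \<bar>i\<bar>) \<le> 2 / (1 - q)"
proof -
  let ?S = "int ` {..l}"
  have "(\<Sum>i\<in>{- int l..int l}. q ^ nat \<bar>i\<bar>) \<le> (\<Sum>i\<in>?S \<union> uminus ` ?S. q ^ nat \<bar>i\<bar>)"
  proof (rule sum_mono2)
    show "{- int l..int l} \<subseteq> ?S \<union> uminus ` ?S"
    proof
      fix i assume i: "i \<in> {- int l..int l}"
      show "i \<in> ?S \<union> uminus ` ?S"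
      proof (cases "0 \<le> i")
        case True
        then have "i = int (nat i)" by simp
        then show ?thesis using i by (intro UnI1 image_eqI[of _ _ "nat i"]) auto
      next
        case False
        then have "i = - int (nat (- i))" by simp
        then show ?thesis
          using i by (intro UnI2 image_eqI[of _ _ "int (nat (- i))"] imageI) auto
      qed
    qed
  qed (use q in auto)
  also have "\<dots> \<le> (\<Sum>i\<in>?S. q ^ nat \<bar>i\<bar>) + (\<Sum>i\<in>uminus ` ?S. q ^ nat \<bar>i\<bar>)"
    by (subst sum.union_inter[symmetric]) (use q in \<open>auto intro!: sum_nonneg\<close>)
  also have "\<dots> = 2 * (\<Sum>i\<le>l. q ^ i)"
    by (simp add: sum.reindex)
  also have "\<dots> \<le> 2 * (1 / (1 - q))"
    using q by (intro mult_left_mono) (auto simp: suminf_geometric[symmetric] intro!: sum_le_suminf)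
  finally show ?thesis by simp
qed

text \<open>The exponential factorizes over the coordinates, so sums over cubes are bounded
  uniformly in the side, and every finite set lies in some cube.\<close>

lemma summable_exp_norm1:
  assumes b: "0 < b"
  shows "(\<lambda>k :: int ^ 'd. exp (- b * real_of_int (norm1 k))) summable_on UNIV"
proof (rule nonneg_bdd_above_summable_on)
  define q where "q = exp (- b)"
  have q: "0 \<le> q" "q < 1" using b by (auto simp: q_def)
  have exp_q: "exp (- b * real_of_int \<bar>i\<bar>) = q ^ nat \<bar>i\<bar>" for i
    unfolding q_def exp_of_nat_mult[symmetric] by simp
  have factor: "exp (- b * real_of_int (norm1 k)) = (\<Prod>j\<in>UNIV. q ^ nat \<bar>k $ j\<bar>)" for k :: "int ^ 'd"
    unfolding norm1_def exp_q[symmetric] by (simp add: exp_sum[symmetric] sum_distrib_left)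
  have box: "(\<Sum>k\<in>(cube l :: (int ^ 'd) set). exp (- b * real_of_int (norm1 k)))
      \<le> (2 / (1 - q)) ^ CARD('d)" for l
  proof -
    have "(\<Sum>k\<in>(cube l :: (int ^ 'd) set). exp (- b * real_of_int (norm1 k)))
        = (\<Sum>g\<in>PiE UNIV (\<lambda>_. {- int l..int l}). \<Prod>j\<in>(UNIV :: 'd set). q ^ nat \<bar>g j\<bar>)"
      unfolding factor by (rule sum.reindex_bij_betw[OF bij_betw_vec_nth_cube])
    also have "\<dots> = (\<Prod>j\<in>(UNIV :: 'd set). \<Sum>i\<in>{- int l..int l}. q ^ nat \<bar>i\<bar>)"
      by (subst prod_sum_PiE) auto
    also have "\<dots> \<le> (\<Prod>j\<in>(UNIV :: 'd set). 2 / (1 - q))"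
      using q by (intro prod_mono conjI sum_power_abs_le sum_nonneg) auto
    finally show ?thesis by simp
  qed
  show "bdd_above (sum (\<lambda>k :: int ^ 'd. exp (- b * real_of_int (norm1 k))) ` {F. F \<subseteq> UNIV \<and> finite F})"
  proof (rule bdd_aboveI2)
    fix F :: "(int ^ 'd) set" assume "F \<in> {F. F \<subseteq> UNIV \<and> finite F}"
    then have F: "finite F" by simp
    define l where "l = nat (Max (insert 0 (norm1 ` F)))"
    have "F \<subseteq> cube l"
    proof
      fix k assume "k \<in> F"
      then have "norm1 k \<le> Max (insert 0 (norm1 ` F))" using F by (intro Max_ge) auto
      then show "k \<in> cube l"
        unfolding cube_iff l_def using component_le_norm1[of k] by (smt (verit) int_nat_eq)
    qed
    then have "(\<Sum>k\<in>F. exp (- b * real_of_int (norm1 k))) \<le> (\<Sum>k\<in>(cube l :: (int ^ 'd) set). exp (- b * real_of_int (norm1 k)))"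
      by (rule sum_mono2[OF finite_cube]) auto
    also have "\<dots> \<le> (2 / (1 - q)) ^ CARD('d)" by (rule box)
    finally show "(\<Sum>k\<in>F. exp (- b * real_of_int (norm1 k))) \<le> (2 / (1 - q)) ^ CARD('d)" .
  qed
qed auto

lemma power_le_exp:
  fixes c :: real
  assumes c: "0 < c"
  shows "\<exists>K>0. \<forall>x\<ge>0. (1 + x) ^ n \<le> K * exp (c * x)"
proof -
  \<comment> \<open>This yields 1 + x \<le> M (1 + c x / (n + 1)) \<le> M exp(c x / (n + 1)), whose
    power n + 1 is the claim; \<open>Suc n\<close> covers the case n = 0.\<close>
  define M where "M = max 1 (real (Suc n) / c)"
  have M: "M \<ge> 1" "M * c \<ge> real (Suc n)"
    using c by (auto simp: M_def max_def field_simps)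
  have "(1 + x) ^ n \<le> M ^ Suc n * exp (c * x)" if x: "0 \<le> x" for x
  proof -
    have "real (Suc n) * x \<le> M * c * x" using M(2) x by (rule mult_right_mono)
    then have "x \<le> M * (c * x / real (Suc n))" by (simp add: field_simps)
    then have le: "1 + x \<le> M * (1 + c * x / real (Suc n))" using M(1) by (simp add: distrib_left)
    have "(1 + x) ^ n \<le> (1 + x) ^ Suc n" using x by (intro power_increasing) auto
    also have "\<dots> \<le> (M * (1 + c * x / real (Suc n))) ^ Suc n" using le x by (intro power_mono) auto
    also have "\<dots> \<le> (M * exp (c * x / real (Suc n))) ^ Suc n"
      using M(1) c x by (intro power_mono mult_left_mono exp_ge_add_one_self) (auto intro!: mult_nonneg_nonneg add_nonneg_nonneg)
    also have "\<dots> = M ^ Suc n * exp (c * x)"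
      unfolding power_mult_distrib exp_of_nat_mult[symmetric] by simp
    finally show ?thesis .
  qed
  moreover have "M ^ Suc n > 0" using M(1) by simp
  ultimately show ?thesis by blast
qed

section \<open>Falling factorials and their growth\<close>

definition falling :: "int \<Rightarrow> nat \<Rightarrow> real" where
  "falling n i = (\<Prod>m<i. of_int n - of_nat m)"

definition falling_monom :: "nat ^ 'd \<Rightarrow> int ^ 'd \<Rightarrow> real" where
  "falling_monom J k = (\<Prod>r\<in>UNIV. falling (k $ r) (J $ r))"

lemma falling_0 [simp]: "falling n 0 = 1"
  and falling_Suc: "falling n (Suc i) = falling n i * (of_int n - of_nat i)"
  by (simp_all add: falling_def)

lemma abs_falling_le: "\<bar>falling n i\<bar> \<le> ((1 + real i) * (1 + \<bar>of_int n\<bar>)) ^ i"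
proof -
  have "\<bar>falling n i\<bar> \<le> (\<Prod>m<i. (1 + real i) * (1 + \<bar>of_int n\<bar>))"
    unfolding falling_def abs_prod
  proof (intro prod_mono conjI)
    fix m assume m: "m \<in> {..<i}"
    have "\<bar>real_of_int n - real m\<bar> \<le> \<bar>of_int n\<bar> + real i" using m by simp
    also have "\<dots> \<le> (1 + real i) * (1 + \<bar>of_int n\<bar>)" by (simp add: algebra_simps)
    finally show "\<bar>real_of_int n - real m\<bar> \<le> (1 + real i) * (1 + \<bar>of_int n\<bar>)" .
  qed simp
  then show ?thesis by simp
qed

text \<open>Each of the |J| linear factors is at most a constant times
  \<open>1 + norm_sup k\<close>. This degree becomes |I_0| in the final exponent.\<close>

lemma abs_falling_monom_le:
  "\<exists>A>0. \<forall>k. \<bar>falling_monom J k\<bar> \<le> A * (1 + real_of_int (norm_sup k)) ^ multi_index_abs J"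
proof -
  define A where "A = (\<Prod>r\<in>UNIV. (1 + real (J $ r)) ^ (J $ r))"
  have "\<bar>falling_monom J k\<bar> \<le> A * (1 + real_of_int (norm_sup k)) ^ multi_index_abs J" for k
  proof -
    have "\<bar>falling_monom J k\<bar>
        \<le> (\<Prod>r\<in>UNIV. ((1 + real (J $ r)) * (1 + real_of_int (norm_sup k))) ^ (J $ r))"
      unfolding falling_monom_def abs_prod
    proof (intro prod_mono conjI)
      fix r
      have "\<bar>k $ r\<bar> \<le> norm_sup k" unfolding norm_sup_def by (rule Max_ge) auto
      then have "\<bar>real_of_int (k $ r)\<bar> \<le> real_of_int (norm_sup k)" by linarith
      then have "((1 + real (J $ r)) * (1 + \<bar>real_of_int (k $ r)\<bar>)) ^ (J $ r)
          \<le> ((1 + real (J $ r)) * (1 + real_of_int (norm_sup k))) ^ (J $ r)"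
        by (intro power_mono mult_left_mono) auto
      then show "\<bar>falling (k $ r) (J $ r)\<bar>
          \<le> ((1 + real (J $ r)) * (1 + real_of_int (norm_sup k))) ^ (J $ r)"
        using abs_falling_le order_trans by blast
    qed simp
    also have "\<dots> = A * (1 + real_of_int (norm_sup k)) ^ multi_index_abs J"
      by (simp add: A_def multi_index_abs_def power_mult_distrib prod.distrib power_sum)
    finally show ?thesis .
  qed
  moreover have "A > 0" unfolding A_def by (intro prod_pos) auto
  ultimately show ?thesis by blast
qed

lemma norm_sup_le_norm1: "norm_sup k \<le> norm1 k"
  unfolding norm_sup_def using component_le_norm1[of k] by simp

lemma norm_sup_nonneg: "0 \<le> norm_sup k"
proof -
  have "\<bar>k $ undefined\<bar> \<le> norm_sup k" unfolding norm_sup_def by (rule Max_ge) auto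
  then show ?thesis by linarith
qed

lemma abs_falling_monom_le_exp:
  assumes c: "0 < c"
  shows "\<exists>K>0. \<forall>k. \<bar>falling_monom J k\<bar> \<le> K * exp (c * real_of_int (norm_sup k))"
proof -
  obtain A where A: "A > 0"
    "\<And>k. \<bar>falling_monom J k\<bar> \<le> A * (1 + real_of_int (norm_sup k)) ^ multi_index_abs J"
    using abs_falling_monom_le[of J] by blast
  obtain K where K: "K > 0" "\<And>x. x \<ge> 0 \<Longrightarrow> (1 + x) ^ multi_index_abs J \<le> K * exp (c * x)"
    using power_le_exp[OF c] by blast
  have "\<bar>falling_monom J k\<bar> \<le> (A * K) * exp (c * real_of_int (norm_sup k))" for k
  proof -
    have "A * (1 + real_of_int (norm_sup k)) ^ multi_index_abs J
        \<le> A * (K * exp (c * real_of_int (norm_sup k)))"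
      using A(1) norm_sup_nonneg[of k] by (intro mult_left_mono K) auto
    then show ?thesis using A(2)[of k] by simp
  qed
  moreover have "A * K > 0" using A K by simp
  ultimately show ?thesis by blast
qed

text \<open>The M-test gives uniform convergence along the finite partial sums, and a locally
  uniform limit of holomorphic functions may be differentiated termwise. A majorant for
  \<open>f\<close> alone therefore controls the derivatives as well.\<close>

lemma infsum_has_field_derivative:
  fixes f f' :: "'k \<Rightarrow> complex \<Rightarrow> complex"
  assumes r: "0 < r"
    and deriv: "\<And>k w. w \<in> cball z r \<Longrightarrow> (f k has_field_derivative f' k w) (at w)"
    and bound: "\<And>k w. w \<in> cball z r \<Longrightarrow> norm (f k w) \<le> M k"
    and M: "M summable_on UNIV"
  shows "((\<lambda>w. \<Sum>\<^sub>\<infinity>k. f k w) has_field_derivative (\<Sum>\<^sub>\<infinity>k. f' k z)) (at z)"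
proof -
  have ev: "eventually (\<lambda>S. continuous_on (cball z r) (\<lambda>w. \<Sum>k\<in>S. f k w) \<and>
      (\<forall>w\<in>ball z r. ((\<lambda>w. \<Sum>k\<in>S. f k w) has_field_derivative (\<Sum>k\<in>S. f' k w)) (at w)))
      (finite_subsets_at_top UNIV)"
  proof (intro always_eventually allI conjI ballI)
    fix S :: "'k set"
    show "continuous_on (cball z r) (\<lambda>w. \<Sum>k\<in>S. f k w)"
      by (intro continuous_on_sum continuous_at_imp_continuous_on ballI DERIV_isCont[OF deriv])
    show "((\<lambda>w. \<Sum>k\<in>S. f k w) has_field_derivative (\<Sum>k\<in>S. f' k w)) (at w)" if "w \<in> ball z r" for w
      using that by (intro DERIV_sum deriv) auto
  qed
  have lim: "uniform_limit (cball z r) (\<lambda>S w. \<Sum>k\<in>S. f k w) (\<lambda>w. \<Sum>\<^sub>\<infinity>k. f k w)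
      (finite_subsets_at_top UNIV)"
    by (rule Weierstrass_m_test_general[OF _ M]) (rule bound)
  obtain g' where g': "\<And>w. w \<in> ball z r \<Longrightarrow> ((\<lambda>w. \<Sum>\<^sub>\<infinity>k. f k w) has_field_derivative g' w) (at w)
      \<and> ((\<lambda>S. \<Sum>k\<in>S. f' k w) \<longlongrightarrow> g' w) (finite_subsets_at_top UNIV)"
    by (rule has_complex_derivative_uniform_limit[OF ev lim _ r]) (auto simp: finite_subsets_at_top_neq_bot)
  have "((\<lambda>k. f' k z) has_sum g' z) UNIV" using g'[of z] r by (simp add: has_sum_def)
  then have "(\<Sum>\<^sub>\<infinity>k. f' k z) = g' z" by (rule infsumI)
  then show ?thesis using g'[of z] r by simp
qed

section \<open>Derivatives of the generating function\<close>

lemma norm_powi_le: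
  fixes w :: complex
  assumes w: "exp (- b) \<le> norm w" "norm w \<le> exp b"
  shows "norm (w powi n) \<le> exp (b * real_of_int \<bar>n\<bar>)"
proof (cases "0 \<le> n")
  case True
  then obtain m where m: "n = int m" using nonneg_int_cases by blast
  have "norm w ^ m \<le> exp b ^ m" using w by (intro power_mono) auto
  then show ?thesis by (simp add: m norm_power exp_of_nat2_mult)
next
  case False
  then obtain m where m: "n = - int m" by (metis int_cases4 less_imp_le linorder_not_less of_nat_0_le_iff)
  have "exp (- b) ^ m \<le> norm w ^ m" using w by (intro power_mono) auto
  then have "inverse (norm w ^ m) \<le> inverse (exp (- b) ^ m)" by (intro le_imp_inverse_le) auto
  also have "\<dots> = exp (b * real m)" by (simp add: exp_of_nat2_mult[symmetric] exp_minus power_inverse)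
  finally show ?thesis by (simp add: m power_int_minus norm_inverse norm_power)
qed

locale decaying_potential =
  fixes u :: "int ^ 'd \<Rightarrow> real" and C \<alpha> :: real
  assumes C_pos: "C > 0" and \<alpha>_pos: "\<alpha> > 0"
    and decay: "\<bar>u k\<bar> \<le> C * exp (- \<alpha> * real_of_int (norm1 k))"
begin

text \<open>The \<open>k\<close>-th term of D_z^J F, differentiated formally.\<close>

definition series_term :: "nat ^ 'd \<Rightarrow> complex ^ 'd \<Rightarrow> int ^ 'd \<Rightarrow> complex" where
  "series_term J z k = of_real (u (- k)) * of_real (falling_monom J k)
     * (\<Prod>r\<in>UNIV. (z $ r) powi (k $ r - int (J $ r)))"

definition derivative_series :: "nat ^ 'd \<Rightarrow> complex ^ 'd \<Rightarrow> complex" where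
  "derivative_series J z = (\<Sum>\<^sub>\<infinity>k. series_term J z k)"

text \<open>Chosen so that |w - 1| \<le> \<delta> keeps |w| between exp(-\<alpha>/4) and
  exp(\<alpha>/4), for positive and negative powers alike.\<close>

definition \<delta> :: real where "\<delta> = 1 - exp (- (\<alpha> / 4))"

lemma \<delta>_pos: "0 < \<delta>" "\<delta> < 1"
  using \<alpha>_pos by (auto simp: \<delta>_def)

lemma near_one:
  fixes w :: complex
  assumes "norm (w - 1) \<le> \<delta>"
  shows "exp (- (\<alpha> / 4)) \<le> norm w" "norm w \<le> exp (\<alpha> / 4)"
proof -
  have "1 - norm (w - 1) \<le> norm w" using norm_triangle_ineq2[of 1 "1 - w"] by (simp add: norm_minus_commute)
  then show "exp (- (\<alpha> / 4)) \<le> norm w" using assms by (simp add: \<delta>_def)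
  have "norm w \<le> 1 + norm (w - 1)" using norm_triangle_ineq[of 1 "w - 1"] by simp
  moreover have "1 + (1 - exp (- (\<alpha> / 4))) \<le> exp (\<alpha> / 4)"
    using exp_ge_add_one_self[of "- (\<alpha> / 4)"] exp_ge_add_one_self[of "\<alpha> / 4"] by linarith
  ultimately show "norm w \<le> exp (\<alpha> / 4)" using assms by (simp add: \<delta>_def)
qed

lemma decay_minus: "\<bar>u (- k)\<bar> \<le> C * exp (- \<alpha> * real_of_int (norm1 k))"
  using decay[of "- k"] by (simp add: norm1_minus)

text \<open>The decay rate is split: \<alpha>/4 pays for the powers of z, \<alpha>/4 for the falling
  monomial, and \<alpha>/2 remains for summability. The shift of the exponents by \<open>J\<close>
  costs a constant factor.\<close>

lemma series_term_bound:
  "\<exists>M. M summable_on UNIV \<and>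
     (\<forall>z k. (\<forall>j. norm (z $ j - 1) \<le> \<delta>) \<longrightarrow> norm (series_term J z k) \<le> M k)"
proof -
  have a4: "0 < \<alpha> / 4" using \<alpha>_pos by simp
  obtain K where K: "K > 0" "\<And>k. \<bar>falling_monom J k\<bar> \<le> K * exp (\<alpha> / 4 * real_of_int (norm_sup k))"
    using abs_falling_monom_le_exp[OF a4, of J] by blast
  define D where "D = C * K * exp (\<alpha> / 4 * real (multi_index_abs J))"
  have "norm (series_term J z k) \<le> D * exp (- (\<alpha> / 2) * real_of_int (norm1 k))"
    if z: "\<forall>j. norm (z $ j - 1) \<le> \<delta>" for z k
  proof -
    have "norm (\<Prod>r\<in>UNIV. (z $ r) powi (k $ r - int (J $ r)))
        \<le> (\<Prod>r\<in>UNIV. exp (\<alpha> / 4 * real_of_int \<bar>k $ r - int (J $ r)\<bar>))"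
      unfolding prod_norm[symmetric]
      using z by (intro prod_mono conjI norm_powi_le near_one) auto
    also have "\<dots> \<le> (\<Prod>r\<in>UNIV. exp (\<alpha> / 4 * (real_of_int \<bar>k $ r\<bar> + real (J $ r))))"
      using \<alpha>_pos by (intro prod_mono conjI) auto
    also have "\<dots> = exp (\<alpha> / 4 * (real_of_int (norm1 k) + real (multi_index_abs J)))"
      by (simp add: exp_sum[symmetric] sum_distrib_left sum_divide_distrib sum.distrib[symmetric]
          norm1_def multi_index_abs_def)
    finally have P: "norm (\<Prod>r\<in>UNIV. (z $ r) powi (k $ r - int (J $ r)))
        \<le> exp (\<alpha> / 4 * (real_of_int (norm1 k) + real (multi_index_abs J)))" .
    have F: "\<bar>falling_monom J k\<bar> \<le> K * exp (\<alpha> / 4 * real_of_int (norm1 k))"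
    proof -
      have "exp (\<alpha> / 4 * real_of_int (norm_sup k)) \<le> exp (\<alpha> / 4 * real_of_int (norm1 k))"
        using \<alpha>_pos norm_sup_le_norm1[of k] by simp
      then show ?thesis using K(2)[of k] K(1) by (meson mult_left_mono less_imp_le order_trans)
    qed
    have "norm (series_term J z k)
        = \<bar>u (- k)\<bar> * \<bar>falling_monom J k\<bar> * norm (\<Prod>r\<in>UNIV. (z $ r) powi (k $ r - int (J $ r)))"
      by (simp add: series_term_def norm_mult)
    also have "\<dots> \<le> (C * exp (- \<alpha> * real_of_int (norm1 k))) * (K * exp (\<alpha> / 4 * real_of_int (norm1 k)))
        * exp (\<alpha> / 4 * (real_of_int (norm1 k) + real (multi_index_abs J)))"
      using C_pos K(1) by (intro mult_mono decay_minus F P mult_nonneg_nonneg) auto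
    also have "\<dots> = D * exp (- (\<alpha> / 2) * real_of_int (norm1 k))"
    proof -
      have "- \<alpha> * real_of_int (norm1 k) + \<alpha> / 4 * real_of_int (norm1 k)
          + \<alpha> / 4 * (real_of_int (norm1 k) + real (multi_index_abs J))
          = \<alpha> / 4 * real (multi_index_abs J) + - (\<alpha> / 2) * real_of_int (norm1 k)"
        by (simp add: algebra_simps)
      then show ?thesis unfolding D_def
        by (simp only: mult.assoc mult.left_commute mult.commute exp_add[symmetric])
           (simp add: mult_ac exp_add[symmetric] algebra_simps)
    qed
    finally show ?thesis .
  qed
  moreover have "(\<lambda>k. D * exp (- (\<alpha> / 2) * real_of_int (norm1 k))) summable_on (UNIV :: (int ^ 'd) set)"
    using \<alpha>_pos by (intro summable_on_cmult_right summable_exp_norm1) simp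
  ultimately show ?thesis by blast
qed

definition raise :: "'d \<Rightarrow> nat ^ 'd \<Rightarrow> nat ^ 'd" where
  "raise j J = (\<chi> r. if r = j then Suc (J $ r) else J $ r)"

lemma falling_monom_raise:
  "falling_monom (raise j J) k = falling_monom J k * (real_of_int (k $ j) - real (J $ j))"
proof -
  have "falling_monom (raise j J) k
      = falling (k $ j) (Suc (J $ j)) * (\<Prod>r\<in>UNIV - {j}. falling (k $ r) (J $ r))"
    unfolding falling_monom_def by (subst prod.remove[of _ j]) (auto simp: raise_def intro!: prod.cong)
  also have "\<dots> = falling_monom J k * (real_of_int (k $ j) - real (J $ j))"
    unfolding falling_monom_def by (subst (2) prod.remove[of _ j]) (auto simp: falling_Suc)
  finally show ?thesis .
qed

lemma series_term_has_derivative: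
  fixes z :: "complex ^ 'd" and j :: 'd
  defines "ins \<equiv> \<lambda>t. (\<chi> i. if i = j then t else z $ i)"
  assumes t: "t \<noteq> 0"
  shows "((\<lambda>t. series_term J (ins t) k) has_field_derivative series_term (raise j J) (ins t) k) (at t)"
proof -
  define c where "c = of_real (u (- k)) * of_real (falling_monom J k)
    * (\<Prod>r\<in>UNIV - {j}. (z $ r) powi (k $ r - int (J $ r)))"
  have 1: "series_term J (ins t) k = c * t powi (k $ j - int (J $ j))" for t
    unfolding series_term_def c_def ins_def by (subst prod.remove[of _ j]) (auto intro!: prod.cong)
  have 2: "series_term (raise j J) (ins t) k
      = c * (of_int (k $ j - int (J $ j)) * t powi (k $ j - int (J $ j) - 1))" for t
    unfolding series_term_def c_def ins_def falling_monom_raise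
    by (subst prod.remove[of _ j]) (auto simp: raise_def algebra_simps intro!: prod.cong)
  have "((\<lambda>t. t powi (k $ j - int (J $ j))) has_field_derivative
      of_int (k $ j - int (J $ j)) * t powi (k $ j - int (J $ j) - 1)) (at t)"
    using t by (auto intro!: derivative_eq_intros)
  then show ?thesis unfolding 1 2 by (rule DERIV_cmult)
qed

text \<open>The function \<open>g\<close> is known only on the polydisc around 1. Agreement near z
  suffices, because \<open>deriv\<close> is local, and it allows the lemma to be iterated.\<close>

lemma partial_deriv_series:
  assumes g: "\<And>z. \<forall>j. norm (z $ j - 1) < \<delta> \<Longrightarrow> g z = derivative_series J z"
    and z: "\<forall>j. norm (z $ j - 1) < \<delta>"
  shows "partial_deriv j g z = derivative_series (raise j J) z"
proof -
  define ins where "ins t = (\<chi> i. if i = j then t else z $ i)" for t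
  \<comment> \<open>Half the room left in coordinate \<open>j\<close>, so the closed disc stays
    inside the polydisc and avoids 0.\<close>
  define r where "r = (\<delta> - norm (z $ j - 1)) / 2"
  have r: "0 < r" using z by (simp add: r_def)
  have near: "norm (t - 1) < \<delta>" if "t \<in> cball (z $ j) r" for t
  proof -
    have "norm (t - z $ j) \<le> r" using that by (simp add: dist_norm norm_minus_commute)
    moreover have "norm (t - 1) \<le> norm (t - z $ j) + norm (z $ j - 1)"
      using norm_triangle_ineq[of "t - z $ j" "z $ j - 1"] by simp
    moreover have "norm (z $ j - 1) < \<delta>" using z by blast
    ultimately show ?thesis unfolding r_def by argo
  qed
  have ins_near: "\<forall>i. norm (ins t $ i - 1) < \<delta>" if "t \<in> cball (z $ j) r" for t
    using near[OF that] z by (simp add: ins_def)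
  obtain M where M: "M summable_on UNIV"
    "\<And>z k. \<forall>j. norm (z $ j - 1) \<le> \<delta> \<Longrightarrow> norm (series_term J z k) \<le> M k"
    using series_term_bound[of J] by blast
  have ins_z: "ins (z $ j) = z" by (simp add: ins_def vec_eq_iff)
  have "((\<lambda>t. \<Sum>\<^sub>\<infinity>k. series_term J (ins t) k) has_field_derivative
      (\<Sum>\<^sub>\<infinity>k. series_term (raise j J) (ins (z $ j)) k)) (at (z $ j))"
  proof (rule infsum_has_field_derivative[OF r _ _ M(1)])
    fix k w assume w: "w \<in> cball (z $ j) r"
    have "w \<noteq> 0" using near[OF w] \<delta>_pos by auto
    then show "((\<lambda>t. series_term J (ins t) k) has_field_derivative series_term (raise j J) (ins w) k) (at w)"
      unfolding ins_def by (rule series_term_has_derivative)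
    show "norm (series_term J (ins w) k) \<le> M k"
      using ins_near[OF w] by (intro M(2)) (auto intro: less_imp_le)
  qed
  then have D: "deriv (\<lambda>t. derivative_series J (ins t)) (z $ j) = derivative_series (raise j J) z"
    unfolding ins_z derivative_series_def by (rule DERIV_imp_deriv)
  have "eventually (\<lambda>t. t \<in> ball (z $ j) r) (nhds (z $ j))"
    using r by (intro eventually_nhds_in_open) auto
  then have "eventually (\<lambda>t. g (ins t) = derivative_series J (ins t)) (nhds (z $ j))"
    by (rule eventually_mono) (use ins_near g in auto)
  then have "deriv (\<lambda>t. g (ins t)) (z $ j) = deriv (\<lambda>t. derivative_series J (ins t)) (z $ j)"
    by (rule deriv_cong_ev) simp
  then show ?thesis using D by (simp add: partial_deriv_def ins_def)
qed

lemma partial_deriv_funpow_series: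
  assumes g: "\<And>z. \<forall>j. norm (z $ j - 1) < \<delta> \<Longrightarrow> g z = derivative_series J z"
    and z: "\<forall>j. norm (z $ j - 1) < \<delta>"
  shows "(partial_deriv j ^^ n) g z = derivative_series ((raise j ^^ n) J) z"
  using z
proof (induction n arbitrary: z)
  case 0
  then show ?case using g by simp
next
  case (Suc n)
  show ?case by (simp add: partial_deriv_series[OF Suc.IH Suc.prems])
qed

lemma raise_funpow: "(raise j ^^ n) J = (\<chi> r. if r = j then n + J $ r else J $ r)"
  by (induction n) (auto simp: raise_def vec_eq_iff)

text \<open>Every coordinate of the index rises from 0 to its value in \<open>I\<close> at its turn,
  so the order of the enumeration leaves no trace.\<close>

lemma foldr_partial_deriv_series:
  assumes "distinct js" "\<forall>j. norm (z $ j - 1) < \<delta>"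
  shows "foldr (\<lambda>j. partial_deriv j ^^ (I $ j)) js (generating_function u) z
    = derivative_series (\<chi> r. if r \<in> set js then I $ r else 0) z"
  using assms
proof (induction js arbitrary: z)
  case Nil
  have "falling_monom (\<chi> r. 0) k = 1" for k :: "int ^ 'd" by (simp add: falling_monom_def)
  then show ?case
    by (simp add: generating_function_def derivative_series_def series_term_def)
next
  case (Cons j js)
  have IH: "foldr (\<lambda>j. partial_deriv j ^^ (I $ j)) js (generating_function u) z
    = derivative_series (\<chi> r. if r \<in> set js then I $ r else 0) z"
    if "\<forall>j. norm (z $ j - 1) < \<delta>" for z using Cons.IH that Cons.prems(1) by simp
  have "(raise j ^^ (I $ j)) (\<chi> r. if r \<in> set js then I $ r else 0)
      = (\<chi> r. if r \<in> set (j # js) then I $ r else 0)"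
    using Cons.prems(1) by (auto simp: raise_funpow vec_eq_iff)
  then show ?case using partial_deriv_funpow_series[OF IH Cons.prems(2), where j = j and n = "I $ j"] by simp
qed

lemma summable_moment: "(\<lambda>k. u (- k) * falling_monom I k) summable_on UNIV"
proof -
  obtain M where M: "M summable_on UNIV"
    "\<And>z k. \<forall>j. norm (z $ j - 1) \<le> \<delta> \<Longrightarrow> norm (series_term I z k) \<le> M k"
    using series_term_bound[of I] by blast
  have "norm (series_term I (\<chi> j. 1) k) = \<bar>u (- k) * falling_monom I k\<bar>" for k
    by (simp add: series_term_def norm_mult abs_mult)
  then have le: "norm (u (- k) * falling_monom I k) \<le> M k" for k
    using M(2)[of "\<chi> j. 1" k] \<delta>_pos by simp
  show ?thesis
    by (rule abs_summable_summable, rule Infinite_Sum.abs_summable_on_comparison_test'[OF M(1)]) (rule le)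
qed

lemma multi_deriv_generating_function:
  "multi_deriv I (generating_function u) (\<chi> j. 1)
    = of_real (\<Sum>\<^sub>\<infinity>k. u (- k) * falling_monom I k)"
proof -
  define js where "js = (SOME js :: 'd list. distinct js \<and> set js = UNIV)"
  have "\<exists>js :: 'd list. distinct js \<and> set js = UNIV"
    using finite_distinct_list[OF finite] by blast
  then have "distinct js \<and> set js = UNIV" unfolding js_def by (rule someI_ex)
  then have js: "distinct js" "set js = UNIV" by auto
  have "multi_deriv I (generating_function u) (\<chi> j. 1) = derivative_series I (\<chi> j. 1)"
    unfolding multi_deriv_def js_def[symmetric]
    using foldr_partial_deriv_series[OF js(1), of "\<chi> j. 1" I] js(2) \<delta>_pos by simp
  also have "\<dots> = (\<Sum>\<^sub>\<infinity>k. of_real (u (- k) * falling_monom I k))"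
    by (simp add: derivative_series_def series_term_def)
  also have "\<dots> = of_real (\<Sum>\<^sub>\<infinity>k. u (- k) * falling_monom I k)"
    by (rule infsumI) (intro has_sum_of_real has_sum_infsum summable_moment)
  finally show ?thesis .
qed

end

section \<open>Weights whose convolution with the potential covers the box\<close>

lemma falling_eq_gbinomial: "falling n i = fact i * (of_int n gchoose i)"
  by (simp add: falling_def gbinomial_prod_rev atLeast0LessThan)

text \<open>Vandermonde's identity for generalized binomial coefficients, multiplied by the
  factorial of \<open>i\<close>.\<close>

lemma falling_add:
  "falling (x + n) i = (\<Sum>m\<le>i. (real (i choose m) * falling x (i - m)) * falling n m)"
proof -
  have "falling (x + n) i = (\<Sum>m=0..i. fact i * ((of_int n gchoose m) * (of_int x gchoose (i - m))))"
    unfolding falling_eq_gbinomial sum_distrib_left[symmetric] gbinomial_Vandermonde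
    by (simp add: add.commute)
  also have "\<dots> = (\<Sum>m=0..i. (real (i choose m) * falling x (i - m)) * falling n m)"
    by (intro sum.cong refl) (simp add: falling_eq_gbinomial binomial_fact field_simps)
  finally show ?thesis by (simp add: atMost_atLeast0)
qed

lemma falling_monom_add:
  "falling_monom I (x + k) = (\<Sum>g\<in>PiE UNIV (\<lambda>r. {..I $ r}).
     (\<Prod>r\<in>UNIV. real (I $ r choose g r) * falling (x $ r) (I $ r - g r)) * falling_monom (vec_lambda g) k)"
proof -
  have "falling_monom I (x + k)
      = (\<Prod>r\<in>UNIV. \<Sum>m\<le>I $ r. (real (I $ r choose m) * falling (x $ r) (I $ r - m)) * falling (k $ r) m)"
    by (simp add: falling_monom_def falling_add)
  also have "\<dots> = (\<Sum>g\<in>PiE UNIV (\<lambda>r. {..I $ r}).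
      \<Prod>r\<in>UNIV. (real (I $ r choose g r) * falling (x $ r) (I $ r - g r)) * falling (k $ r) (g r))"
    by (subst prod_sum_PiE) auto
  also have "\<dots> = (\<Sum>g\<in>PiE UNIV (\<lambda>r. {..I $ r}).
     (\<Prod>r\<in>UNIV. real (I $ r choose g r) * falling (x $ r) (I $ r - g r)) * falling_monom (vec_lambda g) k)"
    by (simp add: falling_monom_def prod.distrib)
  finally show ?thesis .
qed

lemma has_sum_finite_sum:
  fixes f :: "'i \<Rightarrow> 'k \<Rightarrow> 'a :: {topological_comm_monoid_add}"
  assumes "finite S" "\<And>i. i \<in> S \<Longrightarrow> (f i has_sum s i) A"
  shows "((\<lambda>k. \<Sum>i\<in>S. f i k) has_sum (\<Sum>i\<in>S. s i)) A"
  using assms by (induction S rule: finite_induct) (auto intro: has_sum_add has_sum_0)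

lemma norm_sup_triangle: "norm_sup k \<le> norm_sup (x - k) + norm_sup x"
proof -
  have "\<bar>k $ j\<bar> \<le> norm_sup (x - k) + norm_sup x" for j
  proof -
    have "\<bar>(x - k) $ j\<bar> \<le> norm_sup (x - k)" "\<bar>x $ j\<bar> \<le> norm_sup x"
      unfolding norm_sup_def by (rule Max_ge; auto)+
    then show ?thesis by simp
  qed
  then show ?thesis unfolding norm_sup_def[of k] by simp
qed

context decaying_potential
begin

definition moment :: "nat ^ 'd \<Rightarrow> real" where
  "moment J = (\<Sum>\<^sub>\<infinity>k. u (- k) * falling_monom J k)"

lemma leading_index_iff:
  "leading_index u I \<longleftrightarrow> moment I \<noteq> 0 \<and> (\<forall>J. multi_index_less J I \<longrightarrow> moment J = 0)"
  unfolding leading_index_def multi_deriv_generating_function moment_def by simp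

text \<open>By Vandermonde's identity, the convolution of \<open>u\<close> with the falling monomial of a leading
  index only sees the top moment, hence is constant.\<close>

lemma convolution_constant:
  assumes I: "leading_index u I"
  shows "((\<lambda>k. falling_monom I k * u (x - k)) has_sum moment I) UNIV"
proof -
  define G where "G = PiE (UNIV :: 'd set) (\<lambda>r. {..I $ r})"
  define c where "c g = (\<Prod>r\<in>UNIV. real (I $ r choose g r) * falling (x $ r) (I $ r - g r))" for g
  have finG: "finite G" unfolding G_def by (intro finite_PiE) auto
  have IG: "vec_nth I \<in> G" by (simp add: G_def PiE_iff)
  have "((\<lambda>k. \<Sum>g\<in>G. c g * (u (- k) * falling_monom (vec_lambda g) k)) has_sum
      (\<Sum>g\<in>G. c g * moment (vec_lambda g))) UNIV"
    unfolding moment_def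
    by (intro has_sum_finite_sum finG has_sum_cmult_right has_sum_infsum summable_moment)
  \<comment> \<open>Every other \<open>g\<close> in the box below \<open>I\<close> is a strictly
    smaller multi-index, whose moment vanishes; the coefficient at \<open>I\<close> itself is
    1.\<close>
  also have "(\<Sum>g\<in>G. c g * moment (vec_lambda g)) = (\<Sum>g\<in>{vec_nth I}. c g * moment (vec_lambda g))"
  proof (intro sum.mono_neutral_right finG ballI)
    fix g assume g: "g \<in> G - {vec_nth I}"
    then have le: "g r \<le> I $ r" for r by (auto simp: G_def PiE_iff)
    obtain r where "g r \<noteq> I $ r" using g by auto
    with le[of r] have "g r < I $ r" by simp
    then have "(\<Sum>r\<in>UNIV. g r) < (\<Sum>r\<in>UNIV. I $ r)"
      using le by (intro sum_strict_mono_ex1) auto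
    then have "multi_index_less (vec_lambda g) I"
      using le by (simp add: multi_index_less_def multi_index_abs_def)
    then show "c g * moment (vec_lambda g) = 0" using I by (simp add: leading_index_iff)
  qed (use IG in auto)
  also have "\<dots> = moment I" by (simp add: c_def vec_nth_inverse)
  also have "(\<lambda>k. \<Sum>g\<in>G. c g * (u (- k) * falling_monom (vec_lambda g) k))
      = (\<lambda>k. u (- k) * falling_monom I (x + k))"
    unfolding falling_monom_add c_def G_def sum_distrib_left by (simp add: mult_ac)
  finally have *: "((\<lambda>k. u (- k) * falling_monom I (x + k)) has_sum moment I) UNIV" .
  have "bij_betw (\<lambda>k. x + k) UNIV UNIV"
    by (rule bij_betw_byWitness[where f' = "\<lambda>k. k - x"]) auto
  from has_sum_reindex_bij_betw[OF this, of "\<lambda>k. u (x - k) * falling_monom I k" "moment I"] *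
  show ?thesis by (simp add: mult.commute)
qed

text \<open>Outside the larger cube, k is more than half its own norm away from x, so the decay at
  rate \<alpha> beats the growth at rate \<alpha>/4. The extra radius \<open>D\<close> supplies the
  small factor uniformly in l and x.\<close>

lemma convolution_truncation:
  assumes I: "leading_index u I" and e: "0 < e"
  shows "\<exists>D::nat. \<forall>l. \<forall>x\<in>cube l.
    \<bar>(\<Sum>k\<in>cube (2 * l + D). falling_monom I k * u (x - k)) - moment I\<bar> \<le> e"
proof -
  have a4: "0 < \<alpha> / 4" using \<alpha>_pos by simp
  obtain K where K: "K > 0" "\<And>k. \<bar>falling_monom I k\<bar> \<le> K * exp (\<alpha> / 4 * real_of_int (norm_sup k))"
    using abs_falling_monom_le_exp[OF a4, of I] by blast
  define E where "E k = exp (- (\<alpha> / 2) * real_of_int (norm1 k))" for k :: "int ^ 'd"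
  define S where "S = (\<Sum>\<^sub>\<infinity>k. E k)"
  have E_nonneg: "E k \<ge> 0" for k by (simp add: E_def)
  have E: "(E has_sum S) UNIV"
    unfolding S_def E_def using \<alpha>_pos by (intro has_sum_infsum summable_exp_norm1) simp
  have "(\<lambda>n. K * C * S * exp (- (\<alpha> / 4)) ^ n) \<longlonglongrightarrow> K * C * S * 0"
    using \<alpha>_pos by (intro tendsto_mult tendsto_const LIMSEQ_power_zero) auto
  then have "eventually (\<lambda>n. K * C * S * exp (- (\<alpha> / 4)) ^ n < e) sequentially"
    using e by (intro order_tendstoD) auto
  then obtain D where D: "K * C * S * exp (- (\<alpha> / 4)) ^ D < e"
    using eventually_happens by force
  have "\<bar>(\<Sum>k\<in>cube (2 * l + D). falling_monom I k * u (x - k)) - moment I\<bar> \<le> e"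
    if x: "x \<in> cube l" for l x
  proof -
    let ?R = "cube (2 * l + D) :: (int ^ 'd) set"
    define q where "q = K * C * exp (- (\<alpha> / 4)) ^ D"
    have "((\<lambda>k. falling_monom I k * u (x - k)) has_sum
        (moment I - (\<Sum>k\<in>?R. falling_monom I k * u (x - k)))) (UNIV - ?R)"
      by (intro has_sum_Diff convolution_constant[OF I] has_sum_finite finite_cube) auto
    moreover have "bij_betw (\<lambda>k. x - k) UNIV UNIV"
      by (rule bij_betw_byWitness[where f' = "\<lambda>k. x - k"]) auto
    from has_sum_reindex_bij_betw[OF this, of E S] E have "((\<lambda>k. E (x - k)) has_sum S) UNIV" by simp
    then have "((\<lambda>k. q * E (x - k)) has_sum (q * S)) UNIV" by (rule has_sum_cmult_right)
    then have "(\<lambda>k. q * E (x - k)) summable_on (UNIV - ?R)"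
      using summable_on_subset_banach has_sum_imp_summable by blast
    then obtain T where T: "((\<lambda>k. q * E (x - k)) has_sum T) (UNIV - ?R)" by (auto simp: summable_on_def)
    moreover have "T \<le> q * S"
      using T \<open>((\<lambda>k. q * E (x - k)) has_sum (q * S)) UNIV\<close> K C_pos E_nonneg
      by (intro has_sum_mono2[OF T]) (auto simp: q_def)
    moreover have "norm (falling_monom I k * u (x - k)) \<le> q * E (x - k)" if k: "k \<in> UNIV - ?R" for k
    proof -
      define s where "s = real_of_int (norm_sup k)"
      define t where "t = real_of_int (norm1 (x - k))"
      have s: "s \<ge> 2 * real l + real D" using k by (simp add: cube_def s_def)
      have "norm_sup k \<le> norm1 (x - k) + int l"
        using norm_sup_triangle[of k x] norm_sup_le_norm1[of "x - k"] x by (simp add: cube_def)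
      then have t: "s \<le> t + real l" by (simp add: s_def t_def)
      have "\<bar>falling_monom I k * u (x - k)\<bar> \<le> (K * exp (\<alpha> / 4 * s)) * (C * exp (- \<alpha> * t))"
        unfolding abs_mult s_def t_def using K C_pos by (intro mult_mono K(2) decay) auto
      also have "\<dots> = K * C * exp (\<alpha> / 4 * s + - \<alpha> * t)" unfolding exp_add by simp
      also have "\<dots> \<le> K * C * exp (real D * (- (\<alpha> / 4)) + - (\<alpha> / 2) * t)"
      proof -
        \<comment> \<open>The first bracket expresses that k is outside the cube, the second is the
          triangle inequality; the weights 1 and 2 eliminate l.\<close>
        have "0 \<le> \<alpha> / 4 * ((s - 2 * real l - real D) + 2 * (t + real l - s))"
          using s t \<alpha>_pos by (intro mult_nonneg_nonneg) auto
        then have "\<alpha> / 4 * s + - \<alpha> * t \<le> real D * (- (\<alpha> / 4)) + - (\<alpha> / 2) * t"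
          by (simp add: algebra_simps)
        then show ?thesis using K C_pos by simp
      qed
      also have "\<dots> = q * E (x - k)"
        unfolding q_def E_def t_def exp_of_nat_mult[symmetric] exp_add by simp
      finally show ?thesis by simp
    qed
    ultimately have "norm (moment I - (\<Sum>k\<in>?R. falling_monom I k * u (x - k))) \<le> q * S"
      using norm_infsum_le by (meson order_trans)
    also have "\<dots> \<le> e" using D by (simp add: q_def mult_ac)
    finally show ?thesis by (simp add: abs_minus_commute)
  qed
  then show ?thesis by blast
qed

lemma covering_weights:
  assumes I: "leading_index u I"
  shows "\<exists>K>0. \<forall>l. \<exists>t S. finite S \<and> (\<forall>k. k \<notin> S \<longrightarrow> t k = 0) \<and>
    (\<forall>x\<in>cube l. 1 / 2 \<le> (\<Sum>k\<in>S. t k * u (x - k))) \<and>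
    (\<Sum>k\<in>S. \<bar>t k\<bar>) \<le> K * (2 * real l + 1) ^ (CARD('d) + multi_index_abs I)"
proof -
  define c where "c = moment I"
  define n where "n = multi_index_abs I"
  have c: "c \<noteq> 0" using I by (simp add: c_def leading_index_iff)
  then have "0 < \<bar>c\<bar> / 2" by simp
  \<comment> \<open>After division by \<open>c\<close> the tolerance |c|/2 becomes 1/2, so the
    normalized convolution is at least 1/2.\<close>
  from convolution_truncation[OF I this] obtain D :: nat where D: "\<And>l x. x \<in> cube l \<Longrightarrow>
    \<bar>(\<Sum>k\<in>cube (2 * l + D). falling_monom I k * u (x - k)) - c\<bar> \<le> \<bar>c\<bar> / 2"
    unfolding c_def by blast
  obtain A where A: "A > 0" "\<And>k. \<bar>falling_monom I k\<bar> \<le> A * (1 + real_of_int (norm_sup k)) ^ n"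
    using abs_falling_monom_le[of I] unfolding n_def by blast
  \<comment> \<open>The side 2(2l + D) + 1 of the truncation cube is at most (2D + 2)(2l + 1), which
    separates \<open>D\<close> from \<open>l\<close>.\<close>
  define K where "K = A / \<bar>c\<bar> * (2 * real D + 2) ^ (CARD('d) + n)"
  have "K > 0" using A c by (simp add: K_def add_pos_pos)
  moreover have "\<exists>t S. finite S \<and> (\<forall>k. k \<notin> S \<longrightarrow> t k = 0) \<and>
    (\<forall>x\<in>cube l. 1 / 2 \<le> (\<Sum>k\<in>S. t k * u (x - k))) \<and>
    (\<Sum>k\<in>S. \<bar>t k\<bar>) \<le> K * (2 * real l + 1) ^ (CARD('d) + n)" for l
  proof -
    define S where "S = (cube (2 * l + D) :: (int ^ 'd) set)"
    define t where "t k = (if k \<in> S then falling_monom I k / c else 0)" for k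
    have "finite S" unfolding S_def by (rule finite_cube)
    moreover have "1 / 2 \<le> (\<Sum>k\<in>S. t k * u (x - k))" if x: "x \<in> cube l" for x
    proof -
      define s where "s = (\<Sum>k\<in>S. falling_monom I k * u (x - k))"
      have "(\<Sum>k\<in>S. t k * u (x - k)) = s / c"
        unfolding s_def sum_divide_distrib by (intro sum.cong) (auto simp: t_def)
      moreover have "\<bar>s / c - 1\<bar> \<le> 1 / 2"
      proof -
        have "\<bar>s - c\<bar> / \<bar>c\<bar> \<le> 1 / 2" using D[OF x] c by (simp add: s_def S_def field_simps)
        moreover have "s / c - 1 = (s - c) / c" using c by (simp add: field_simps)
        ultimately show ?thesis by (simp add: abs_divide)
      qed
      ultimately show ?thesis by linarith
    qed
    moreover have "(\<Sum>k\<in>S. \<bar>t k\<bar>) \<le> K * (2 * real l + 1) ^ (CARD('d) + n)"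
    proof -
      define R where "R = 2 * real (2 * l + D) + 1"
      have R: "R \<le> (2 * real D + 2) * (2 * real l + 1)" "0 \<le> R" by (auto simp: R_def algebra_simps)
      have "(\<Sum>k\<in>S. \<bar>t k\<bar>) \<le> (\<Sum>k\<in>S. A / \<bar>c\<bar> * R ^ n)"
      proof (rule sum_mono)
        fix k assume k: "k \<in> S"
        then have "norm_sup k \<le> int (2 * l + D)" by (simp add: S_def cube_def)
        then have "real_of_int (norm_sup k) \<le> real (2 * l + D)" by linarith
        then have "1 + real_of_int (norm_sup k) \<le> R" by (simp add: R_def)
        then have "(1 + real_of_int (norm_sup k)) ^ n \<le> R ^ n"
          using norm_sup_nonneg[of k] by (intro power_mono) auto
        then have "A * (1 + real_of_int (norm_sup k)) ^ n \<le> A * R ^ n"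
          using A(1) by (intro mult_left_mono) auto
        with A(2)[of k] have "\<bar>falling_monom I k\<bar> \<le> A * R ^ n" by linarith
        then have "\<bar>falling_monom I k\<bar> / \<bar>c\<bar> \<le> A * R ^ n / \<bar>c\<bar>" by (intro divide_right_mono) auto
        then show "\<bar>t k\<bar> \<le> A / \<bar>c\<bar> * R ^ n" using k by (simp add: t_def)
      qed
      also have "\<dots> = A / \<bar>c\<bar> * R ^ (CARD('d) + n)"
        by (simp add: S_def card_cube R_def power_add algebra_simps)
      also have "\<dots> \<le> A / \<bar>c\<bar> * ((2 * real D + 2) * (2 * real l + 1)) ^ (CARD('d) + n)"
        using A c R by (intro mult_left_mono power_mono) auto
      also have "\<dots> = K * (2 * real l + 1) ^ (CARD('d) + n)"
        by (simp add: K_def power_mult_distrib)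
      finally show ?thesis .
    qed
    ultimately show ?thesis by (intro exI[of _ t] exI[of _ S]) (auto simp: t_def)
  qed
  ultimately show ?thesis unfolding n_def by blast
qed

end

section \<open>Existence of a leading index\<close>

definition dot :: "real ^ 'd \<Rightarrow> int ^ 'd \<Rightarrow> real" where
  "dot \<theta> k = (\<Sum>r\<in>UNIV. \<theta> $ r * real_of_int (k $ r))"

lemma abs_dot_le: "\<bar>dot \<theta> k\<bar> \<le> norm \<theta> * real_of_int (norm1 k)"
proof -
  have "\<bar>dot \<theta> k\<bar> \<le> (\<Sum>r\<in>UNIV. \<bar>\<theta> $ r * real_of_int (k $ r)\<bar>)" unfolding dot_def by (rule sum_abs)
  also have "\<dots> \<le> (\<Sum>r\<in>UNIV. norm \<theta> * \<bar>real_of_int (k $ r)\<bar>)"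
    unfolding abs_mult by (intro sum_mono mult_right_mono component_le_norm_cart) auto
  finally show ?thesis by (simp add: norm1_def sum_distrib_left)
qed

text \<open>The excluded directions form countably many hyperplanes, a null set. Outside them exp(i
  \<theta>.k) differs from 1 for every nonzero k.\<close>

lemma generic_direction: "\<exists>\<theta> :: real ^ 'd. \<forall>k n. k \<noteq> 0 \<longrightarrow> dot \<theta> k \<noteq> 2 * pi * of_int n"
proof -
  define H where "H = (\<lambda>(k :: int ^ 'd, n :: int). {\<theta> :: real ^ 'd. dot \<theta> k = 2 * pi * of_int n})"
  have "negligible (H (k, n))" if "k \<noteq> 0" for k n
  proof -
    define a :: "real ^ 'd" where "a = (\<chi> r. real_of_int (k $ r))"
    have "a \<noteq> 0" using that by (auto simp: a_def vec_eq_iff)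
    moreover have "H (k, n) = {\<theta>. inner a \<theta> = 2 * pi * of_int n}"
      by (simp add: H_def a_def inner_vec_def dot_def mult.commute)
    ultimately show ?thesis using negligible_hyperplane by auto
  qed
  then have "negligible (\<Union>(H ` ((- {0}) \<times> UNIV)))"
    by (intro negligible_countable_Union) auto
  then have "\<Union>(H ` ((- {0}) \<times> UNIV)) \<noteq> UNIV" using non_negligible_UNIV by metis
  then obtain \<theta> where "\<theta> \<notin> \<Union>(H ` ((- {0}) \<times> UNIV))" by blast
  then show ?thesis by (intro exI[of _ \<theta>]) (auto simp: H_def)
qed

text \<open>The geometric sums stay bounded by 2/|z - 1|, while the denominator grows.\<close>

lemma average_of_powers_tendsto_0:
  fixes z :: complex
  assumes z: "norm z = 1" "z \<noteq> 1"
  shows "(\<lambda>n. (\<Sum>m<n. z ^ m) / of_nat n) \<longlonglongrightarrow> 0"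
proof (rule Lim_null_comparison)
  show "(\<lambda>n. 2 / norm (z - 1) / real n) \<longlonglongrightarrow> 0"
    by (rule tendsto_divide_0[OF tendsto_const filterlim_at_top_imp_at_infinity[OF filterlim_real_sequentially]])
  have "norm ((\<Sum>m<n. z ^ m) / of_nat n) \<le> 2 / norm (z - 1) / real n" for n
  proof -
    have "norm (z ^ n - 1) \<le> 2"
      using norm_triangle_ineq4[of "z ^ n" 1] z(1) by (simp add: norm_power)
    then have "norm (\<Sum>m<n. z ^ m) \<le> 2 / norm (z - 1)"
      using z by (simp add: geometric_sum norm_divide divide_right_mono)
    then have "norm (\<Sum>m<n. z ^ m) / real n \<le> 2 / norm (z - 1) / real n" by (intro divide_right_mono) auto
    then show ?thesis by (simp add: norm_divide)
  qed
  then show "eventually (\<lambda>n. norm ((\<Sum>m<n. z ^ m) / of_nat n) \<le> 2 / norm (z - 1) / real n) sequentially"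
    by simp
qed

lemma infsum_dominated_convergence:
  fixes f :: "nat \<Rightarrow> 'k \<Rightarrow> complex"
  assumes M: "M summable_on UNIV" and le: "\<And>n k. norm (f n k) \<le> M k"
    and lim: "\<And>k. (\<lambda>n. f n k) \<longlonglongrightarrow> g k"
  shows "(\<lambda>n. \<Sum>\<^sub>\<infinity>k. f n k) \<longlonglongrightarrow> (\<Sum>\<^sub>\<infinity>k. g k)"
proof -
  have M_nonneg: "0 \<le> M k" for k using le[of 0 k] norm_ge_zero order_trans by blast
  have le_g: "norm (g k) \<le> M k" for k
    by (rule tendsto_upperbound[OF tendsto_norm[OF lim]]) (use le in auto)
  have abs: "Infinite_Set_Sum.abs_summable_on h UNIV" if "\<And>k. norm (h k) \<le> M k" for h :: "'k \<Rightarrow> complex"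
    using that M by (meson Infinite_Sum.abs_summable_on_comparison_test' abs_summable_equivalent)
  have eq: "(\<Sum>\<^sub>\<infinity>k. h k) = (\<integral>k. h k \<partial>count_space UNIV)" if "\<And>k. norm (h k) \<le> M k" for h :: "'k \<Rightarrow> complex"
    using infsetsum_infsum[OF abs[OF that]] by (simp add: infsetsum_def)
  have "integrable (count_space UNIV) M"
  proof -
    have "(\<lambda>k. norm (M k)) summable_on UNIV" using M M_nonneg by simp
    then have "Infinite_Set_Sum.abs_summable_on M UNIV" unfolding abs_summable_equivalent .
    then show ?thesis by (simp add: Infinite_Set_Sum.abs_summable_on_def)
  qed
  then have "(\<lambda>n. \<integral>k. f n k \<partial>count_space UNIV) \<longlonglongrightarrow> (\<integral>k. g k \<partial>count_space UNIV)"
    by (rule integral_dominated_convergence[rotated 2]) (use lim le in auto)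
  then show ?thesis by (simp add: eq le le_g)
qed

text \<open>The linear span of the falling monomials. It serves to pass from vanishing moments to
  vanishing sums against the powers of \<theta>.k.\<close>

inductive falling_poly :: "(int ^ 'd \<Rightarrow> real) \<Rightarrow> bool" where
  monom: "falling_poly (falling_monom J)"
| add: "falling_poly p \<Longrightarrow> falling_poly q \<Longrightarrow> falling_poly (\<lambda>k. p k + q k)"
| cmult: "falling_poly p \<Longrightarrow> falling_poly (\<lambda>k. c * p k)"

lemma falling_poly_sum:
  assumes "finite S" "S \<noteq> {}" "\<And>i. i \<in> S \<Longrightarrow> falling_poly (p i)"
  shows "falling_poly (\<lambda>k. \<Sum>i\<in>S. p i k)"
  using assms by (induction S rule: finite_ne_induct) (auto intro: falling_poly.add)

section \<open>Vanishing moments and the Fourier transform\<close>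

context decaying_potential
begin

text \<open>Multiplying the falling monomial of \<open>J\<close> by k_j gives the one of
  \<open>raise j J\<close> plus J_j times the original.\<close>

lemma falling_poly_component:
  assumes "falling_poly p"
  shows "falling_poly (\<lambda>k :: int ^ 'd. real_of_int (k $ j) * p k)"
  using assms
proof induction
  case (monom J)
  have "falling_poly (\<lambda>k. falling_monom (raise j J) k + real (J $ j) * falling_monom J k)"
    by (rule falling_poly.add[OF falling_poly.monom falling_poly.cmult[OF falling_poly.monom]])
  then show ?case by (simp add: falling_monom_raise algebra_simps)
next
  case (add p q)
  from falling_poly.add[OF add.IH] show ?case by (simp add: distrib_left)
next
  case (cmult p c)
  from falling_poly.cmult[OF cmult.IH, of c] show ?case by (simp add: mult.left_commute)
qed

lemma falling_poly_dot_power: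
  fixes \<theta> :: "real ^ 'd"
  shows "falling_poly (\<lambda>k. dot \<theta> k ^ n)"
proof (induction n)
  case 0
  have "falling_monom (\<chi> r. 0) = (\<lambda>k :: int ^ 'd. 1)" by (simp add: falling_monom_def fun_eq_iff)
  with falling_poly.monom[of "\<chi> r. 0"] have "falling_poly (\<lambda>k :: int ^ 'd. 1)" by metis
  then show ?case by simp
next
  case (Suc n)
  have "falling_poly (\<lambda>k. \<Sum>r\<in>UNIV. \<theta> $ r * (real_of_int (k $ r) * dot \<theta> k ^ n))"
    by (intro falling_poly_sum falling_poly.cmult falling_poly_component Suc.IH) auto
  then show ?case by (simp add: dot_def sum_distrib_right mult.assoc)
qed

lemma moments_vanish:
  assumes zero: "\<And>J. moment J = 0" and p: "falling_poly p"
  shows "((\<lambda>k. u (- k) * p k) has_sum 0) UNIV"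
  using p
proof induction
  case (monom J)
  show ?case using has_sum_infsum[OF summable_moment[of J]] zero[of J] by (simp add: moment_def)
next
  case (add p q)
  from has_sum_add[OF add.IH] show ?case by (simp add: distrib_left)
next
  case (cmult p c)
  from has_sum_cmult_right[OF cmult.IH, of c] show ?case by (simp add: mult.left_commute)
qed

text \<open>The n-th derivative in w of u(-k) exp(w \<theta>.k). Imaginary w give the Fourier
  transform along the line spanned by \<theta>.\<close>

definition fourier_term :: "real ^ 'd \<Rightarrow> nat \<Rightarrow> complex \<Rightarrow> int ^ 'd \<Rightarrow> complex" where
  "fourier_term \<theta> n w k = of_real (u (- k) * dot \<theta> k ^ n) * exp (w * of_real (dot \<theta> k))"

definition fourier :: "real ^ 'd \<Rightarrow> nat \<Rightarrow> complex \<Rightarrow> complex" where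
  "fourier \<theta> n w = (\<Sum>\<^sub>\<infinity>k. fourier_term \<theta> n w k)"

lemma fourier_term_bound:
  "\<exists>M. M summable_on UNIV \<and> (\<forall>w k. \<bar>Re w\<bar> * norm \<theta> \<le> \<alpha> / 4 \<longrightarrow> norm (fourier_term \<theta> n w k) \<le> M k)"
proof -
  have a4: "0 < \<alpha> / 4" using \<alpha>_pos by simp
  obtain K where K: "K > 0" "\<And>x. x \<ge> 0 \<Longrightarrow> (1 + x) ^ n \<le> K * exp (\<alpha> / 4 * x)"
    using power_le_exp[OF a4] by blast
  define D where "D = C * (norm \<theta> ^ n * K)"
  have "norm (fourier_term \<theta> n w k) \<le> D * exp (- (\<alpha> / 2) * real_of_int (norm1 k))"
    if w: "\<bar>Re w\<bar> * norm \<theta> \<le> \<alpha> / 4" for w k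
  proof -
    define x where "x = real_of_int (norm1 k)"
    have x: "0 \<le> x" using norm_sup_le_norm1[of k] norm_sup_nonneg[of k] by (simp add: x_def)
    have dot: "\<bar>dot \<theta> k\<bar> \<le> norm \<theta> * x" unfolding x_def by (rule abs_dot_le)
    have "\<bar>dot \<theta> k\<bar> ^ n \<le> (norm \<theta> * x) ^ n" using dot by (intro power_mono) auto
    also have "\<dots> \<le> norm \<theta> ^ n * (1 + x) ^ n"
      unfolding power_mult_distrib using x by (intro mult_left_mono power_mono) auto
    also have "\<dots> \<le> norm \<theta> ^ n * (K * exp (\<alpha> / 4 * x))" using x K by (intro mult_left_mono) auto
    finally have 1: "\<bar>dot \<theta> k\<bar> ^ n \<le> norm \<theta> ^ n * K * exp (\<alpha> / 4 * x)" by (simp add: mult.assoc)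
    have "Re w * dot \<theta> k \<le> \<bar>Re w\<bar> * \<bar>dot \<theta> k\<bar>" by (metis abs_ge_self abs_mult)
    also have "\<dots> \<le> \<bar>Re w\<bar> * (norm \<theta> * x)" using dot by (intro mult_left_mono) auto
    also have "\<dots> \<le> \<alpha> / 4 * x" using w x by (metis mult.assoc mult_right_mono)
    finally have 2: "exp (Re w * dot \<theta> k) \<le> exp (\<alpha> / 4 * x)" by simp
    have "norm (fourier_term \<theta> n w k) = \<bar>u (- k)\<bar> * \<bar>dot \<theta> k\<bar> ^ n * exp (Re w * dot \<theta> k)"
      by (simp add: fourier_term_def norm_mult norm_exp_eq_Re norm_power)
    also have "\<dots> \<le> (C * exp (- \<alpha> * x)) * (norm \<theta> ^ n * K * exp (\<alpha> / 4 * x)) * exp (\<alpha> / 4 * x)"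
      using C_pos K(1) 1 2 decay_minus[of k] unfolding x_def
      by (intro mult_mono mult_nonneg_nonneg) auto
    also have "\<dots> = D * (exp (- \<alpha> * x) * exp (\<alpha> / 4 * x) * exp (\<alpha> / 4 * x))"
      by (simp add: D_def mult_ac)
    also have "\<dots> = D * exp (- (\<alpha> / 2) * x)"
      unfolding exp_add[symmetric] by (simp add: algebra_simps)
    finally show ?thesis by (simp add: x_def)
  qed
  moreover have "(\<lambda>k. D * exp (- (\<alpha> / 2) * real_of_int (norm1 k))) summable_on (UNIV :: (int ^ 'd) set)"
    using \<alpha>_pos by (intro summable_on_cmult_right summable_exp_norm1) simp
  ultimately show ?thesis by blast
qed

text \<open>The width keeps the exponential growth below rate \<alpha>/4; the added 1 avoids
  division by zero for \<theta> = 0.\<close>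

definition strip :: "real ^ 'd \<Rightarrow> complex set" where
  "strip \<theta> = {w. Re w < \<alpha> / (4 * (norm \<theta> + 1))} \<inter> {w. Re w > - \<alpha> / (4 * (norm \<theta> + 1))}"

lemma strip: "open (strip \<theta>)" "connected (strip \<theta>)" "Re w = 0 \<Longrightarrow> w \<in> strip \<theta>"
  and strip_bound: "w \<in> strip \<theta> \<Longrightarrow> \<bar>Re w\<bar> * norm \<theta> \<le> \<alpha> / 4"
proof -
  show "open (strip \<theta>)" unfolding strip_def
    by (intro open_Int open_halfspace_Re_lt open_halfspace_Re_gt)
  show "connected (strip \<theta>)" unfolding strip_def
    by (intro convex_connected convex_Int convex_halfspace_Re_lt convex_halfspace_Re_gt)
  have pos: "0 < 4 * (norm \<theta> + 1)" using norm_ge_zero[of \<theta>] by argo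
  then show "Re w = 0 \<Longrightarrow> w \<in> strip \<theta>" using \<alpha>_pos by (simp add: strip_def)
  assume "w \<in> strip \<theta>"
  then have "\<bar>Re w\<bar> \<le> \<alpha> / (4 * (norm \<theta> + 1))" by (simp add: strip_def abs_le_iff)
  then have "\<bar>Re w\<bar> * (4 * (norm \<theta> + 1)) \<le> \<alpha>" using pos by (simp only: pos_le_divide_eq)
  moreover have "\<bar>Re w\<bar> * norm \<theta> \<le> \<bar>Re w\<bar> * (norm \<theta> + 1)" by (intro mult_left_mono) auto
  ultimately show "\<bar>Re w\<bar> * norm \<theta> \<le> \<alpha> / 4" by (simp add: algebra_simps)
qed

lemma fourier_has_derivative:
  assumes w: "w \<in> strip \<theta>"
  shows "(fourier \<theta> n has_field_derivative fourier \<theta> (Suc n) w) (at w)"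
proof -
  obtain r where r: "0 < r" "cball w r \<subseteq> strip \<theta>"
    using strip(1) w open_contains_cball by blast
  obtain M where M: "M summable_on UNIV"
    "\<And>w k. \<bar>Re w\<bar> * norm \<theta> \<le> \<alpha> / 4 \<Longrightarrow> norm (fourier_term \<theta> n w k) \<le> M k"
    using fourier_term_bound[of \<theta> n] by blast
  have "((\<lambda>w. \<Sum>\<^sub>\<infinity>k. fourier_term \<theta> n w k) has_field_derivative
      (\<Sum>\<^sub>\<infinity>k. fourier_term \<theta> (Suc n) w k)) (at w)"
  proof (rule infsum_has_field_derivative[OF r(1) _ _ M(1)])
    fix k v assume v: "v \<in> cball w r"
    show "((\<lambda>w. fourier_term \<theta> n w k) has_field_derivative fourier_term \<theta> (Suc n) v k) (at v)"
      unfolding fourier_term_def by (auto intro!: derivative_eq_intros)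
    show "norm (fourier_term \<theta> n v k) \<le> M k" using v r by (intro M(2) strip_bound) auto
  qed
  then show ?thesis by (simp add: fourier_def[abs_def])
qed

lemma fourier_higher_deriv:
  assumes "w \<in> strip \<theta>"
  shows "(deriv ^^ n) (fourier \<theta> 0) w = fourier \<theta> n w"
  using assms
proof (induction n arbitrary: w)
  case 0
  then show ?case by simp
next
  case (Suc n)
  have "eventually (\<lambda>w. w \<in> strip \<theta>) (nhds w)"
    using strip(1) Suc.prems by (rule eventually_nhds_in_open)
  then have "eventually (\<lambda>w. (deriv ^^ n) (fourier \<theta> 0) w = fourier \<theta> n w) (nhds w)"
    by (rule eventually_mono) (rule Suc.IH)
  then have "deriv ((deriv ^^ n) (fourier \<theta> 0)) w = deriv (fourier \<theta> n) w"
    by (rule deriv_cong_ev) simp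
  also have "\<dots> = fourier \<theta> (Suc n) w"
    by (rule DERIV_imp_deriv[OF fourier_has_derivative[OF Suc.prems]])
  finally show ?case by simp
qed

text \<open>All derivatives at 0 are sums of \<open>u\<close> against polynomials, hence zero. The
  identity theorem carries this through the connected strip, along the whole imaginary axis.\<close>

lemma fourier_vanishes:
  assumes zero: "\<And>J. moment J = 0" and w: "w \<in> strip \<theta>"
  shows "fourier \<theta> 0 w = 0"
proof (rule holomorphic_fun_eq_0_on_connected[OF _ strip(1,2) _ _ w])
  show "fourier \<theta> 0 holomorphic_on strip \<theta>"
    using fourier_has_derivative strip(1) by (auto simp: holomorphic_on_open)
  show "0 \<in> strip \<theta>" by (rule strip(3)) simp
  then show "(deriv ^^ n) (fourier \<theta> 0) 0 = 0" for n
  proof -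
    have "((\<lambda>k. of_real (u (- k) * dot \<theta> k ^ n) :: complex) has_sum of_real 0) UNIV"
      by (rule has_sum_of_real[OF moments_vanish[OF zero falling_poly_dot_power]])
    then show ?thesis
      using \<open>0 \<in> strip \<theta>\<close> by (simp add: fourier_higher_deriv fourier_def fourier_term_def infsumI)
  qed
qed

text \<open>If all moments vanish, so does the Fourier transform of \<open>u\<close>, by analyticity. Averaging it
  along a generic arithmetic progression isolates the coefficient at the origin.\<close>

lemma leading_index_exists:
  assumes "u 0 \<noteq> 0"
  shows "\<exists>I. leading_index u I"
proof -
  have "\<exists>J. moment J \<noteq> 0"
  proof (rule ccontr)
    assume "\<not> ?thesis"
    then have zero: "\<And>J. moment J = 0" by blast
    obtain \<theta> :: "real ^ 'd" where \<theta>: "\<And>k n. k \<noteq> 0 \<Longrightarrow> dot \<theta> k \<noteq> 2 * pi * of_int n"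
      using generic_direction by blast
    define z where "z k = exp (\<i> * of_real (dot \<theta> k))" for k
    \<comment> \<open>Summing over k gives the average of the vanishing transform at the points i m
      with m < n. For fixed k, as n grows, the term tends to \<open>u 0\<close> if k = 0 and to 0
      otherwise.\<close>
    define f where "f n k = of_real (u (- k)) * ((\<Sum>m<n. z k ^ m) / of_nat n)" for n k
    have norm_z: "norm (z k) = 1" for k by (simp add: z_def)
    obtain M where M: "M summable_on UNIV"
      "\<And>w k. \<bar>Re w\<bar> * norm \<theta> \<le> \<alpha> / 4 \<Longrightarrow> norm (fourier_term \<theta> 0 w k) \<le> M k"
      using fourier_term_bound[of \<theta> 0] by blast
    have uM: "\<bar>u (- k)\<bar> \<le> M k" for k
      using M(2)[of 0 k] \<alpha>_pos by (simp add: fourier_term_def norm_mult)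
    have f_sum: "f n k = (\<Sum>m<n. fourier_term \<theta> 0 (\<i> * of_nat m) k / of_nat n)" for n k
      by (simp add: f_def fourier_term_def z_def exp_of_nat_mult[symmetric] sum_distrib_left
          sum_divide_distrib mult_ac)
    have "((\<lambda>k. f n k) has_sum (\<Sum>m<n. fourier \<theta> 0 (\<i> * of_nat m) / of_nat n)) UNIV" for n
      unfolding f_sum
    proof (intro has_sum_finite_sum)
      fix m assume "m \<in> {..<n}"
      have "(\<lambda>k. fourier_term \<theta> 0 (\<i> * of_nat m) k) summable_on UNIV"
        by (rule abs_summable_summable, rule Infinite_Sum.abs_summable_on_comparison_test'[OF M(1)])
           (rule M(2), use \<alpha>_pos in simp)
      then have "((\<lambda>k. fourier_term \<theta> 0 (\<i> * of_nat m) k) has_sum fourier \<theta> 0 (\<i> * of_nat m)) UNIV"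
        unfolding fourier_def by (rule has_sum_infsum)
      from has_sum_cmult_left[OF this, of "inverse (of_nat n)"]
      show "((\<lambda>k. fourier_term \<theta> 0 (\<i> * of_nat m) k / of_nat n) has_sum
          fourier \<theta> 0 (\<i> * of_nat m) / of_nat n) UNIV" by (simp add: divide_inverse)
    qed simp
    moreover have "fourier \<theta> 0 (\<i> * of_nat m) = 0" for m
      by (rule fourier_vanishes[OF zero strip(3)]) simp
    ultimately have "(\<Sum>\<^sub>\<infinity>k. f n k) = 0" for n by (simp add: infsumI)
    moreover have "(\<lambda>n. \<Sum>\<^sub>\<infinity>k. f n k) \<longlonglongrightarrow> (\<Sum>\<^sub>\<infinity>k :: int ^ 'd. if k = 0 then of_real (u 0) else 0)"
    proof (rule infsum_dominated_convergence[OF M(1)])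
      fix n :: nat and k
      have "norm (\<Sum>m<n. z k ^ m) \<le> (\<Sum>m<n. norm (z k ^ m))" by (rule norm_sum)
      also have "\<dots> = real n" by (simp add: norm_power norm_z)
      finally have "norm ((\<Sum>m<n. z k ^ m) / of_nat n) \<le> 1"
        by (cases "n = 0") (auto simp: norm_divide)
      then have "norm (f n k) \<le> \<bar>u (- k)\<bar> * 1"
        unfolding f_def norm_mult norm_of_real by (intro mult_left_mono) auto
      then show "norm (f n k) \<le> M k" using uM[of k] by simp
    next
      fix k
      show "(\<lambda>n. f n k) \<longlonglongrightarrow> (if k = 0 then of_real (u 0) else 0)"
      proof (cases "k = 0")
        case True
        have "z 0 = 1" by (simp add: z_def dot_def)
        then have "eventually (\<lambda>n. f n 0 = of_real (u 0)) sequentially"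
          unfolding f_def by (intro eventually_sequentiallyI[of 1]) simp
        then show ?thesis using True by (simp add: tendsto_eventually)
      next
        case False
        have "z k \<noteq> 1"
        proof
          assume "z k = 1"
          then obtain n :: int where "dot \<theta> k = of_int (2 * n) * pi"
            by (auto simp: z_def exp_eq_1)
          then show False using \<theta>[OF False, of n] by simp
        qed
        then have "(\<lambda>n. of_real (u (- k)) * ((\<Sum>m<n. z k ^ m) / of_nat n)) \<longlonglongrightarrow> of_real (u (- k)) * 0"
          by (intro tendsto_mult tendsto_const average_of_powers_tendsto_0 norm_z)
        then show ?thesis using False by (simp add: f_def)
      qed
    qed
    ultimately have "(\<Sum>\<^sub>\<infinity>k :: int ^ 'd. if k = 0 then of_real (u 0) else 0) = (0 :: complex)"
      by (simp add: LIMSEQ_const_iff)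
    moreover have "(\<Sum>\<^sub>\<infinity>k :: int ^ 'd. if k = 0 then of_real (u 0) else 0) = (of_real (u 0) :: complex)"
    proof -
      have "(\<Sum>\<^sub>\<infinity>k :: int ^ 'd. if k = 0 then of_real (u 0) else 0)
          = (\<Sum>\<^sub>\<infinity>k\<in>{0 :: int ^ 'd}. of_real (u 0) :: complex)"
        by (rule infsum_cong_neutral) auto
      then show ?thesis by simp
    qed
    ultimately show False using assms by simp
  qed
  then obtain J where "moment J \<noteq> 0" by blast
  \<comment> \<open>A nonzero moment of least total degree has only vanishing moments below
    it.\<close>
  from ex_has_least_nat[of "\<lambda>J. moment J \<noteq> 0", OF this, of multi_index_abs] obtain I
    where I: "moment I \<noteq> 0" "\<And>J. moment J \<noteq> 0 \<Longrightarrow> multi_index_abs I \<le> multi_index_abs J" by blast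
  have "moment J = 0" if "multi_index_less J I" for J
    using I(2)[of J] that by (force simp: multi_index_less_def)
  with I(1) show ?thesis unfolding leading_index_iff by blast
qed

end

section \<open>The Wegner estimate\<close>

text \<open>The complement of the support is a union of open null sets, and by Lindelof countably
  many of them already cover it.\<close>

lemma AE_measure_support:
  assumes sets: "sets \<nu> = sets borel"
  shows "AE x in \<nu>. x \<in> measure_support \<nu>"
proof -
  define F where "F = {U :: real set. open U \<and> emeasure \<nu> U = 0}"
  obtain F' where F': "F' \<subseteq> F" "countable F'" "\<Union>F' = \<Union>F"
    using Lindelof[of F] unfolding F_def by blast
  have "(\<Union>U\<in>F'. U) \<in> null_sets \<nu>"
    by (rule null_sets_UN'[OF F'(2)]) (use F'(1) sets in \<open>auto simp: F_def null_sets_def\<close>)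
  moreover have "- measure_support \<nu> \<subseteq> \<Union>F"
    by (auto simp: measure_support_def F_def not_gr_zero)
  ultimately show ?thesis using F'(3) by (intro AE_I'[of "\<Union>F'"]) auto
qed

text \<open>Unconditional, because both sides default to 0 without absolute convergence.
  Measurability of the potential can thus be proved on all configurations at once.\<close>

lemma infsum_real_eq_integral:
  fixes f :: "'k \<Rightarrow> real"
  shows "(\<Sum>\<^sub>\<infinity>k. f k) = (\<integral>k. f k \<partial>count_space UNIV)"
proof -
  have iff: "f summable_on UNIV \<longleftrightarrow> Infinite_Set_Sum.abs_summable_on f UNIV"
    using summable_on_iff_abs_summable_on_real[of f UNIV] unfolding abs_summable_equivalent .
  show ?thesis
  proof (cases "f summable_on UNIV")
    case True
    from infsetsum_infsum[OF True[unfolded iff]] show ?thesis by (simp add: infsetsum_def)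
  next
    case False
    from this[unfolded iff] have "\<not> integrable (count_space UNIV) f"
      unfolding Infinite_Set_Sum.abs_summable_on_def .
    then have "(\<integral>k. f k \<partial>count_space UNIV) = 0" by (rule not_integrable_integral_eq)
    with infsum_not_exists[OF False] show ?thesis by (rule trans[OF _ sym])
  qed
qed

lemma alloy_potential_measurable:
  assumes sets[measurable_cong]: "sets \<nu> = sets borel"
  shows "(\<lambda>\<omega>. alloy_potential u \<omega> x) \<in> borel_measurable (\<Pi>\<^sub>M k\<in>UNIV. \<nu>)"
proof -
  interpret sigma_finite_measure "count_space (UNIV :: (int ^ 'a) set)"
    by (rule sigma_finite_measure_count_space)
  have "(\<lambda>(k, \<omega>). \<omega> k * u (x - k)) \<in> borel_measurable (count_space UNIV \<Otimes>\<^sub>M (\<Pi>\<^sub>M k\<in>UNIV. \<nu>))"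
    by (rule measurable_pair_measure_countable1) auto
  then have "(\<lambda>(\<omega>, k). \<omega> k * u (x - k)) \<in> borel_measurable ((\<Pi>\<^sub>M k\<in>UNIV. \<nu>) \<Otimes>\<^sub>M count_space UNIV)"
    by (subst measurable_pair_swap_iff) (simp add: case_prod_unfold)
  then show ?thesis
    unfolding alloy_potential_def infsum_real_eq_integral by (rule borel_measurable_lebesgue_integral)
qed

text \<open>The probabilistic half of the argument, for an arbitrary finitely supported direction
  \<open>t\<close> that raises the convolution to 1/2 on the box.\<close>

lemma expectation_trace_le:
  fixes u :: "int ^ 'd \<Rightarrow> real" and \<rho> :: "real \<Rightarrow> real"
  assumes u: "(\<lambda>k. \<bar>u k\<bar>) summable_on UNIV"
    and prob: "prob_space \<nu>" and supp: "compact (measure_support \<nu>)"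
    and \<rho>: "\<rho> \<in> BV" "AE x in lborel. 0 \<le> \<rho> x" and \<nu>: "\<nu> = density lborel (\<lambda>x. ennreal (\<rho> x))"
    and lam: "lam > 0" and I: "I \<subseteq> {a..b}" and \<epsilon>: "0 < \<epsilon>" and ab: "a \<le> b"
    and S: "finite S" "\<And>k. k \<notin> S \<Longrightarrow> t k = 0"
    and cover: "\<And>x. x \<in> cube l \<Longrightarrow> 1 / 2 \<le> (\<Sum>k\<in>S. t k * u (x - k))"
  shows "(\<integral>\<^sup>+ \<omega>. ennreal (Re (ell2_trace (cube l)
            (spectral_projection_on (cube l)
              (compression (cube l) (alloy_hamiltonian lam u \<omega>)) I))) \<partial>(\<Pi>\<^sub>M k\<in>UNIV. \<nu>))
    \<le> ennreal (real (card (cube l :: (int ^ 'd) set)) * (2 * (b - a + \<epsilon>) / lam * (\<Sum>k\<in>S. \<bar>t k\<bar>) * var_norm \<rho>))"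
proof -
  define L where "L = (cube l :: (int ^ 'd) set)"
  have finL: "finite L" unfolding L_def by (rule finite_cube)
  define N where "N = (\<Pi>\<^sub>M k\<in>(UNIV :: (int ^ 'd) set). \<nu>)"
  \<comment> \<open>Times \<open>lam\<close> and the covering constant 1/2, this is a gain of
    exactly b - a + \<epsilon>.\<close>
  define s where "s = 2 * (b - a + \<epsilon>) / lam"
  have s: "s > 0" "lam * s = 2 * (b - a + \<epsilon>)" using lam \<epsilon> ab by (auto simp: s_def)
  define shift where "shift \<omega> = (\<lambda>k. \<omega> k + s * t k)" for \<omega> :: "int ^ 'd \<Rightarrow> real"
  define W where "W \<omega> x = lam * alloy_potential u \<omega> x" for \<omega> x
  define g where "g \<omega> = real (box_count L (W \<omega>) (b + \<epsilon>))" for \<omega> :: "int ^ 'd \<Rightarrow> real"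
  interpret \<nu>: prob_space \<nu> by (rule prob)
  interpret N: prob_space N unfolding N_def by (intro prob_space_PiM prob)
  have sets_\<nu>: "sets \<nu> = sets borel" by (simp add: \<nu>)
  have int_\<rho>: "integrable lborel \<rho>" using \<rho>(1) by (simp add: BV_def)
  have gm: "g \<in> borel_measurable N"
    unfolding g_def N_def W_def
    by (intro box_count_measurable[OF finL] borel_measurable_times borel_measurable_const
        alloy_potential_measurable sets_\<nu>)
  have "shift \<in> N \<rightarrow>\<^sub>M N"
    unfolding N_def shift_def
    by (rule measurable_PiM_single') (auto simp: space_PiM \<nu>)
  then have gsm: "(\<lambda>\<omega>. g (shift \<omega>)) \<in> borel_measurable N" using gm by (rule measurable_compose)
  have g_bounds: "0 \<le> g \<omega>" "g \<omega> \<le> real (card L)" for \<omega>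
    unfolding g_def box_count_def
    using hermitian_on.count_below_le[OF hermitian_box_operator[OF finL]] by auto
  have int_g: "integrable N g" and int_gs: "integrable N (\<lambda>\<omega>. g (shift \<omega>))"
    using g_bounds gm gsm by (auto intro!: N.integrable_const_bound[of _ "real (card L)"])
  obtain M where M: "\<And>x. x \<in> measure_support \<nu> \<Longrightarrow> \<bar>x\<bar> \<le> M"
    using compact_imp_bounded[OF supp] unfolding bounded_real by blast
  have "AE x in \<nu>. \<bar>x\<bar> \<le> M" using AE_measure_support[OF sets_\<nu>] by eventually_elim (rule M)
  then have "AE \<omega> in N. \<bar>\<omega> k\<bar> \<le> M" for k
    unfolding N_def by (rule AE_PiM_component[rotated 2]) (auto intro: prob)
  then have "AE \<omega> in N. \<forall>k. \<bar>\<omega> k\<bar> \<le> M" by (simp add: AE_all_countable)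
  \<comment> \<open>Only almost sure, since linearity of the potential along the shift uses
    convergence of its series, here ensured by bounded couplings. Nonnegativity of the difference
    lets its nonnegative integral be computed as an ordinary one.\<close>
  then have key: "AE \<omega> in N. Re (ell2_trace L (spectral_projection_on L
      (compression L (alloy_hamiltonian lam u \<omega>)) I)) \<le> g \<omega> - g (shift \<omega>) \<and> 0 \<le> g \<omega> - g (shift \<omega>)"
  proof eventually_elim
    fix \<omega> :: "int ^ 'd \<Rightarrow> real" assume \<omega>: "\<forall>k. \<bar>\<omega> k\<bar> \<le> M"
    interpret A: hermitian_on L "box_operator L (W \<omega>)" by (rule hermitian_box_operator[OF finL])
    have "W \<omega> x + (b - a + \<epsilon>) \<le> W (shift \<omega>) x" if x: "x \<in> L" for x
    proof -
      have "bij_betw (\<lambda>k. x - k) UNIV UNIV"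
        by (rule bij_betw_byWitness[where f' = "\<lambda>k. x - k"]) auto
      from summable_on_reindex_bij_betw[OF this, of "\<lambda>k. \<bar>u k\<bar>"] u
      have "(\<lambda>k. M * \<bar>u (x - k)\<bar>) summable_on UNIV" by (simp add: summable_on_cmult_right)
      then have "(\<lambda>k. \<omega> k * u (x - k)) summable_on UNIV"
      proof (rule abs_summable_summable[OF Infinite_Sum.abs_summable_on_comparison_test'])
        show "norm (\<omega> k * u (x - k)) \<le> M * \<bar>u (x - k)\<bar>" for k
          using \<omega> by (simp add: abs_mult mult_right_mono)
      qed
      moreover have "((\<lambda>k. s * t k * u (x - k)) has_sum (\<Sum>k\<in>S. s * t k * u (x - k))) UNIV"
        by (rule has_sum_cong_neutral[THEN iffD1, OF _ _ _ has_sum_finite[OF S(1)]]) (auto simp: S(2))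
      ultimately have "((\<lambda>k. \<omega> k * u (x - k) + s * t k * u (x - k)) has_sum
          (alloy_potential u \<omega> x + (\<Sum>k\<in>S. s * t k * u (x - k)))) UNIV"
        unfolding alloy_potential_def by (intro has_sum_add has_sum_infsum)
      then have "alloy_potential u (shift \<omega>) x
          = alloy_potential u \<omega> x + s * (\<Sum>k\<in>S. t k * u (x - k))"
        unfolding alloy_potential_def shift_def
        by (simp add: distrib_right infsumI sum_distrib_left mult.assoc)
      then have "W (shift \<omega>) x = W \<omega> x + (lam * s) * (\<Sum>k\<in>S. t k * u (x - k))"
        by (simp add: W_def distrib_left)
      moreover have "(lam * s) * (1 / 2) \<le> (lam * s) * (\<Sum>k\<in>S. t k * u (x - k))"
        using lam s(1) x by (intro mult_left_mono cover) (auto simp: L_def)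
      ultimately show ?thesis using s(2) by simp
    qed
    \<comment> \<open>Eigenvalues of the shifted operator below b + \<epsilon> are no more than
      those of the original one below \<open>a\<close>.\<close>
    then have "box_count L (W (shift \<omega>)) (b + \<epsilon>) \<le> box_count L (W \<omega>) (b + \<epsilon> - (b - a + \<epsilon>))"
      by (rule box_count_antimono[OF finL])
    then have 1: "g (shift \<omega>) \<le> real (A.count_below a)" by (simp add: g_def box_count_def)
    have "Re (ell2_trace L (spectral_projection_on L (box_operator L (W \<omega>)) I))
        \<le> real (A.count_below (b + \<epsilon>)) - real (A.count_below a)"
      using I \<epsilon> ab by (intro A.trace_spectral_projection_le) auto
    moreover have "real (A.count_below a) \<le> g \<omega>"
      unfolding g_def box_count_def using A.count_below_mono[of a "b + \<epsilon>"] \<epsilon> ab by simp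
    ultimately show "Re (ell2_trace L (spectral_projection_on L
        (compression L (alloy_hamiltonian lam u \<omega>)) I)) \<le> g \<omega> - g (shift \<omega>)
        \<and> 0 \<le> g \<omega> - g (shift \<omega>)"
      using 1 by (simp add: compression_alloy_hamiltonian W_def[symmetric] g_def box_count_def)
  qed
  have "(\<integral>\<^sup>+ \<omega>. ennreal (Re (ell2_trace L (spectral_projection_on L
      (compression L (alloy_hamiltonian lam u \<omega>)) I))) \<partial>N) \<le> (\<integral>\<^sup>+ \<omega>. ennreal (g \<omega> - g (shift \<omega>)) \<partial>N)"
    by (rule nn_integral_mono_AE) (use key in \<open>eventually_elim, auto intro: ennreal_leI\<close>)
  also have "\<dots> = ennreal (\<integral>\<omega>. g \<omega> - g (shift \<omega>) \<partial>N)"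
    using int_g int_gs key by (intro nn_integral_eq_integral Bochner_Integration.integrable_diff) auto
  also have "\<dots> \<le> ennreal (real (card L) * (s * (\<Sum>k\<in>S. \<bar>t k\<bar>) * var_norm \<rho>))"
  proof (rule ennreal_leI)
    have "(\<integral>\<omega>. g \<omega> - g (shift \<omega>) \<partial>N) = (\<integral>\<omega>. g \<omega> \<partial>N) - (\<integral>\<omega>. g (shift \<omega>) \<partial>N)"
      by (rule Bochner_Integration.integral_diff[OF int_g int_gs])
    \<comment> \<open>The bound on \<open>g\<close> produces one volume factor; the sum over
      \<open>S\<close> will carry the other.\<close>
    also have "\<dots> \<le> real (card L) * (\<Sum>k\<in>S. \<integral>x. \<bar>\<rho> x - \<rho> (x - s * t k)\<bar> \<partial>lborel)"
      unfolding N_def shift_def \<nu>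
      using prob gm g_bounds S
      by (intro expectation_shift_le int_\<rho> \<rho>(2)) (auto simp: N_def \<nu>)
    also have "\<dots> \<le> real (card L) * (\<Sum>k\<in>S. \<bar>s * t k\<bar> * var_norm \<rho>)"
      by (intro mult_left_mono sum_mono BV_translation \<rho>(1)) auto
    also have "\<dots> = real (card L) * (s * (\<Sum>k\<in>S. \<bar>t k\<bar>) * var_norm \<rho>)"
      using s(1) by (simp add: abs_mult sum_distrib_left sum_distrib_right mult.assoc)
    finally show "(\<integral>\<omega>. g \<omega> - g (shift \<omega>) \<partial>N) \<le> real (card L) * (s * (\<Sum>k\<in>S. \<bar>t k\<bar>) * var_norm \<rho>)" .
  qed
  finally show ?thesis by (simp add: L_def N_def s_def)
qed

text \<open>A nonempty bounded interval contains the open interval between its infimum and supremum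
  and differs from it by at most two points, whence it is measurable with the expected
  length.\<close>

lemma bounded_interval_hull:
  fixes I :: "real set"
  assumes I: "is_interval I" "bounded I"
  shows "\<exists>a b. a \<le> b \<and> I \<subseteq> {a..b} \<and> b - a = measure lborel I"
proof (cases "I = {}")
  case True
  then show ?thesis by (intro exI[of _ 0]) auto
next
  case False
  have bdd: "bdd_below I" "bdd_above I"
    by (rule bounded_imp_bdd_below[OF I(2)], rule bounded_imp_bdd_above[OF I(2)])
  have sub: "I \<subseteq> {Inf I..Sup I}" using bdd by (auto intro: cInf_lower cSup_upper)
  have le: "Inf I \<le> Sup I" by (rule cInf_le_cSup[OF False bdd(2,1)])
  have inner: "{Inf I<..<Sup I} \<subseteq> I"
  proof
    fix x assume x: "x \<in> {Inf I<..<Sup I}"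
    then obtain y where "y \<in> I" "y < x" using cInf_less_iff[OF False bdd(1)] by auto
    moreover obtain z where "z \<in> I" "x < z" using less_cSup_iff[OF False bdd(2)] x by auto
    ultimately show "x \<in> I" using mem_is_interval_1_I[OF I(1), of y z x] by simp
  qed
  have "I - {Inf I<..<Sup I} \<subseteq> {Inf I, Sup I}" using sub by force
  then have "finite (I - {Inf I<..<Sup I})" by (rule finite_subset) simp
  then have "I - {Inf I<..<Sup I} \<in> sets lborel" by (simp add: finite_imp_closed)
  then have meas: "I \<in> sets lborel"
    using sets.Un[of "{Inf I<..<Sup I}" lborel "I - {Inf I<..<Sup I}"] inner by (simp add: Un_absorb1)
  have fin: "emeasure lborel I < \<infinity>" using I(2) by (rule emeasure_bounded_finite)
  have "measure lborel {Inf I<..<Sup I} \<le> measure lborel I"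
    using inner meas fin by (intro measure_mono_fmeasurable) (auto simp: fmeasurable_def)
  moreover have "measure lborel I \<le> measure lborel {Inf I..Sup I}"
    using sub meas by (intro measure_mono_fmeasurable) (auto simp: fmeasurable_def emeasure_lborel_Icc_eq)
  ultimately have "Sup I - Inf I = measure lborel I" using le by simp
  with sub le show ?thesis by blast
qed

theorem theorem2p7:
  fixes u :: "int ^ 'd \<Rightarrow> real"
  assumes u_summable: "(\<lambda>k. \<bar>u k\<bar>) summable_on UNIV"
    and u_0: "u 0 \<noteq> 0"
    and u_decay: "\<exists>C \<alpha>. C > 0 \<and> \<alpha> > 0 \<and> (\<forall>k. \<bar>u k\<bar> \<le> C * exp (- \<alpha> * real_of_int (norm1 k)))"
  shows "(\<exists>I\<^sub>0. leading_index u I\<^sub>0) \<and>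
    (\<forall>I\<^sub>0. leading_index u I\<^sub>0 \<longrightarrow>
      (\<exists>Cu > 0. \<forall>(\<nu> :: real measure) (\<rho> :: real \<Rightarrow> real) (lam :: real) (l :: nat) (I :: real set).
        prob_space \<nu> \<and> compact (measure_support \<nu>) \<and>
        \<rho> \<in> BV \<and> (AE x in lborel. 0 \<le> \<rho> x) \<and> \<nu> = density lborel (\<lambda>x. ennreal (\<rho> x)) \<and>
        lam > 0 \<and> is_interval I \<and> bounded I \<longrightarrow>
        (\<integral>\<^sup>+ \<omega>. ennreal (Re (ell2_trace (cube l)
            (spectral_projection_on (cube l)
              (compression (cube l) (alloy_hamiltonian lam u \<omega>)) I))) \<partial>(\<Pi>\<^sub>M k\<in>UNIV. \<nu>))
        \<le> ennreal (inverse lam * Cu * var_norm \<rho> * measure lborel I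
            * (2 * real l + 1) ^ (2 * CARD('d) + multi_index_abs I\<^sub>0))))"
proof -
  obtain C \<alpha> where "C > 0" "\<alpha> > 0" "\<And>k. \<bar>u k\<bar> \<le> C * exp (- \<alpha> * real_of_int (norm1 k))"
    using u_decay by blast
  then interpret decaying_potential u C \<alpha> by unfold_locales
  show ?thesis
  proof (intro conjI allI impI)
    show "\<exists>I\<^sub>0. leading_index u I\<^sub>0" by (rule leading_index_exists[OF u_0])
  next
    fix I\<^sub>0 assume I\<^sub>0: "leading_index u I\<^sub>0"
    \<comment> \<open>Obtained before the law, the coupling constant, the box and the interval are
      fixed, so it depends only on \<open>u\<close> and the index.\<close>
    obtain K where K: "K > 0" and weights: "\<And>l. \<exists>t S. finite S \<and> (\<forall>k. k \<notin> S \<longrightarrow> t k = 0) \<and>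
      (\<forall>x\<in>cube l. 1 / 2 \<le> (\<Sum>k\<in>S. t k * u (x - k))) \<and>
      (\<Sum>k\<in>S. \<bar>t k\<bar>) \<le> K * (2 * real l + 1) ^ (CARD('d) + multi_index_abs I\<^sub>0)"
      using covering_weights[OF I\<^sub>0] by blast
    show "\<exists>Cu > 0. \<forall>(\<nu> :: real measure) (\<rho> :: real \<Rightarrow> real) (lam :: real) (l :: nat) (I :: real set).
        prob_space \<nu> \<and> compact (measure_support \<nu>) \<and>
        \<rho> \<in> BV \<and> (AE x in lborel. 0 \<le> \<rho> x) \<and> \<nu> = density lborel (\<lambda>x. ennreal (\<rho> x)) \<and>
        lam > 0 \<and> is_interval I \<and> bounded I \<longrightarrow>
        (\<integral>\<^sup>+ \<omega>. ennreal (Re (ell2_trace (cube l)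
            (spectral_projection_on (cube l)
              (compression (cube l) (alloy_hamiltonian lam u \<omega>)) I))) \<partial>(\<Pi>\<^sub>M k\<in>UNIV. \<nu>))
        \<le> ennreal (inverse lam * Cu * var_norm \<rho> * measure lborel I
            * (2 * real l + 1) ^ (2 * CARD('d) + multi_index_abs I\<^sub>0))"
    \<comment> \<open>The 2 is the one in the shift length, caused by the covering constant
      1/2.\<close>
    proof (intro exI[of _ "2 * K"] conjI allI impI)
      show "0 < 2 * K" using K by simp
    next
      fix \<nu> :: "real measure" and \<rho> :: "real \<Rightarrow> real" and lam :: real and l :: nat and I :: "real set"
      assume "prob_space \<nu> \<and> compact (measure_support \<nu>) \<and>
        \<rho> \<in> BV \<and> (AE x in lborel. 0 \<le> \<rho> x) \<and> \<nu> = density lborel (\<lambda>x. ennreal (\<rho> x)) \<and>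
        lam > 0 \<and> is_interval I \<and> bounded I"
      then have A: "prob_space \<nu>" "compact (measure_support \<nu>)" "\<rho> \<in> BV" "AE x in lborel. 0 \<le> \<rho> x"
        "\<nu> = density lborel (\<lambda>x. ennreal (\<rho> x))" "lam > 0" "is_interval I" "bounded I" by auto
      define T where "T = (\<integral>\<^sup>+ \<omega>. ennreal (Re (ell2_trace (cube l)
            (spectral_projection_on (cube l)
              (compression (cube l) (alloy_hamiltonian lam u \<omega>)) I))) \<partial>(\<Pi>\<^sub>M k\<in>UNIV. \<nu>))"
      define m where "m = measure lborel I"
      define P where "P = (2 * real l + 1) ^ (2 * CARD('d) + multi_index_abs I\<^sub>0)"
      obtain a b where ab: "a \<le> b" "I \<subseteq> {a..b}" "b - a = m"
        using bounded_interval_hull[OF A(7,8)] unfolding m_def by blast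
      obtain t S where tS: "finite S" "\<And>k. k \<notin> S \<Longrightarrow> t k = 0"
        "\<And>x. x \<in> cube l \<Longrightarrow> 1 / 2 \<le> (\<Sum>k\<in>S. t k * u (x - k))"
        "(\<Sum>k\<in>S. \<bar>t k\<bar>) \<le> K * (2 * real l + 1) ^ (CARD('d) + multi_index_abs I\<^sub>0)"
        using weights[of l] by blast
      have P: "P = (2 * real l + 1) ^ CARD('d) * (2 * real l + 1) ^ (CARD('d) + multi_index_abs I\<^sub>0)"
        unfolding P_def by (simp only: power_add[symmetric] mult_2 add.assoc)
      have card: "real (card (cube l :: (int ^ 'd) set)) = (2 * real l + 1) ^ CARD('d)"
        by (simp add: card_cube add.commute)
      have var: "0 \<le> var_norm \<rho>" by (simp add: var_norm_def)
      have bound: "T \<le> ennreal (inverse lam * (2 * K) * var_norm \<rho> * (m + \<epsilon>) * P)" if \<epsilon>: "0 < \<epsilon>" for \<epsilon>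
      proof -
        have "T \<le> ennreal (real (card (cube l :: (int ^ 'd) set))
            * (2 * (b - a + \<epsilon>) / lam * (\<Sum>k\<in>S. \<bar>t k\<bar>) * var_norm \<rho>))"
          unfolding T_def by (rule expectation_trace_le[OF u_summable A(1-6) ab(2) \<epsilon> ab(1) tS(1-3)])
        also have "\<dots> \<le> ennreal (real (card (cube l :: (int ^ 'd) set)) * (2 * (b - a + \<epsilon>) / lam
            * (K * (2 * real l + 1) ^ (CARD('d) + multi_index_abs I\<^sub>0)) * var_norm \<rho>))"
          using A(6) \<epsilon> ab(1) tS(4) var
          by (intro ennreal_leI mult_left_mono mult_right_mono) auto
        also have "\<dots> = ennreal (inverse lam * (2 * K) * var_norm \<rho> * (m + \<epsilon>) * P)"
          unfolding ab(3) P card by (simp add: divide_inverse mult_ac)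
        finally show ?thesis .
      qed
      \<comment> \<open>The left side does not involve \<epsilon>, so letting \<epsilon> = 1/(n + 1)
        tend to 0 restores the exact length of the interval.\<close>
      have "(\<lambda>n. ennreal (inverse lam * (2 * K) * var_norm \<rho> * (m + 1 / real (Suc n)) * P))
          \<longlonglongrightarrow> ennreal (inverse lam * (2 * K) * var_norm \<rho> * (m + 0) * P)"
        by (intro tendsto_ennrealI tendsto_intros lim_1_over_n[THEN LIMSEQ_Suc])
      then have "T \<le> ennreal (inverse lam * (2 * K) * var_norm \<rho> * (m + 0) * P)"
        by (rule LIMSEQ_le_const) (intro exI[of _ 0] allI impI bound, simp)
      then show "(\<integral>\<^sup>+ \<omega>. ennreal (Re (ell2_trace (cube l)
            (spectral_projection_on (cube l)
              (compression (cube l) (alloy_hamiltonian lam u \<omega>)) I))) \<partial>(\<Pi>\<^sub>M k\<in>UNIV. \<nu>))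
        \<le> ennreal (inverse lam * (2 * K) * var_norm \<rho> * measure lborel I
            * (2 * real l + 1) ^ (2 * CARD('d) + multi_index_abs I\<^sub>0))"
        by (simp add: T_def m_def P_def)
    qed
  qed
qed

end
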